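(* Let $R$ be a reduced commutative unital ring whose set $\mathrm{min}(R)$ of minimal prime ideals is finite. Put $T=\prod_{\mathfrak{p}\in\mathrm{min}(R)}(R/\mathfrak{p})^+$, regarded as an extension ring of $R$ via the natural injection $R\to\prod_{\mathfrak{p}\in\mathrm{min}(R)}R/\mathfrak{p}\subseteq T$. Then: (1) $T$ is the universal aic of $R$. (2) An aic of $R$ is isomorphic to $T$ (as an $R$-algebra) if and only if it contains precisely $2^{|\mathrm{min}(R)|}$ idempotents, that is, if and only if it has $|\mathrm{min}(R)|$ connected components.
   Context: All rings are commutative and unital; the trivial ring is allowed. A ring extension $R\subseteq S$ is tight if every non-zero ideal of $S$ has non-zero intersection with $R$. A ring $S$ is absolutely integrally closed (ai closed) if every monic polynomial in $S[X]$ factorizes as a product of monic linear polynomials in $S[X]$ (uniqueness of the factorization is not required). An absolute integral closure (aic) of $R$ is an extension ring $S\supseteq R$ that is ai closed, integral over $R$ and tight over $R$. A universal aic of $R$ is an aic of $R$ into which every aic of $R$ can be embedded as an $R$-algebra. For an integral domain $D$, $D^+$ denotes the integral closure of $D$ in an algebraic closure of its field of fractions. *)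

theory Defs
  imports "HOL-Algebra.Algebra" "HOL-Analysis.Abstract_Topology_2"
begin

text \<open>
  A ring extension of \<open>R\<close> is rendered as a commutative ring \<open>S\<close> together with an
  injective unital homomorphism \<open>\<phi>\<close> from \<open>R\<close> to \<open>S\<close>; the copy of \<open>R\<close> inside \<open>S\<close> is
  \<open>\<phi> ` carrier R\<close>.  The locale \<^locale>\<open>cring\<close> admits the trivial ring, and \<^const>\<open>ring_hom\<close>
  preserves the unit.
\<close>

definition ring_extension ::
    "('a, 'm) ring_scheme \<Rightarrow> ('b, 'n) ring_scheme \<Rightarrow> ('a \<Rightarrow> 'b) \<Rightarrow> bool" where
  "ring_extension R S \<phi> \<longleftrightarrow>
     cring R \<and> cring S \<and> \<phi> \<in> ring_hom R S \<and> inj_on \<phi> (carrier R)"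

definition tight_extension ::
    "('a, 'm) ring_scheme \<Rightarrow> ('b, 'n) ring_scheme \<Rightarrow> ('a \<Rightarrow> 'b) \<Rightarrow> bool" where
  "tight_extension R S \<phi> \<longleftrightarrow>
     (\<forall>I. ideal I S \<and> I \<noteq> {\<zero>\<^bsub>S\<^esub>} \<longrightarrow> I \<inter> \<phi> ` carrier R \<noteq> {\<zero>\<^bsub>S\<^esub>})"

text \<open>
  Polynomials are those of \<^const>\<open>UP\<close>, whose elements are functions of finite support;
  over the trivial ring the only polynomial, zero, counts as monic.
\<close>

definition monic_poly :: "('a, 'm) ring_scheme \<Rightarrow> (nat \<Rightarrow> 'a) \<Rightarrow> bool" where
  "monic_poly R f \<longleftrightarrow>
     f \<in> carrier (UP R) \<and> up_ring.coeff (UP R) f (deg R f) = \<one>\<^bsub>R\<^esub>"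

definition integral_element ::
    "('a, 'm) ring_scheme \<Rightarrow> ('b, 'n) ring_scheme \<Rightarrow> ('a \<Rightarrow> 'b) \<Rightarrow> 'b \<Rightarrow> bool" where
  "integral_element R S \<phi> s \<longleftrightarrow>
     s \<in> carrier S \<and> (\<exists>f. monic_poly R f \<and> UnivPoly.eval R S \<phi> s f = \<zero>\<^bsub>S\<^esub>)"

definition integral_extension ::
    "('a, 'm) ring_scheme \<Rightarrow> ('b, 'n) ring_scheme \<Rightarrow> ('a \<Rightarrow> 'b) \<Rightarrow> bool" where
  "integral_extension R S \<phi> \<longleftrightarrow> (\<forall>s \<in> carrier S. integral_element R S \<phi> s)"

definition ai_closed :: "('a, 'm) ring_scheme \<Rightarrow> bool" where
  "ai_closed S \<longleftrightarrow>
     (\<forall>f. monic_poly S f \<longrightarrow>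
       (\<exists>(n::nat) a. a \<in> {..<n} \<rightarrow> carrier S \<and>
          f = finprod (UP S)
                (\<lambda>i. up_ring.monom (UP S) \<one>\<^bsub>S\<^esub> 1 \<ominus>\<^bsub>UP S\<^esub> up_ring.monom (UP S) (a i) 0) {..<n}))"

definition aic :: "('a, 'm) ring_scheme \<Rightarrow> ('b, 'n) ring_scheme \<Rightarrow> ('a \<Rightarrow> 'b) \<Rightarrow> bool" where
  "aic R S \<phi> \<longleftrightarrow>
     ring_extension R S \<phi> \<and> ai_closed S \<and> integral_extension R S \<phi> \<and> tight_extension R S \<phi>"

definition algebra_embeds ::
    "('a, 'm) ring_scheme \<Rightarrow> ('b, 'n) ring_scheme \<Rightarrow> ('a \<Rightarrow> 'b)
      \<Rightarrow> ('c, 'k) ring_scheme \<Rightarrow> ('a \<Rightarrow> 'c) \<Rightarrow> bool" where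
  "algebra_embeds R S \<phi> T \<psi> \<longleftrightarrow>
     (\<exists>h \<in> ring_hom S T. inj_on h (carrier S) \<and> (\<forall>r \<in> carrier R. h (\<phi> r) = \<psi> r))"

definition algebra_iso ::
    "('a, 'm) ring_scheme \<Rightarrow> ('b, 'n) ring_scheme \<Rightarrow> ('a \<Rightarrow> 'b)
      \<Rightarrow> ('c, 'k) ring_scheme \<Rightarrow> ('a \<Rightarrow> 'c) \<Rightarrow> bool" where
  "algebra_iso R S \<phi> T \<psi> \<longleftrightarrow>
     (\<exists>h \<in> ring_iso S T. \<forall>r \<in> carrier R. h (\<phi> r) = \<psi> r)"

text \<open>
  A definition cannot quantify over types, so universality is relative to the type of the
  elements of the competing rings; a theorem with that type left as a variable asserts
  universality among all absolute integral closures.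
\<close>

definition universal_aic ::
    "'c itself \<Rightarrow> ('a, 'm) ring_scheme \<Rightarrow> ('b, 'n) ring_scheme \<Rightarrow> ('a \<Rightarrow> 'b) \<Rightarrow> bool" where
  "universal_aic _ R T \<psi> \<longleftrightarrow>
     aic R T \<psi> \<and> (\<forall>(S :: 'c ring) \<phi>. aic R S \<phi> \<longrightarrow> algebra_embeds R S \<phi> T \<psi>)"

definition reduced_ring :: "('a, 'm) ring_scheme \<Rightarrow> bool" where
  "reduced_ring R \<longleftrightarrow>
     cring R \<and> (\<forall>x \<in> carrier R. \<forall>n::nat. x [^]\<^bsub>R\<^esub> n = \<zero>\<^bsub>R\<^esub> \<longrightarrow> x = \<zero>\<^bsub>R\<^esub>)"

definition min_primes :: "('a, 'm) ring_scheme \<Rightarrow> 'a set set" where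
  "min_primes R = {p. primeideal p R \<and> (\<forall>q. primeideal q R \<and> q \<subseteq> p \<longrightarrow> q = p)}"

definition idempotents :: "('a, 'm) ring_scheme \<Rightarrow> 'a set" where
  "idempotents S = {e \<in> carrier S. e \<otimes>\<^bsub>S\<^esub> e = e}"

text \<open>The prime spectrum with the Zariski topology, generated by the basic open sets.\<close>

definition Spec :: "('a, 'm) ring_scheme \<Rightarrow> 'a set topology" where
  "Spec S = topology_generated_by {{p. primeideal p S \<and> f \<notin> p} | f. f \<in> carrier S}"

lemma topspace_Spec:
  assumes "cring S"
  shows "topspace (Spec S) = {p. primeideal p S}"
proof -
  interpret cring S by fact
  have "\<one>\<^bsub>S\<^esub> \<notin> p" if "primeideal p S" for p
    using that by (metis ideal.one_imp_carrier primeideal.I_notcarr primeideal.axioms(1))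
  then show ?thesis
    unfolding Spec_def topology_generated_by_topspace by blast
qed

text \<open>The element \<open>fraction D a b\<close> of the field of fractions is the class of all pairs \<open>(c, d)\<close> with
  \<open>c / d = a / b\<close>.\<close>

definition fraction :: "('a, 'm) ring_scheme \<Rightarrow> 'a \<Rightarrow> 'a \<Rightarrow> ('a \<times> 'a) set" where
  "fraction D a b =
     {(c, d). c \<in> carrier D \<and> d \<in> carrier D - {\<zero>\<^bsub>D\<^esub>} \<and> a \<otimes>\<^bsub>D\<^esub> d = c \<otimes>\<^bsub>D\<^esub> b}"

definition fraction_field :: "('a, 'm) ring_scheme \<Rightarrow> ('a \<times> 'a) set ring" where
  "fraction_field D =
     \<lparr> carrier = {fraction D a b | a b. a \<in> carrier D \<and> b \<in> carrier D - {\<zero>\<^bsub>D\<^esub>}},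
       monoid.mult = (\<lambda>A B. \<Union>(a, b) \<in> A. \<Union>(c, d) \<in> B. fraction D (a \<otimes>\<^bsub>D\<^esub> c) (b \<otimes>\<^bsub>D\<^esub> d)),
       one = fraction D \<one>\<^bsub>D\<^esub> \<one>\<^bsub>D\<^esub>,
       ring.zero = fraction D \<zero>\<^bsub>D\<^esub> \<one>\<^bsub>D\<^esub>,
       ring.add = (\<lambda>A B. \<Union>(a, b) \<in> A. \<Union>(c, d) \<in> B.
                fraction D (a \<otimes>\<^bsub>D\<^esub> d \<oplus>\<^bsub>D\<^esub> c \<otimes>\<^bsub>D\<^esub> b) (b \<otimes>\<^bsub>D\<^esub> d)) \<rparr>"

lemma fraction_UN_const:
  assumes "\<And>x y z w. (x, y) \<in> A \<Longrightarrow> (z, w) \<in> B \<Longrightarrow> f x y z w = C"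
    and "(a, b) \<in> A" "(c, d) \<in> B"
  shows "(\<Union>(x, y) \<in> A. \<Union>(z, w) \<in> B. f x y z w) = C"
proof (intro equalityI subsetI)
  fix t assume "t \<in> (\<Union>(x, y) \<in> A. \<Union>(z, w) \<in> B. f x y z w)"
  then obtain x y z w where "(x, y) \<in> A" "(z, w) \<in> B" "t \<in> f x y z w" by auto
  then show "t \<in> C" using assms(1) by simp
next
  fix t assume "t \<in> C"
  then have "t \<in> f a b c d" using assms by simp
  then show "t \<in> (\<Union>(x, y) \<in> A. \<Union>(z, w) \<in> B. f x y z w)"
    using assms(2,3) by (intro UN_I[of "(a, b)"]) (auto intro!: UN_I[of "(c, d)"])
qed

context "domain"
begin

lemma fraction_eqI:
  assumes "a \<in> carrier R" "b \<in> carrier R - {\<zero>}" "c \<in> carrier R" "d \<in> carrier R - {\<zero>}"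
    and eq: "a \<otimes> d = c \<otimes> b"
  shows "fraction R a b = fraction R c d"
proof -
  have *: "fraction R a b \<subseteq> fraction R c d"
    if A: "a \<in> carrier R" "b \<in> carrier R - {\<zero>}" "c \<in> carrier R" "d \<in> carrier R - {\<zero>}"
      and eq: "a \<otimes> d = c \<otimes> b" for a b c d
  proof (clarsimp simp: fraction_def)
    fix x y assume xy: "x \<in> carrier R" "y \<in> carrier R" "a \<otimes> y = x \<otimes> b"
    have "b \<otimes> (c \<otimes> y) = (c \<otimes> b) \<otimes> y" using A xy(1,2) by (simp add: m_ac)
    also have "\<dots> = (a \<otimes> d) \<otimes> y" by (simp only: eq)
    also have "\<dots> = (a \<otimes> y) \<otimes> d" using A xy(1,2) by (simp add: m_ac)
    also have "\<dots> = (x \<otimes> b) \<otimes> d" by (simp only: xy)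
    also have "\<dots> = b \<otimes> (x \<otimes> d)" using A xy(1,2) by (simp add: m_ac)
    finally show "c \<otimes> y = x \<otimes> d" using A xy by (subst (asm) m_lcancel) auto
  qed
  show ?thesis
    using *[OF assms] *[OF assms(3,4,1,2) eq[symmetric]] by blast
qed

lemma fraction_eq_iff:
  assumes "a \<in> carrier R" "b \<in> carrier R - {\<zero>}" "c \<in> carrier R" "d \<in> carrier R - {\<zero>}"
  shows "fraction R a b = fraction R c d \<longleftrightarrow> a \<otimes> d = c \<otimes> b"
proof
  assume "fraction R a b = fraction R c d"
  moreover have "(c, d) \<in> fraction R c d" using assms by (simp add: fraction_def)
  ultimately show "a \<otimes> d = c \<otimes> b" by (auto simp: fraction_def)
qed (rule fraction_eqI[OF assms])

lemma fraction_mult: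
  assumes "a \<in> carrier R" "b \<in> carrier R - {\<zero>}" "c \<in> carrier R" "d \<in> carrier R - {\<zero>}"
  shows "fraction R a b \<otimes>\<^bsub>fraction_field R\<^esub> fraction R c d = fraction R (a \<otimes> c) (b \<otimes> d)"
proof -
  have "fraction R (x \<otimes> z) (y \<otimes> w) = fraction R (a \<otimes> c) (b \<otimes> d)"
    if "(x, y) \<in> fraction R a b" "(z, w) \<in> fraction R c d" for x y z w
  proof -
    have c: "x \<in> carrier R" "y \<in> carrier R - {\<zero>}" "z \<in> carrier R" "w \<in> carrier R - {\<zero>}"
      and e: "a \<otimes> y = x \<otimes> b" "c \<otimes> w = z \<otimes> d"
      using that by (auto simp: fraction_def)
    have "(x \<otimes> z) \<otimes> (b \<otimes> d) = (x \<otimes> b) \<otimes> (z \<otimes> d)" using assms c by (simp add: m_ac)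
    also have "\<dots> = (a \<otimes> y) \<otimes> (c \<otimes> w)" by (simp only: e)
    also have "\<dots> = (a \<otimes> c) \<otimes> (y \<otimes> w)" using assms c by (simp add: m_ac)
    finally show ?thesis
      using assms c by (intro fraction_eqI) (auto simp: integral_iff)
  qed
  moreover have "(a, b) \<in> fraction R a b" "(c, d) \<in> fraction R c d"
    using assms by (auto simp: fraction_def)
  ultimately have "(\<Union>(x, y) \<in> fraction R a b. \<Union>(z, w) \<in> fraction R c d. fraction R (x \<otimes> z) (y \<otimes> w))
      = fraction R (a \<otimes> c) (b \<otimes> d)"
    by (rule fraction_UN_const)
  then show ?thesis by (simp add: fraction_field_def)
qed

lemma fraction_add:
  assumes "a \<in> carrier R" "b \<in> carrier R - {\<zero>}" "c \<in> carrier R" "d \<in> carrier R - {\<zero>}"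
  shows "fraction R a b \<oplus>\<^bsub>fraction_field R\<^esub> fraction R c d
    = fraction R (a \<otimes> d \<oplus> c \<otimes> b) (b \<otimes> d)"
proof -
  have "fraction R (x \<otimes> w \<oplus> z \<otimes> y) (y \<otimes> w) = fraction R (a \<otimes> d \<oplus> c \<otimes> b) (b \<otimes> d)"
    if "(x, y) \<in> fraction R a b" "(z, w) \<in> fraction R c d" for x y z w
  proof -
    have c: "x \<in> carrier R" "y \<in> carrier R - {\<zero>}" "z \<in> carrier R" "w \<in> carrier R - {\<zero>}"
      and e: "a \<otimes> y = x \<otimes> b" "c \<otimes> w = z \<otimes> d"
      using that by (auto simp: fraction_def)
    have "(x \<otimes> w \<oplus> z \<otimes> y) \<otimes> (b \<otimes> d) = (x \<otimes> b) \<otimes> (w \<otimes> d) \<oplus> (z \<otimes> d) \<otimes> (y \<otimes> b)"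
      using assms c by (simp add: m_ac l_distr r_distr)
    also have "\<dots> = (a \<otimes> y) \<otimes> (w \<otimes> d) \<oplus> (c \<otimes> w) \<otimes> (y \<otimes> b)" by (simp only: e)
    also have "\<dots> = (a \<otimes> d \<oplus> c \<otimes> b) \<otimes> (y \<otimes> w)"
      using assms c by (simp add: m_ac l_distr r_distr)
    finally show ?thesis
      using assms c by (intro fraction_eqI) (auto simp: integral_iff)
  qed
  moreover have "(a, b) \<in> fraction R a b" "(c, d) \<in> fraction R c d"
    using assms by (auto simp: fraction_def)
  ultimately have "(\<Union>(x, y) \<in> fraction R a b. \<Union>(z, w) \<in> fraction R c d. fraction R (x \<otimes> w \<oplus> z \<otimes> y) (y \<otimes> w))
      = fraction R (a \<otimes> d \<oplus> c \<otimes> b) (b \<otimes> d)"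
    by (rule fraction_UN_const)
  then show ?thesis by (simp add: fraction_field_def)
qed

lemma fraction_field_is_field: "field (fraction_field R)"
proof -
  let ?F = "fraction_field R"
  have F: "carrier ?F = {fraction R a b | a b. a \<in> carrier R \<and> b \<in> carrier R - {\<zero>}}"
    "\<one>\<^bsub>?F\<^esub> = fraction R \<one> \<one>" "\<zero>\<^bsub>?F\<^esub> = fraction R \<zero> \<one>"
    by (simp_all add: fraction_field_def)
  have cl: "fraction R a b \<in> carrier ?F" if "a \<in> carrier R" "b \<in> carrier R - {\<zero>}" for a b
    using that F by blast
  have ex: "\<exists>a b. x = fraction R a b \<and> a \<in> carrier R \<and> b \<in> carrier R - {\<zero>}"
    if "x \<in> carrier ?F" for x
    using that F by blast
  note ops = fraction_add fraction_mult cl F(2,3) fraction_eq_iff integral_iff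
  have cr: "cring ?F"
  proof (rule cringI)
    show "abelian_group ?F"
    proof (rule abelian_groupI)
      fix x assume "x \<in> carrier ?F"
      then obtain a b where ab: "x = fraction R a b" "a \<in> carrier R" "b \<in> carrier R - {\<zero>}"
        using ex by blast
      show "\<zero>\<^bsub>?F\<^esub> \<oplus>\<^bsub>?F\<^esub> x = x" using ab by (simp add: ops)
      have "fraction R (\<ominus> a) b \<oplus>\<^bsub>?F\<^esub> x = \<zero>\<^bsub>?F\<^esub>"
        using ab by (simp add: ops l_minus l_neg)
      then show "\<exists>y \<in> carrier ?F. y \<oplus>\<^bsub>?F\<^esub> x = \<zero>\<^bsub>?F\<^esub>"
        using ab by (intro bexI[of _ "fraction R (\<ominus> a) b"] cl) auto
    next
      show "\<zero>\<^bsub>?F\<^esub> \<in> carrier ?F" using cl F by simp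
    next
      fix x y assume "x \<in> carrier ?F" "y \<in> carrier ?F"
      then obtain a b c d where
        "x = fraction R a b" "a \<in> carrier R" "b \<in> carrier R - {\<zero>}"
        "y = fraction R c d" "c \<in> carrier R" "d \<in> carrier R - {\<zero>}"
        using ex by meson
      note A = this
      show "x \<oplus>\<^bsub>?F\<^esub> y \<in> carrier ?F" using A by (simp add: ops)
      show "x \<oplus>\<^bsub>?F\<^esub> y = y \<oplus>\<^bsub>?F\<^esub> x" using A by (simp add: ops a_comm m_comm)
      fix z assume "z \<in> carrier ?F"
      then obtain e f where B: "z = fraction R e f" "e \<in> carrier R" "f \<in> carrier R - {\<zero>}"
        using ex by meson
      show "x \<oplus>\<^bsub>?F\<^esub> y \<oplus>\<^bsub>?F\<^esub> z = x \<oplus>\<^bsub>?F\<^esub> (y \<oplus>\<^bsub>?F\<^esub> z)"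
        using A B by (simp add: ops l_distr r_distr m_ac a_ac)
    qed
    show "comm_monoid ?F"
    proof (rule comm_monoidI)
      show "\<one>\<^bsub>?F\<^esub> \<in> carrier ?F" using cl F by simp
    next
      fix x assume "x \<in> carrier ?F"
      then obtain a b where ab: "x = fraction R a b" "a \<in> carrier R" "b \<in> carrier R - {\<zero>}"
        using ex by blast
      show "\<one>\<^bsub>?F\<^esub> \<otimes>\<^bsub>?F\<^esub> x = x" using ab by (simp add: ops)
    next
      fix x y assume "x \<in> carrier ?F" "y \<in> carrier ?F"
      then obtain a b c d where
        "x = fraction R a b" "a \<in> carrier R" "b \<in> carrier R - {\<zero>}"
        "y = fraction R c d" "c \<in> carrier R" "d \<in> carrier R - {\<zero>}"
        using ex by meson
      note A = this
      show "x \<otimes>\<^bsub>?F\<^esub> y \<in> carrier ?F" using A by (simp add: ops)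
      show "x \<otimes>\<^bsub>?F\<^esub> y = y \<otimes>\<^bsub>?F\<^esub> x" using A by (simp add: ops m_comm)
      fix z assume "z \<in> carrier ?F"
      then obtain e f where B: "z = fraction R e f" "e \<in> carrier R" "f \<in> carrier R - {\<zero>}"
        using ex by meson
      show "x \<otimes>\<^bsub>?F\<^esub> y \<otimes>\<^bsub>?F\<^esub> z = x \<otimes>\<^bsub>?F\<^esub> (y \<otimes>\<^bsub>?F\<^esub> z)"
        using A B by (simp add: ops m_ac)
    qed
    fix x y z assume "x \<in> carrier ?F" "y \<in> carrier ?F" "z \<in> carrier ?F"
    then obtain a b c d e f where
      "x = fraction R a b" "a \<in> carrier R" "b \<in> carrier R - {\<zero>}"
      "y = fraction R c d" "c \<in> carrier R" "d \<in> carrier R - {\<zero>}"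
      "z = fraction R e f" "e \<in> carrier R" "f \<in> carrier R - {\<zero>}"
      using ex by metis
    then show "(x \<oplus>\<^bsub>?F\<^esub> y) \<otimes>\<^bsub>?F\<^esub> z = x \<otimes>\<^bsub>?F\<^esub> z \<oplus>\<^bsub>?F\<^esub> y \<otimes>\<^bsub>?F\<^esub> z"
      by (simp add: ops l_distr r_distr m_ac)
  qed
  show ?thesis
  proof (rule cring.cring_fieldI2[OF cr])
    show "\<zero>\<^bsub>?F\<^esub> \<noteq> \<one>\<^bsub>?F\<^esub>" by (simp add: ops)
    fix x assume x: "x \<in> carrier ?F" "x \<noteq> \<zero>\<^bsub>?F\<^esub>"
    then obtain a b where ab: "x = fraction R a b" "a \<in> carrier R" "b \<in> carrier R - {\<zero>}"
      using ex by blast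
    then have "a \<noteq> \<zero>" using x by (auto simp: ops)
    then have "x \<otimes>\<^bsub>?F\<^esub> fraction R b a = \<one>\<^bsub>?F\<^esub>" "fraction R b a \<in> carrier ?F"
      using ab by (simp_all add: ops m_comm)
    then show "\<exists>y \<in> carrier ?F. x \<otimes>\<^bsub>?F\<^esub> y = \<one>\<^bsub>?F\<^esub>"
      by (intro bexI[of _ "fraction R b a"])
  qed
qed

end

text \<open>
  For a domain \<open>D\<close>, the algebraic closure of the field of fractions is the one chosen by
  \<^const>\<open>field.alg_closure\<close>, into which \<^const>\<open>ring.indexed_const\<close> is the canonical embedding.
\<close>

type_synonym 'a frac_closure =
  "(('a \<times> 'a) set list \<times> nat) multiset \<Rightarrow> ('a \<times> 'a) set"

definition frac_closure :: "('a, 'm) ring_scheme \<Rightarrow> 'a frac_closure ring" where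
  "frac_closure D = field.alg_closure (fraction_field D)"

lemma (in "domain") frac_closure_algebraic_closure:
  "algebraic_closure (frac_closure R)
     (ring.indexed_const (fraction_field R) ` carrier (fraction_field R))"
  unfolding frac_closure_def by (rule field.alg_closureE(1)[OF fraction_field_is_field])

definition plus_map :: "('a, 'm) ring_scheme \<Rightarrow> 'a \<Rightarrow> 'a frac_closure" where
  "plus_map D a = ring.indexed_const (fraction_field D) (fraction D a \<one>\<^bsub>D\<^esub>)"

definition plus_ring :: "('a, 'm) ring_scheme \<Rightarrow> 'a frac_closure ring" where
  "plus_ring D =
     (frac_closure D)
       \<lparr> carrier := {x \<in> carrier (frac_closure D).
                      integral_element D (frac_closure D) (plus_map D) x} \<rparr>"

definition product_ring :: "'i set \<Rightarrow> ('i \<Rightarrow> ('b, 'n) ring_scheme) \<Rightarrow> ('i \<Rightarrow> 'b) ring" where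
  "product_ring I A =
     \<lparr> carrier = (\<Pi>\<^sub>E i\<in>I. carrier (A i)),
       monoid.mult = (\<lambda>x y. \<lambda>i\<in>I. x i \<otimes>\<^bsub>A i\<^esub> y i),
       one = (\<lambda>i\<in>I. \<one>\<^bsub>A i\<^esub>),
       ring.zero = (\<lambda>i\<in>I. \<zero>\<^bsub>A i\<^esub>),
       ring.add = (\<lambda>x y. \<lambda>i\<in>I. x i \<oplus>\<^bsub>A i\<^esub> y i) \<rparr>"

type_synonym 'a plus_product = "'a set \<Rightarrow> 'a set frac_closure"

definition plus_product :: "('a, 'm) ring_scheme \<Rightarrow> 'a plus_product ring" where
  "plus_product R = product_ring (min_primes R) (\<lambda>p. plus_ring (R Quot p))"

definition plus_product_map :: "('a, 'm) ring_scheme \<Rightarrow> 'a \<Rightarrow> 'a plus_product" where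
  "plus_product_map R r = (\<lambda>p \<in> min_primes R. plus_map (R Quot p) (p +>\<^bsub>R\<^esub> r))"

end

theory Submission
  imports Defs "HOL-Analysis.Abstract_Topological_Spaces"
begin

text \<open>
  Let \<open>S\<close> be an aic of \<open>R\<close>. A minimal prime \<open>p\<close> of \<open>R\<close> is the contraction of some prime \<open>q\<close> of \<open>S\<close>, and
  the integral extension \<open>R/p \<subseteq> S/q\<close> embeds into \<open>(R/p)\<^sup>+\<close> over \<open>R/p\<close>. The resulting homomorphism
  \<open>S \<rightarrow> T\<close> extends the injection \<open>R \<rightarrow> T\<close>, so its kernel meets \<open>R\<close> trivially and vanishes by
  tightness. Conversely, \<open>T\<close> is tight because an element of \<open>T\<close> that is nonzero at \<open>p\<close> can be
  multiplied into \<open>R\<close>: first by an element of \<open>R\<close> lying in all the other minimal primes, then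
  by an element of \<open>(R/p)\<^sup>+\<close>.

  Once the image of \<open>S\<close> contains all the \<open>2 ^ |min(R)|\<close> idempotents of \<open>T\<close>, it is everything: an
  element of \<open>T\<close> is a root of a monic polynomial over \<open>R\<close>, which splits over \<open>S\<close>, so that each of its
  coordinates is the coordinate of an element of \<open>S\<close>. Finally, the zero ideal of \<open>S\<close> is
  the intersection of the finitely many kernels of \<open>S \<rightarrow> (R/p)\<^sup>+\<close>, so every
  connected component of the spectrum contains one of these, and the unions of components
  correspond to the idempotents of \<open>S\<close>.
\<close>

section \<open>Prime ideals\<close>

text \<open>That (R/p)^+ is a ring in which monic polynomials have roots requires integrality to be
  stable under sums, products and integral equations with integral coefficients. In place of
  finitely generated modules the proof uses that the integral closure inside a field is the
  intersection of the valuation subrings above the base ring: each of them is a subring and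
  integrally closed, so every stability property can be checked in one valuation subring at a time.

  The map from S/q to an algebraically closed field comes from a maximal graph, that is, from a
  maximal subring of the product of the two rings without pairs (0, y) where y \<noteq> 0. Graphs
  are plain sets of pairs, so a union of a chain needs no gluing of functions, and integrality makes
  the partial maps injective without passing to fractions.

  Mutual embeddings need not yield an isomorphism. That T is the only universal aic is a consequence
  of (2): two embeddings in opposite directions force the finite numbers of idempotents to
  agree.\<close>

lemma (in cring) idealI_cring:
  assumes "I \<subseteq> carrier R" "\<zero> \<in> I"
    and add: "\<And>a b. a \<in> I \<Longrightarrow> b \<in> I \<Longrightarrow> a \<oplus> b \<in> I"
    and mult: "\<And>a x. a \<in> I \<Longrightarrow> x \<in> carrier R \<Longrightarrow> x \<otimes> a \<in> I"
  shows "ideal I R"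
proof (rule idealI[OF ring_axioms])
  have neg: "\<ominus> a \<in> I" if "a \<in> I" for a
    using mult[OF that, of "\<ominus> \<one>"] that assms(1) by (auto simp: l_minus)
  show "subgroup I (add_monoid R)"
    using assms neg by (intro add.subgroupI) (auto simp: a_inv_def)
  show "x \<otimes> a \<in> I" "a \<otimes> x \<in> I" if "a \<in> I" "x \<in> carrier R" for a x
    using that mult assms(1) by (auto simp: m_comm subset_iff)
qed

text \<open>I + (a) is the ideal against which maximality is tested in the next lemma.\<close>

lemma (in ideal) in_rcos_add:
  assumes "cring R" "a \<in> carrier R"
  shows "I \<subseteq> I <+>\<^bsub>R\<^esub> PIdl a" "a \<in> I <+>\<^bsub>R\<^esub> PIdl a" "ideal (I <+>\<^bsub>R\<^esub> PIdl a) R"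
    "x \<in> I <+>\<^bsub>R\<^esub> PIdl a \<Longrightarrow> \<exists>i \<in> I. \<exists>r \<in> carrier R. x = i \<oplus> r \<otimes> a"
proof -
  interpret cring R by fact
  have "\<zero> \<in> PIdl a" "a \<in> PIdl a"
    using assms cgenideal_self additive_subgroup.zero_closed ideal.axioms(1) cgenideal_ideal by blast+
  then have mem: "i \<oplus> j \<in> I <+>\<^bsub>R\<^esub> PIdl a" if "i \<in> I" "j \<in> {\<zero>, a}" for i j
    unfolding set_add_def' using that by blast
  show "I \<subseteq> I <+>\<^bsub>R\<^esub> PIdl a"
  proof
    show "x \<in> I <+>\<^bsub>R\<^esub> PIdl a" if "x \<in> I" for x using mem[OF that, of \<zero>] that by simp
  qed
  show "a \<in> I <+>\<^bsub>R\<^esub> PIdl a" using mem[of \<zero> a] assms by simp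
  show "ideal (I <+>\<^bsub>R\<^esub> PIdl a) R" by (rule add_ideals[OF is_ideal cgenideal_ideal[OF assms(2)]])
  show "x \<in> I <+>\<^bsub>R\<^esub> PIdl a \<Longrightarrow> \<exists>i \<in> I. \<exists>r \<in> carrier R. x = i \<oplus> r \<otimes> a"
    unfolding set_add_def' cgenideal_def by auto
qed

text \<open>Krull's argument: take P maximal among the ideals that contain I and miss M. If a and b
  lie outside P, then P + (a) and P + (b) both meet M. The product of two such elements is in M, and
  if a b were in P it would be in P as well.\<close>

lemma (in cring) exists_prime_disjoint:
  assumes I: "ideal I R" and M: "M \<subseteq> carrier R" "\<one> \<in> M"
    and mult: "\<And>a b. a \<in> M \<Longrightarrow> b \<in> M \<Longrightarrow> a \<otimes> b \<in> M"
    and disj: "I \<inter> M = {}"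
  shows "\<exists>P. primeideal P R \<and> I \<subseteq> P \<and> P \<inter> M = {}"
proof -
  define A where "A = {J. ideal J R \<and> I \<subseteq> J \<and> J \<inter> M = {}}"
  have "\<exists>P\<in>A. \<forall>J\<in>A. P \<subseteq> J \<longrightarrow> J = P"
  proof (rule subset_Zorn_nonempty)
    show "A \<noteq> {}" using I disj by (auto simp: A_def)
    fix C assume C: "C \<noteq> {}" "subset.chain A C"
    then have "subset.chain {I. ideal I R} C"
      unfolding subset.chain_def A_def by blast
    from chain_Union_is_ideal[OF this] have "ideal (\<Union>C) R" using C(1) by simp
    then show "\<Union>C \<in> A" using C unfolding subset.chain_def A_def by blast
  qed
  then obtain P where P: "ideal P R" "I \<subseteq> P" "P \<inter> M = {}"
    and max: "\<And>J. ideal J R \<Longrightarrow> I \<subseteq> J \<Longrightarrow> J \<inter> M = {} \<Longrightarrow> P \<subseteq> J \<Longrightarrow> J = P" by (auto simp: A_def)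
  interpret P: ideal P R by fact
  have meets: "\<exists>i \<in> P. \<exists>r \<in> carrier R. i \<oplus> r \<otimes> a \<in> M" if "a \<in> carrier R" "a \<notin> P" for a
  proof -
    note * = P.in_rcos_add[OF is_cring that(1)]
    have "(P <+>\<^bsub>R\<^esub> PIdl a) \<inter> M \<noteq> {}"
      using *(1,2) max[OF *(3)] P(2) that(2) by auto
    then show ?thesis using *(4) by blast
  qed
  have "primeideal P R"
  proof (rule primeidealI[OF P(1) is_cring])
    show "carrier R \<noteq> P" using M P(3) by auto
    fix a b assume ab: "a \<in> carrier R" "b \<in> carrier R" "a \<otimes> b \<in> P"
    show "a \<in> P \<or> b \<in> P"
    proof (rule ccontr)
      assume "\<not> ?thesis"
      then obtain i r j s where *: "i \<in> P" "r \<in> carrier R" "i \<oplus> r \<otimes> a \<in> M"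
        "j \<in> P" "s \<in> carrier R" "j \<oplus> s \<otimes> b \<in> M" using meets ab by meson
      note c = ab(1,2) *(2,5) P.Icarr[OF *(1)] P.Icarr[OF *(4)]
      have "(i \<oplus> r \<otimes> a) \<otimes> (j \<oplus> s \<otimes> b) = (j \<oplus> s \<otimes> b) \<otimes> i \<oplus> ((r \<otimes> a) \<otimes> j \<oplus> (r \<otimes> s) \<otimes> (a \<otimes> b))"
        using c by (simp add: l_distr r_distr m_ac a_ac)
      also have "\<dots> \<in> P" using c * ab P.I_l_closed by (intro P.a_closed) auto
      finally show False using mult[OF *(3,6)] P(3) by blast
    qed
  qed
  then show ?thesis using P by blast
qed

lemma (in primeideal) notin_submonoid:
  "\<one> \<notin> I" "a \<in> carrier R - I \<Longrightarrow> b \<in> carrier R - I \<Longrightarrow> a \<otimes> b \<in> carrier R - I"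
  using I_notcarr one_imp_carrier I_prime by auto

text \<open>The complement of a maximal multiplicative set avoiding zero is a minimal prime.\<close>

lemma reduced_ring_min_prime_avoiding:
  assumes "reduced_ring R" "a \<in> carrier R" "a \<noteq> \<zero>\<^bsub>R\<^esub>"
  shows "\<exists>p \<in> min_primes R. a \<notin> p"
proof -
  interpret cring R using assms by (simp add: reduced_ring_def)
  define A where "A = {M. M \<subseteq> carrier R \<and> \<one>\<^bsub>R\<^esub> \<in> M \<and> a \<in> M \<and> \<zero>\<^bsub>R\<^esub> \<notin> M \<and>
    (\<forall>x\<in>M. \<forall>y\<in>M. x \<otimes>\<^bsub>R\<^esub> y \<in> M)}"
  have "\<exists>M\<in>A. \<forall>J\<in>A. M \<subseteq> J \<longrightarrow> J = M"
  proof (rule subset_Zorn_nonempty)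
    \<comment> \<open>Reducedness keeps zero out of the powers of \<open>a\<close>, so these form a
      first member of the family.\<close>
    have "\<zero>\<^bsub>R\<^esub> \<notin> range (\<lambda>n::nat. a [^]\<^bsub>R\<^esub> n)"
      using assms unfolding reduced_ring_def by (metis rangeE)
    moreover have "a \<in> range (\<lambda>n::nat. a [^]\<^bsub>R\<^esub> n)" "\<one>\<^bsub>R\<^esub> \<in> range (\<lambda>n::nat. a [^]\<^bsub>R\<^esub> n)"
      using assms(2) nat_pow_0[of a] by (auto intro: range_eqI[of _ _ 1] range_eqI[of _ _ 0])
    ultimately have "range (\<lambda>n::nat. a [^]\<^bsub>R\<^esub> n) \<in> A"
      using assms(2) by (auto simp: nat_pow_mult A_def)
    then show "A \<noteq> {}" by blast
    fix C assume C: "C \<noteq> {}" "subset.chain A C"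
    have mult: "x \<otimes>\<^bsub>R\<^esub> y \<in> \<Union>C" if xy: "x \<in> J" "y \<in> Y" "J \<in> C" "Y \<in> C" for x y J Y
    proof -
      have "J \<subseteq> Y \<or> Y \<subseteq> J" using C xy unfolding subset.chain_def A_def by blast
      then obtain Z where Z: "Z \<in> C" "x \<in> Z" "y \<in> Z" using xy by blast
      then have "Z \<in> A" using C unfolding subset.chain_def by blast
      then have "x \<otimes>\<^bsub>R\<^esub> y \<in> Z" using Z by (simp add: A_def)
      then show ?thesis using Z by blast
    qed
    have "C \<subseteq> A" using C unfolding subset.chain_def by blast
    moreover obtain J where "J \<in> C" using C(1) by blast
    ultimately have "\<Union>C \<subseteq> carrier R" "\<one>\<^bsub>R\<^esub> \<in> \<Union>C" "a \<in> \<Union>C" "\<zero>\<^bsub>R\<^esub> \<notin> \<Union>C"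
      unfolding A_def by blast+
    then show "\<Union>C \<in> A" using mult by (simp add: A_def)
  qed
  then obtain M where M: "M \<in> A" and max: "\<And>J. J \<in> A \<Longrightarrow> M \<subseteq> J \<Longrightarrow> J = M" by blast
  have "\<exists>P. primeideal P R \<and> {\<zero>\<^bsub>R\<^esub>} \<subseteq> P \<and> P \<inter> M = {}"
    using M zeroideal by (intro exists_prime_disjoint) (auto simp: A_def)
  then obtain P where P: "primeideal P R" "P \<inter> M = {}" by blast
  \<comment> \<open>The complement of a prime q below P is multiplicative and contains M, so it
    equals M by maximality; P, being disjoint from M, then lies in q.\<close>
  have "q = P" if q: "primeideal q R" "q \<subseteq> P" for q
  proof -
    interpret q: primeideal q R by fact
    have "carrier R - q \<in> A"
      using q P M q.notin_submonoid q.zero_closed by (auto simp: A_def)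
    moreover have "M \<subseteq> carrier R - q" using M P q by (auto simp: A_def)
    ultimately have "carrier R - q = M" using max by blast
    moreover have "P \<subseteq> carrier R" using P(1) by (meson ideal.Icarr primeideal.axioms(1) subsetI)
    ultimately show ?thesis using q P by blast
  qed
  then show ?thesis using P M by (intro bexI[of _ P]) (auto simp: min_primes_def A_def)
qed

text \<open>Minimality of p replaces lying over: a prime of S that misses the image of R - p
  contracts to a prime inside p, hence to p. Such a prime exists because injectivity keeps zero out
  of that image; integrality does not enter.\<close>

lemma exists_prime_over_min_prime:
  assumes S: "cring S" and f: "\<phi> \<in> ring_hom R S" "inj_on \<phi> (carrier R)" and p: "p \<in> min_primes R"
  shows "\<exists>q. primeideal q S \<and> (\<forall>r \<in> carrier R. \<phi> r \<in> q \<longleftrightarrow> r \<in> p)"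
proof -
  interpret S: cring S by fact
  interpret p: primeideal p R using p by (simp add: min_primes_def)
  interpret h: ring_hom_cring R S \<phi>
    by unfold_locales (rule f)
  have "\<exists>q. primeideal q S \<and> {\<zero>\<^bsub>S\<^esub>} \<subseteq> q \<and> q \<inter> \<phi> ` (carrier R - p) = {}"
  proof (rule S.exists_prime_disjoint[OF S.zeroideal])
    show "\<phi> ` (carrier R - p) \<subseteq> carrier S" by auto
    show "\<one>\<^bsub>S\<^esub> \<in> \<phi> ` (carrier R - p)"
    proof -
      have "\<phi> \<one>\<^bsub>R\<^esub> \<in> \<phi> ` (carrier R - p)" using p.notin_submonoid(1) by (intro imageI) simp
      then show ?thesis by simp
    qed
    show "a \<otimes>\<^bsub>S\<^esub> b \<in> \<phi> ` (carrier R - p)" if ab: "a \<in> \<phi> ` (carrier R - p)" "b \<in> \<phi> ` (carrier R - p)" for a b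
    proof -
      obtain x y where xy: "x \<in> carrier R - p" "y \<in> carrier R - p" "a = \<phi> x" "b = \<phi> y" using ab by blast
      then have "\<phi> (x \<otimes>\<^bsub>R\<^esub> y) \<in> \<phi> ` (carrier R - p)" using p.notin_submonoid(2)[of x y] by (intro imageI)
      then show ?thesis using xy by simp
    qed
    have "x = \<zero>\<^bsub>R\<^esub>" if "x \<in> carrier R" "\<phi> x = \<zero>\<^bsub>S\<^esub>" for x
      using that inj_onD[OF f(2), of x "\<zero>\<^bsub>R\<^esub>"] by simp
    then show "{\<zero>\<^bsub>S\<^esub>} \<inter> \<phi> ` (carrier R - p) = {}" using p.zero_closed by fastforce
  qed
  then obtain q where q: "primeideal q S" "q \<inter> \<phi> ` (carrier R - p) = {}" by blast
  interpret q: primeideal q S by fact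
  have hr: "ring_hom_ring R S \<phi>" by (rule ring_hom_ringI2[OF p.ring_axioms S.ring_axioms f(1)])
  let ?p' = "{r \<in> carrier R. \<phi> r \<in> q}"
  have "primeideal ?p' R"
  proof (rule primeidealI[OF ring_hom_ring.ideal_vimage[OF hr q.is_ideal] p.is_cring])
    show "carrier R \<noteq> ?p'" using q.notin_submonoid(1) h.hom_one p.one_closed by force
    show "a \<in> ?p' \<or> b \<in> ?p'" if "a \<in> carrier R" "b \<in> carrier R" "a \<otimes>\<^bsub>R\<^esub> b \<in> ?p'" for a b
      using that q.I_prime[of "\<phi> a" "\<phi> b"] by auto
  qed
  moreover have "?p' \<subseteq> p" using q(2) by auto
  ultimately have "?p' = p" using p by (simp add: min_primes_def)
  then show ?thesis using q by blast
qed

section \<open>Monic polynomials and integrality\<close>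

text \<open>The degree is part of the data instead of being computed by \<open>deg\<close>, and the
  leading coefficient is implicit, so that a homomorphism acts on the lower coefficients
  alone.\<close>

definition monic_value :: "('b, 'n) ring_scheme \<Rightarrow> nat \<Rightarrow> (nat \<Rightarrow> 'b) \<Rightarrow> 'b \<Rightarrow> 'b" where
  "monic_value S n c x = x [^]\<^bsub>S\<^esub> n \<oplus>\<^bsub>S\<^esub> (\<Oplus>\<^bsub>S\<^esub>i \<in> {..<n}. c i \<otimes>\<^bsub>S\<^esub> x [^]\<^bsub>S\<^esub> i)"

lemma (in abelian_monoid) finsum_atMost_eq:
  "f \<in> {..n} \<rightarrow> carrier G \<Longrightarrow> finsum G f {..n::nat} = f n \<oplus> finsum G f {..<n}"
  unfolding atMost_Suc lessThan_Suc_atMost[symmetric] lessThan_Suc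
  by (rule finsum_insert) auto

lemma ring_hom_cring_memI: "cring R \<Longrightarrow> cring S \<Longrightarrow> h \<in> ring_hom R S \<Longrightarrow> ring_hom_cring R S h"
  by (simp add: ring_hom_cring_def ring_hom_cring_axioms_def)

text \<open>Carries integral equations along quotient maps, inclusions of subrings and coordinate
  projections.\<close>

lemma ring_hom_monic_value:
  assumes "cring S" "cring T" "h \<in> ring_hom S T" "c \<in> {..<n} \<rightarrow> carrier S" "x \<in> carrier S"
  shows "h (monic_value S n c x) = monic_value T n (\<lambda>i. h (c i)) (h x)"
proof -
  interpret h: ring_hom_cring S T h by (rule ring_hom_cring_memI[OF assms(1-3)])
  have 1: "(\<lambda>i. c i \<otimes>\<^bsub>S\<^esub> x [^]\<^bsub>S\<^esub> i) \<in> {..<n} \<rightarrow> carrier S" using assms by auto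
  have "h (\<Oplus>\<^bsub>S\<^esub>i\<in>{..<n}. c i \<otimes>\<^bsub>S\<^esub> x [^]\<^bsub>S\<^esub> i) = (\<Oplus>\<^bsub>T\<^esub>i\<in>{..<n}. h (c i) \<otimes>\<^bsub>T\<^esub> h x [^]\<^bsub>T\<^esub> i)"
    unfolding h.hom_finsum[OF 1] using assms by (intro h.S.finsum_cong') (auto simp: h.hom_pow Pi_def)
  then show ?thesis
    using assms h.R.finsum_closed[OF 1] by (simp add: monic_value_def h.hom_pow)
qed

lemma (in cring) monic_value_closed:
  "c \<in> {..<n} \<rightarrow> carrier R \<Longrightarrow> x \<in> carrier R \<Longrightarrow> monic_value R n c x \<in> carrier R"
  unfolding monic_value_def by (intro a_closed nat_pow_closed finsum_closed) auto

lemma (in cring) monic_value_cong: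
  "(\<And>i. i < n \<Longrightarrow> c i = d i) \<Longrightarrow> d \<in> {..<n} \<rightarrow> carrier R \<Longrightarrow> x \<in> carrier R \<Longrightarrow>
    monic_value R n c x = monic_value R n d x"
  unfolding monic_value_def by (intro arg_cong2[where f="(\<oplus>)"] refl finsum_cong') auto

definition monic_UP :: "('a, 'm) ring_scheme \<Rightarrow> nat \<Rightarrow> (nat \<Rightarrow> 'a) \<Rightarrow> nat \<Rightarrow> 'a" where
  "monic_UP R n c = (\<lambda>i. if i < n then c i else if i = n then \<one>\<^bsub>R\<^esub> else \<zero>\<^bsub>R\<^esub>)"

context UP_cring
begin

lemma
  assumes "c \<in> {..<n} \<rightarrow> carrier R"
  shows monic_UP_closed: "monic_UP R n c \<in> carrier P"
    and coeff_monic_UP: "up_ring.coeff P (monic_UP R n c) = monic_UP R n c"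
proof -
  have "bound \<zero> n (monic_UP R n c)" by (rule bound.intro) (simp add: monic_UP_def)
  then have "monic_UP R n c \<in> up R"
    using assms by (intro mem_upI exI[of _ n]) (auto simp: monic_UP_def)
  then show "monic_UP R n c \<in> carrier P" "up_ring.coeff P (monic_UP R n c) = monic_UP R n c"
    unfolding P_def UP_def by simp_all
qed

text \<open>Non-triviality matters: over the trivial ring the coefficient at n is zero and the
  degree is 0 whatever n is.\<close>

lemma deg_monic_UP:
  assumes "c \<in> {..<n} \<rightarrow> carrier R" "\<one> \<noteq> \<zero>"
  shows "deg R (monic_UP R n c) = n"
  using monic_UP_closed[OF assms(1)] coeff_monic_UP[OF assms(1)] assms(2)
  by (intro le_antisym deg_aboveI deg_belowI) (simp_all add: monic_UP_def)

lemma monic_poly_monic_UP: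
  assumes "c \<in> {..<n} \<rightarrow> carrier R" "\<one> \<noteq> \<zero>"
  shows "monic_poly R (monic_UP R n c)"
  using monic_UP_closed[OF assms(1)] coeff_monic_UP[OF assms(1)] deg_monic_UP[OF assms]
  unfolding monic_poly_def P_def by (simp add: monic_UP_def)

lemma monic_poly_eval:
  assumes "cring S" "\<phi> \<in> ring_hom R S" "s \<in> carrier S" "monic_poly R f"
  shows "UnivPoly.eval R S \<phi> s f = monic_value S (deg R f) (\<lambda>i. \<phi> (up_ring.coeff P f i)) s"
proof -
  interpret h: ring_hom_cring R S \<phi> by (rule ring_hom_cring_memI[OF R_cring assms(1,2)])
  have f: "f \<in> carrier P" "up_ring.coeff P f (deg R f) = \<one>" using assms(4) by (auto simp: monic_poly_def P_def)
  show ?thesis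
    using f assms(3) unfolding eval_on_carrier[OF f(1)] monic_value_def
    by (subst h.S.finsum_atMost_eq) auto
qed

lemma eval_monic_UP:
  assumes "cring S" "\<phi> \<in> ring_hom R S" "s \<in> carrier S" "c \<in> {..<n} \<rightarrow> carrier R" "\<one> \<noteq> \<zero>"
  shows "UnivPoly.eval R S \<phi> s (monic_UP R n c) = monic_value S n (\<lambda>i. \<phi> (c i)) s"
proof -
  interpret h: ring_hom_cring R S \<phi> by (rule ring_hom_cring_memI[OF R_cring assms(1,2)])
  have "UnivPoly.eval R S \<phi> s (monic_UP R n c) = monic_value S n (\<lambda>i. \<phi> (monic_UP R n c i)) s"
    using monic_poly_eval[OF assms(1-3) monic_poly_monic_UP[OF assms(4,5)]]
    by (simp add: coeff_monic_UP[OF assms(4)] deg_monic_UP[OF assms(4,5)])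
  also have "\<dots> = monic_value S n (\<lambda>i. \<phi> (c i)) s"
    using assms by (intro h.S.monic_value_cong) (auto simp: monic_UP_def)
  finally show ?thesis .
qed

end

text \<open>Settles the trivial base ring, which the degree formula for \<open>monic_UP\<close>
  excludes.\<close>

lemma ring_hom_from_trivial:
  assumes "cring R" "cring S" "h \<in> ring_hom R S" "\<one>\<^bsub>R\<^esub> = \<zero>\<^bsub>R\<^esub>" "x \<in> carrier S"
  shows "x = \<zero>\<^bsub>S\<^esub>"
proof -
  interpret h: ring_hom_cring R S h by (rule ring_hom_cring_memI[OF assms(1-3)])
  have "\<one>\<^bsub>S\<^esub> = \<zero>\<^bsub>S\<^esub>" using h.hom_one h.hom_zero assms(4) by simp
  then show ?thesis using assms(5) h.S.one_zeroD by blast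
qed

lemma integral_element_iff:
  assumes "cring R" "cring S" "\<phi> \<in> ring_hom R S"
  shows "integral_element R S \<phi> s \<longleftrightarrow> s \<in> carrier S \<and>
    (\<exists>n c. c \<in> {..<n} \<rightarrow> carrier R \<and> monic_value S n (\<lambda>i. \<phi> (c i)) s = \<zero>\<^bsub>S\<^esub>)"
    (is "?L \<longleftrightarrow> ?Q")
proof -
  interpret UP_cring R "UP R" by (simp_all add: UP_cring_def assms)
  interpret h: ring_hom_cring R S \<phi> by (rule ring_hom_cring_memI[OF assms])
  show ?thesis
  proof
    assume ?L
    then obtain f where s: "s \<in> carrier S" and f: "monic_poly R f" "UnivPoly.eval R S \<phi> s f = \<zero>\<^bsub>S\<^esub>"
      by (auto simp: integral_element_def)
    then have "monic_value S (deg R f) (\<lambda>i. \<phi> (up_ring.coeff (UP R) f i)) s = \<zero>\<^bsub>S\<^esub>"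
      "up_ring.coeff (UP R) f \<in> {..<deg R f} \<rightarrow> carrier R"
      using monic_poly_eval[OF assms(2,3) s f(1)] f by (auto simp: monic_poly_def)
    with s show ?Q by blast
  next
    assume Q: ?Q
    then obtain n c where nc: "s \<in> carrier S" "c \<in> {..<n} \<rightarrow> carrier R"
      "monic_value S n (\<lambda>i. \<phi> (c i)) s = \<zero>\<^bsub>S\<^esub>" by blast
    show ?L
    proof (cases "\<one>\<^bsub>R\<^esub> = \<zero>\<^bsub>R\<^esub>")
      \<comment> \<open>Over the trivial ring the zero polynomial is monic, and S is trivial too, so
        it serves as the required equation.\<close>
      case True
      have "UnivPoly.eval R S \<phi> s \<zero>\<^bsub>UP R\<^esub> \<in> carrier S"
        using UP_pre_univ_prop.eval_ring_hom[OF UP_pre_univ_propI[OF assms] nc(1)]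
        by (rule ring_hom_closed) simp
      then have "UnivPoly.eval R S \<phi> s \<zero>\<^bsub>UP R\<^esub> = \<zero>\<^bsub>S\<^esub>"
        by (rule ring_hom_from_trivial[OF assms True])
      moreover have "monic_poly R \<zero>\<^bsub>UP R\<^esub>"
        using True by (simp add: monic_poly_def)
      ultimately show ?thesis using nc(1) unfolding integral_element_def by blast
    next
      case False
      then show ?thesis
        using nc eval_monic_UP[OF assms(2,3) nc(1,2) False] monic_poly_monic_UP[OF nc(2) False]
        unfolding integral_element_def by auto
    qed
  qed
qed

text \<open>A root splits off a linear factor, and the cofactor is again monic of degree one less,
  so induction on the degree applies even in the presence of zero divisors. Over the trivial ring
  every monic polynomial is the empty product.\<close>

lemma ai_closedI:
  fixes R (structure)
  assumes cr: "cring R" and root: "\<And>n c. 0 < n \<Longrightarrow> c \<in> {..<n} \<rightarrow> carrier R \<Longrightarrow> \<exists>a \<in> carrier R. monic_value R n c a = \<zero>"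
  shows "ai_closed R"
proof -
  interpret UP_cring R "UP R" by (simp_all add: UP_cring_def cr)
  let ?P = "UP R"
  let ?X = "\<lambda>a. up_ring.monom ?P \<one> 1 \<ominus>\<^bsub>?P\<^esub> up_ring.monom ?P a 0"
  show ?thesis
  proof (cases "\<one> = \<zero>")
    case True
    have "f = \<one>\<^bsub>?P\<^esub>" if "monic_poly R f" for f
    proof (rule up_eqI)
      show f: "f \<in> carrier ?P" using that by (simp add: monic_poly_def)
      show "up_ring.coeff ?P f n = up_ring.coeff ?P \<one>\<^bsub>?P\<^esub> n" for n
        using R.one_zeroD[OF True] coeff_closed[OF f, of n] coeff_closed[OF P.one_closed, of n] by simp
    qed simp
    then show ?thesis unfolding ai_closed_def
      by (intro allI impI exI[of _ "0::nat"]) auto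
  next
    case False
    then have nt: "carrier R \<noteq> {\<zero>}" using R.one_closed by blast
    have X: "?X a \<in> carrier ?P" if "a \<in> carrier R" for a using that by simp
    have *: "\<exists>a. a \<in> {..<n} \<rightarrow> carrier R \<and> f = finprod ?P (\<lambda>i. ?X (a i)) {..<n}"
      if "monic_poly R f" "deg R f = n" for f n
      using that
    proof (induction n arbitrary: f)
      case 0
      then have f: "f \<in> carrier ?P" "up_ring.coeff ?P f 0 = \<one>" by (auto simp: monic_poly_def)
      from deg_zero_impl_monom[OF f(1) 0(2)] f(2) show ?case by simp
    next
      case (Suc n)
      then have f: "f \<in> carrier ?P" "up_ring.coeff ?P f (Suc n) = \<one>" by (auto simp: monic_poly_def)
      have "\<exists>a \<in> carrier R. monic_value R (Suc n) (\<lambda>i. up_ring.coeff ?P f i) a = \<zero>"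
        using f by (intro root) auto
      then obtain a where a: "a \<in> carrier R" "UnivPoly.eval R R id a f = \<zero>"
        using monic_poly_eval[OF cr id_ring_hom _ Suc(2)] Suc(3) by auto
      obtain q where q: "q \<in> carrier ?P" "f = ?X a \<otimes>\<^bsub>?P\<^esub> q"
        using remainder_theorem[OF f(1) a(1) nt] a f by auto
      have q0: "q \<noteq> \<zero>\<^bsub>?P\<^esub>"
      proof
        assume "q = \<zero>\<^bsub>?P\<^esub>"
        then have "f = \<zero>\<^bsub>?P\<^esub>" using q(2) P.r_null[OF X[OF a(1)]] by simp
        then show False using f(2) False by simp
      qed
      \<comment> \<open>In (X - a) q the part a q has no coefficient at deg q + 1, so the leading
        coefficient of q reappears in f. This bounds deg f from below without any cancellation in R;
        the bound from above is that for the degree of a product.\<close>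
      have "up_ring.coeff ?P f (Suc (deg R q)) = up_ring.coeff ?P (up_ring.monom ?P \<one> 1 \<otimes>\<^bsub>?P\<^esub> q) (deg R q + 1)
          \<ominus> up_ring.coeff ?P (up_ring.monom ?P a 0 \<otimes>\<^bsub>?P\<^esub> q) (Suc (deg R q) + 0)"
        unfolding q(2) using a q(1) by (simp add: P.l_distr P.l_minus P.minus_eq R.minus_eq del: coeff_mult)
      also have "\<dots> = up_ring.coeff ?P q (deg R q) \<ominus> a \<otimes> up_ring.coeff ?P q (Suc (deg R q))"
        using a q(1) by (simp only: coeff_monom_mult R.one_closed) simp
      also have "\<dots> = up_ring.coeff ?P q (deg R q)"
        using a q(1) deg_aboveD[of q "Suc (deg R q)"] by (simp add: R.minus_eq)
      finally have lc: "up_ring.coeff ?P f (Suc (deg R q)) = up_ring.coeff ?P q (deg R q)" .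
      have "Suc (deg R q) \<le> deg R f"
        using lc lcoeff_nonzero2[OF q(1) q0] f(1) by (intro deg_belowI) auto
      moreover have "deg R f \<le> deg R (?X a) + deg R q"
        unfolding q(2) using deg_mult_ring[OF X[OF a(1)] q(1)] .
      moreover have "deg R (?X a) = 1" by (rule deg_minus_monom[OF a(1) nt])
      ultimately have d: "deg R q = n" using Suc(3) by simp
      then have "monic_poly R q" using lc f q by (simp add: monic_poly_def)
      then obtain b where b: "b \<in> {..<n} \<rightarrow> carrier R" "q = finprod ?P (\<lambda>i. ?X (b i)) {..<n}"
        using Suc.IH d by blast
      let ?b = "b(n := a)"
      have "finprod ?P (\<lambda>i. ?X (?b i)) {..<Suc n} = ?X (?b n) \<otimes>\<^bsub>?P\<^esub> finprod ?P (\<lambda>i. ?X (?b i)) {..<n}"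
        unfolding lessThan_Suc using a b by (intro P.finprod_insert) (auto simp: Pi_def)
      also have "finprod ?P (\<lambda>i. ?X (?b i)) {..<n} = q"
        unfolding b(2) using b(1) by (intro P.finprod_cong') (auto simp: Pi_def)
      finally have "f = finprod ?P (\<lambda>i. ?X (?b i)) {..<Suc n}" using q by simp
      moreover have "?b \<in> {..<Suc n} \<rightarrow> carrier R" using a b by (auto simp: Pi_def less_Suc_eq)
      ultimately show ?case by blast
    qed
    show ?thesis unfolding ai_closed_def using * by blast
  qed
qed

text \<open>As T may have zero divisors, only a vanishing product of differences is obtained; a
  vanishing factor is singled out later, in each coordinate of T separately.\<close>

lemma ai_closedD:
  assumes "ai_closed S" "cring S" "cring T" "h \<in> ring_hom S T" "t \<in> carrier T"
    and c: "c \<in> {..<n} \<rightarrow> carrier S" "monic_value T n (\<lambda>i. h (c i)) t = \<zero>\<^bsub>T\<^esub>"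
  shows "\<exists>m a. a \<in> {..<m::nat} \<rightarrow> carrier S \<and> finprod T (\<lambda>i. t \<ominus>\<^bsub>T\<^esub> h (a i)) {..<m} = \<zero>\<^bsub>T\<^esub>"
proof (cases "\<one>\<^bsub>S\<^esub> = \<zero>\<^bsub>S\<^esub>")
  case True
  interpret T: cring T by fact
  have "\<one>\<^bsub>T\<^esub> = \<zero>\<^bsub>T\<^esub>" by (rule ring_hom_from_trivial[OF assms(2-4) True T.one_closed])
  then show ?thesis by (intro exI[of _ "0::nat"]) auto
next
  case False
  interpret UP_pre_univ_prop S T h "UP S"
    using UP_pre_univ_propI[OF assms(2-4)] .
  interpret e: ring_hom_cring "UP S" T "UnivPoly.eval S T h t"
    using eval_ring_hom[OF assms(5)] by unfold_locales
  let ?X = "\<lambda>a. up_ring.monom (UP S) \<one>\<^bsub>S\<^esub> 1 \<ominus>\<^bsub>UP S\<^esub> up_ring.monom (UP S) a 0"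
  let ?f = "monic_UP S n c"
  obtain m a where a: "a \<in> {..<m::nat} \<rightarrow> carrier S" "?f = finprod (UP S) (\<lambda>i. ?X (a i)) {..<m}"
    using assms(1) monic_poly_monic_UP[OF c(1) False] unfolding ai_closed_def by blast
  have X: "UnivPoly.eval S T h t (?X b) = t \<ominus>\<^bsub>T\<^esub> h b" if "b \<in> carrier S" for b
    using that assms(5) by (simp add: P.minus_eq S.minus_eq eval_monom1 eval_const del: One_nat_def)
  have "\<zero>\<^bsub>T\<^esub> = UnivPoly.eval S T h t ?f"
    using eval_monic_UP[OF assms(3-5) c(1) False] c(2) by simp
  also have "\<dots> = finprod T (UnivPoly.eval S T h t \<circ> (\<lambda>i. ?X (a i))) {..<m}"
    unfolding a(2) using a(1) by (intro e.hom_finprod) (auto simp: Pi_def)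
  also have "\<dots> = finprod T (\<lambda>i. t \<ominus>\<^bsub>T\<^esub> h (a i)) {..<m}"
    using a(1) assms(5) X by (intro S.finprod_cong') (auto simp: Pi_def)
  finally show ?thesis using a(1) by metis
qed

text \<open>Clearing denominators reverses the coefficients. The arguments on valuation rings use
  this to turn a relation in an inverse into one in the element itself, or conversely.\<close>

lemma (in cring) pow_mult_finsum_inverse_powers:
  fixes n :: nat
  assumes "x \<in> carrier R" "t \<in> carrier R" "x \<otimes> t = \<one>" "c \<in> {..n} \<rightarrow> carrier R"
  shows "x [^] n \<otimes> (\<Oplus>i \<in> {..n}. c i \<otimes> t [^] i) = (\<Oplus>i \<in> {..n}. c (n - i) \<otimes> x [^] i)"
  using assms(4)
proof (induction n)
  case 0
  then show ?case using assms by simp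
next
  case (Suc n)
  have xt: "x [^] k \<otimes> t [^] k = \<one>" for k :: nat
    using assms(1-3) by (metis nat_pow_distrib nat_pow_one)
  have c: "c \<in> {..n} \<rightarrow> carrier R" "c (Suc n) \<in> carrier R" using Suc.prems by auto
  then have cl: "(\<Oplus>i \<in> {..n}. c i \<otimes> t [^] i) \<in> carrier R" "(\<Oplus>i \<in> {..n}. c (n - i) \<otimes> x [^] i) \<in> carrier R"
    using assms by (auto intro!: finsum_closed simp: Pi_def)
  have "(\<Oplus>i \<in> {..Suc n}. c i \<otimes> t [^] i) = c (Suc n) \<otimes> t [^] Suc n \<oplus> (\<Oplus>i \<in> {..n}. c i \<otimes> t [^] i)"
    using Suc.prems assms by (intro finsum_Suc) (auto simp: Pi_def)
  then have "x [^] Suc n \<otimes> (\<Oplus>i \<in> {..Suc n}. c i \<otimes> t [^] i)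
    = c (Suc n) \<otimes> (x [^] Suc n \<otimes> t [^] Suc n) \<oplus> x \<otimes> (x [^] n \<otimes> (\<Oplus>i \<in> {..n}. c i \<otimes> t [^] i))"
    using assms c cl by (simp add: r_distr m_ac)
  also have "\<dots> = x \<otimes> (\<Oplus>i \<in> {..n}. c (n - i) \<otimes> x [^] i) \<oplus> c (Suc n)"
    using Suc.IH[OF c(1)] c cl assms xt[of "Suc n"] by (simp add: a_comm)
  also have "x \<otimes> (\<Oplus>i \<in> {..n}. c (n - i) \<otimes> x [^] i) = (\<Oplus>i \<in> {..n}. c (Suc n - Suc i) \<otimes> x [^] Suc i)"
  proof -
    have "x \<otimes> (\<Oplus>i \<in> {..n}. c (n - i) \<otimes> x [^] i) = (\<Oplus>i \<in> {..n}. x \<otimes> (c (n - i) \<otimes> x [^] i))"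
      using assms c by (intro finsum_rdistr) (auto simp: Pi_def)
    also have "\<dots> = (\<Oplus>i \<in> {..n}. c (Suc n - Suc i) \<otimes> x [^] Suc i)"
      using assms c by (intro finsum_cong') (auto simp: Pi_def m_ac)
    finally show ?thesis .
  qed
  also have "\<dots> \<oplus> c (Suc n) = (\<Oplus>i \<in> {..Suc n}. c (Suc n - i) \<otimes> x [^] i)"
    using Suc.prems assms by (subst finsum_Suc2) (auto simp: Pi_def)
  finally show ?case .
qed

text \<open>In an integral equation of s the constant term is a multiple of s. If it vanishes,
  cancelling one factor s in the domain gives a shorter equation. The descent ends before degree 0,
  where the equation would read 1 = 0.\<close>

lemma integral_divides_nonzero:
  assumes "domain S" "cring R" "\<phi> \<in> ring_hom R S" "integral_element R S \<phi> s" "s \<noteq> \<zero>\<^bsub>S\<^esub>"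
  shows "\<exists>z \<in> carrier S. \<exists>r \<in> carrier R. s \<otimes>\<^bsub>S\<^esub> z = \<phi> r \<and> \<phi> r \<noteq> \<zero>\<^bsub>S\<^esub>"
proof -
  interpret S: "domain" S by fact
  interpret h: ring_hom_cring R S \<phi> by (rule ring_hom_cring_memI[OF assms(2) S.is_cring assms(3)])
  have s: "s \<in> carrier S" using assms(4) by (simp add: integral_element_def)
  have "\<exists>n c. c \<in> {..<n} \<rightarrow> carrier R \<and> monic_value S n (\<lambda>i. \<phi> (c i)) s = \<zero>\<^bsub>S\<^esub>"
    using assms(4) unfolding integral_element_iff[OF assms(2) S.is_cring assms(3)] by blast
  then obtain n c where "c \<in> {..<n} \<rightarrow> carrier R" "monic_value S n (\<lambda>i. \<phi> (c i)) s = \<zero>\<^bsub>S\<^esub>" by blast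
  then show ?thesis
  proof (induction n arbitrary: c)
    case 0
    then show ?case using s by (simp add: monic_value_def)
  next
    case (Suc n)
    let ?c = "\<lambda>i. c (Suc i)" and ?v = "\<lambda>i. \<phi> (c i) \<otimes>\<^bsub>S\<^esub> s [^]\<^bsub>S\<^esub> i"
    have c: "?c \<in> {..<n} \<rightarrow> carrier R" "c 0 \<in> carrier R" using Suc.prems(1) by auto
    \<comment> \<open>What remains of the equation when the constant term is dropped and one factor
      \<open>s\<close> is taken out, so that the whole reads
      \<open>s \<otimes> z \<oplus> \<phi> (c 0) = \<zero>\<close>.\<close>
    define z where "z = monic_value S n (\<lambda>i. \<phi> (?c i)) s"
    have z: "z \<in> carrier S" unfolding z_def using c s by (intro S.monic_value_closed) auto
    have v: "?v \<in> {..<Suc n} \<rightarrow> carrier S" using Suc.prems(1) s by auto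
    have "finsum S ?v {..<Suc n} = finsum S (\<lambda>i. ?v (Suc i)) {..<n} \<oplus>\<^bsub>S\<^esub> \<phi> (c 0)"
    proof (cases n)
      case 0
      then show ?thesis using c by (simp add: lessThan_Suc)
    next
      case (Suc m)
      then show ?thesis using S.finsum_Suc2[of ?v m] v c by (auto simp: lessThan_Suc_atMost Pi_def)
    qed
    also have "finsum S (\<lambda>i. ?v (Suc i)) {..<n} = s \<otimes>\<^bsub>S\<^esub> (\<Oplus>\<^bsub>S\<^esub>i\<in>{..<n}. \<phi> (?c i) \<otimes>\<^bsub>S\<^esub> s [^]\<^bsub>S\<^esub> i)"
      using c s by (subst S.finsum_rdistr) (auto simp: Pi_def S.m_ac intro!: S.finsum_cong')
    finally have "monic_value S (Suc n) (\<lambda>i. \<phi> (c i)) s = s \<otimes>\<^bsub>S\<^esub> z \<oplus>\<^bsub>S\<^esub> \<phi> (c 0)"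
      using c s by (subgoal_tac "(\<Oplus>\<^bsub>S\<^esub>i\<in>{..<n}. \<phi> (?c i) \<otimes>\<^bsub>S\<^esub> s [^]\<^bsub>S\<^esub> i) \<in> carrier S")
        (auto simp: monic_value_def z_def S.r_distr S.m_ac S.a_ac Pi_def intro!: S.finsum_closed)
    with Suc.prems(2) have eq: "s \<otimes>\<^bsub>S\<^esub> z \<oplus>\<^bsub>S\<^esub> \<phi> (c 0) = \<zero>\<^bsub>S\<^esub>" by simp
    show ?case
    proof (cases "\<phi> (c 0) = \<zero>\<^bsub>S\<^esub>")
      case True
      then have "z = \<zero>\<^bsub>S\<^esub>" using eq s z assms(5) S.integral by fastforce
      then show ?thesis using Suc.IH[OF c(1)] by (simp add: z_def)
    next
      case False
      have "s \<otimes>\<^bsub>S\<^esub> z = \<phi> (\<ominus>\<^bsub>R\<^esub> c 0)" using S.sum_zero_eq_neg[OF _ _ eq] s z c by simp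
      moreover have "\<phi> (\<ominus>\<^bsub>R\<^esub> c 0) \<noteq> \<zero>\<^bsub>S\<^esub>" using False c by simp
      ultimately show ?thesis using z c by blast
    qed
  qed
qed

section \<open>Integral closure via valuation rings\<close>

lemma (in ring) chain_Union_subring:
  assumes "C \<noteq> {}" "subset.chain {H. subring H R} C"
  shows "subring (\<Union>C) R"
proof -
  have sub: "subring H R" if "H \<in> C" for H using assms(2) that unfolding subset.chain_def by blast
  have two: "\<exists>H \<in> C. a \<in> H \<and> b \<in> H" if ab: "a \<in> \<Union>C" "b \<in> \<Union>C" for a b
  proof -
    obtain H K where HK: "H \<in> C" "K \<in> C" "a \<in> H" "b \<in> K" using ab by blast
    then have "H \<subseteq> K \<or> K \<subseteq> H" using assms(2) unfolding subset.chain_def by blast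
    then show ?thesis using HK by blast
  qed
  obtain H0 where H0: "H0 \<in> C" using assms(1) by blast
  show ?thesis
  proof (rule subringI)
    show "\<Union>C \<subseteq> carrier R" using sub subringE(1) by blast
    show "\<one> \<in> \<Union>C" using H0 subringE(3)[OF sub[OF H0]] by blast
    show "\<ominus> h \<in> \<Union>C" if "h \<in> \<Union>C" for h using that subringE(5)[OF sub] by blast
    show "h1 \<otimes> h2 \<in> \<Union>C" if "h1 \<in> \<Union>C" "h2 \<in> \<Union>C" for h1 h2
      using two[OF that] subringE(6)[OF sub] by blast
    show "h1 \<oplus> h2 \<in> \<Union>C" if "h1 \<in> \<Union>C" "h2 \<in> \<Union>C" for h1 h2
      using two[OF that] subringE(7)[OF sub] by blast
  qed
qed

lemma (in ring) subring_pow_closed: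
  assumes "subring V R" "x \<in> V" shows "x [^] (n::nat) \<in> V"
  by (induction n) (use assms subringE in auto)

lemma (in ring) subring_finsum_closed:
  assumes "subring V R" "f \<in> I \<rightarrow> V" "finite I"
  shows "finsum R f I \<in> V"
  using assms(3,2)
proof (induction I rule: finite_induct)
  case empty
  then show ?case using subringE(2)[OF assms(1)] by simp
next
  case (insert i I)
  have "f i \<in> V" "f \<in> I \<rightarrow> V" using insert.prems by auto
  moreover have "finsum R f (insert i I) = f i \<oplus> finsum R f I"
    using insert subringE(1)[OF assms(1)] by (intro finsum_insert) auto
  ultimately show ?case using insert.IH subringE(7)[OF assms(1)] by simp
qed

lemma (in cring) subring_cring: "subring V R \<Longrightarrow> cring (R\<lparr>carrier := V\<rparr>)"
  using subcring_iff[OF subringE(1)] subcringI' by blast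

lemma (in cring) subring_id_hom: "subring V R \<Longrightarrow> id \<in> ring_hom (R\<lparr>carrier := V\<rparr>) R"
  using subringE(1) by (intro ring_hom_memI) auto

text \<open>W is V[x], the image of evaluation at x on polynomials over V; this gives both the
  subring property and the form of its elements.\<close>

lemma (in cring) adjoin_element:
  assumes V: "subring V R" and x: "x \<in> carrier R"
  shows "\<exists>W. subring W R \<and> V \<subseteq> W \<and> x \<in> W \<and>
    (\<forall>w \<in> W. \<exists>n c. c \<in> {..n::nat} \<rightarrow> V \<and> w = (\<Oplus>i \<in> {..n}. c i \<otimes> x [^] i))"
proof -
  let ?A = "R\<lparr>carrier := V\<rparr>"
  have U: "UP_pre_univ_prop ?A R id"
    by (rule UP_pre_univ_propI[OF subring_cring[OF V] is_cring subring_id_hom[OF V]])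
  interpret U: UP_pre_univ_prop ?A R id "UP ?A" by (rule U)
  let ?e = "UnivPoly.eval ?A R id x"
  have hom: "?e \<in> ring_hom (UP ?A) R" by (rule UP_pre_univ_prop.eval_ring_hom[OF U x])
  have UA: "UP_cring ?A" by (simp add: UP_cring_def subring_cring[OF V])
  have cr: "cring (UP ?A)" using UA by (rule UP_cring.UP_cring)
  then have rr: "ring_hom_ring (UP ?A) R ?e"
    using hom by (intro ring_hom_ringI2) (auto simp: cring_def ring_axioms)
  have "subring (?e ` carrier (UP ?A)) R"
    by (rule ring_hom_ring.img_is_subring[OF rr ring.carrier_is_subring]) (use cr in \<open>simp add: cring_def\<close>)
  moreover have "v \<in> ?e ` carrier (UP ?A)" if "v \<in> V" for v
  proof -
    have "?e (up_ring.monom (UP ?A) v 0) = v"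
      using UP_pre_univ_prop.eval_const[OF U x, of v] that by simp
    moreover have "up_ring.monom (UP ?A) v 0 \<in> carrier (UP ?A)"
      using U.monom_closed[of v 0] that by simp
    ultimately show ?thesis by (metis imageI)
  qed
  moreover have "x \<in> ?e ` carrier (UP ?A)"
  proof -
    have "?e (up_ring.monom (UP ?A) \<one> 1) = x"
      using UP_pre_univ_prop.eval_monom1[OF U x] by simp
    moreover have "up_ring.monom (UP ?A) \<one> 1 \<in> carrier (UP ?A)"
      using U.monom_closed[of \<one> 1]
        subringE(3)[OF V] by simp
    ultimately show ?thesis by (metis imageI)
  qed
  moreover have "\<exists>n c. c \<in> {..n::nat} \<rightarrow> V \<and> ?e f = (\<Oplus>i \<in> {..n}. c i \<otimes> x [^] i)"
    if f: "f \<in> carrier (UP ?A)" for f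
  proof (intro exI conjI)
    show "up_ring.coeff (UP ?A) f \<in> {..deg ?A f} \<rightarrow> V"
      using U.coeff_closed[OF f] by auto
    show "?e f = (\<Oplus>i \<in> {..deg ?A f}. up_ring.coeff (UP ?A) f i \<otimes> x [^] i)"
      using f by (simp add: UnivPoly.eval_def)
  qed
  ultimately show ?thesis by (intro exI[of _ "?e ` carrier (UP ?A)"]) blast
qed

text \<open>At y = 0, where \<open>inv\<close> has no meaning, the first alternative holds because
  subrings contain zero. K itself is allowed.\<close>

definition valuation_subring :: "'a set \<Rightarrow> ('a, 'm) ring_scheme \<Rightarrow> bool" where
  "valuation_subring V K \<longleftrightarrow> subring V K \<and>
     (\<forall>y \<in> carrier K. y \<in> V \<or> inv\<^bsub>K\<^esub> y \<in> V)"

context cring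
begin

text \<open>The part of the ideal t V[u] of V[u] that polynomials of degree at most n produce; it
  contains 1 for some n exactly if t becomes a unit in V[u].\<close>

definition scaled_span :: "'a set \<Rightarrow> 'a \<Rightarrow> 'a \<Rightarrow> nat \<Rightarrow> 'a set" where
  "scaled_span V t u n = {(\<Oplus>i \<in> {..n}. (t \<otimes> c i) \<otimes> u [^] i) | c. c \<in> {..n} \<rightarrow> V}"

context
  fixes V t u
  assumes V: "subring V R" and t: "t \<in> V" and u: "u \<in> carrier R"
begin

private lemma VR: "x \<in> V \<Longrightarrow> x \<in> carrier R"
  using subringE(1)[OF V] by blast

lemma scaled_span_Suc: "scaled_span V t u n \<subseteq> scaled_span V t u (Suc n)"
proof
  fix z assume "z \<in> scaled_span V t u n"
  then obtain c where c: "c \<in> {..n} \<rightarrow> V" "z = (\<Oplus>i \<in> {..n}. (t \<otimes> c i) \<otimes> u [^] i)"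
    unfolding scaled_span_def by blast
  let ?c = "c(Suc n := \<zero>)"
  have c': "?c \<in> {..Suc n} \<rightarrow> V" using c(1) subringE(2)[OF V] by (auto simp: Pi_def le_Suc_eq)
  have "(\<Oplus>i \<in> {..Suc n}. (t \<otimes> ?c i) \<otimes> u [^] i)
    = (t \<otimes> ?c (Suc n)) \<otimes> u [^] Suc n \<oplus> (\<Oplus>i \<in> {..n}. (t \<otimes> ?c i) \<otimes> u [^] i)"
    using c' t u VR by (intro finsum_Suc) (auto simp: Pi_def)
  also have "(\<Oplus>i \<in> {..n}. (t \<otimes> ?c i) \<otimes> u [^] i) = z"
    unfolding c(2) using c t u VR by (intro finsum_cong') (auto simp: Pi_def)
  also have "(t \<otimes> ?c (Suc n)) \<otimes> u [^] Suc n \<oplus> z = z"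
  proof -
    have "z \<in> carrier R" unfolding c(2) using c t u VR by (intro finsum_closed) (auto simp: Pi_def)
    then show ?thesis using t u VR by (simp del: nat_pow_Suc)
  qed
  finally show "z \<in> scaled_span V t u (Suc n)" using c' unfolding scaled_span_def by blast
qed

lemma scaled_span_const: "c \<in> V \<Longrightarrow> t \<otimes> c \<in> scaled_span V t u n"
proof (induction n)
  case 0
  then have "t \<otimes> c = (\<Oplus>i \<in> {..0::nat}. (t \<otimes> c) \<otimes> u [^] i)" using t u VR by simp
  then show ?case using 0 unfolding scaled_span_def by (intro CollectI exI[of _ "\<lambda>_. c"]) simp
next
  case (Suc n)
  then show ?case using scaled_span_Suc by blast
qed

lemma scaled_span_add:
  assumes "y \<in> scaled_span V t u n" "z \<in> scaled_span V t u n"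
  shows "y \<oplus> z \<in> scaled_span V t u n"
proof -
  obtain c d where c: "c \<in> {..n} \<rightarrow> V" "y = (\<Oplus>i \<in> {..n}. (t \<otimes> c i) \<otimes> u [^] i)"
    and d: "d \<in> {..n} \<rightarrow> V" "z = (\<Oplus>i \<in> {..n}. (t \<otimes> d i) \<otimes> u [^] i)"
    using assms unfolding scaled_span_def by blast
  have "y \<oplus> z = (\<Oplus>i \<in> {..n}. (t \<otimes> c i) \<otimes> u [^] i \<oplus> (t \<otimes> d i) \<otimes> u [^] i)"
    unfolding c(2) d(2) using c d t u VR by (intro finsum_addf[symmetric]) (auto simp: Pi_def)
  also have "\<dots> = (\<Oplus>i \<in> {..n}. (t \<otimes> (c i \<oplus> d i)) \<otimes> u [^] i)"
    using c d t u VR by (intro finsum_cong') (auto simp: Pi_def l_distr r_distr)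
  finally show ?thesis
    using c d subringE(7)[OF V] unfolding scaled_span_def by (auto intro!: exI[of _ "\<lambda>i. c i \<oplus> d i"])
qed

lemma scaled_span_smult:
  assumes "a \<in> V" "z \<in> scaled_span V t u n"
  shows "a \<otimes> z \<in> scaled_span V t u n"
proof -
  obtain c where c: "c \<in> {..n} \<rightarrow> V" "z = (\<Oplus>i \<in> {..n}. (t \<otimes> c i) \<otimes> u [^] i)"
    using assms unfolding scaled_span_def by blast
  have "a \<otimes> z = (\<Oplus>i \<in> {..n}. a \<otimes> ((t \<otimes> c i) \<otimes> u [^] i))"
    unfolding c(2) using assms c t u VR by (intro finsum_rdistr) (auto simp: Pi_def)
  also have "\<dots> = (\<Oplus>i \<in> {..n}. (t \<otimes> (a \<otimes> c i)) \<otimes> u [^] i)"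
    using assms c t u VR by (intro finsum_cong') (auto simp: Pi_def m_ac)
  finally show ?thesis
    using c assms subringE(6)[OF V] unfolding scaled_span_def by (auto intro!: exI[of _ "\<lambda>i. a \<otimes> c i"])
qed

lemma scaled_span_SucE:
  assumes "z \<in> scaled_span V t u (Suc n)"
  obtains a s where "a \<in> V" "s \<in> scaled_span V t u n" "z = (t \<otimes> a) \<otimes> u [^] Suc n \<oplus> s"
proof -
  obtain c where c: "c \<in> {..Suc n} \<rightarrow> V" "z = (\<Oplus>i \<in> {..Suc n}. (t \<otimes> c i) \<otimes> u [^] i)"
    using assms unfolding scaled_span_def by blast
  have "z = (t \<otimes> c (Suc n)) \<otimes> u [^] Suc n \<oplus> (\<Oplus>i \<in> {..n}. (t \<otimes> c i) \<otimes> u [^] i)"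
    unfolding c(2) using c t u VR by (intro finsum_Suc) (auto simp: Pi_def)
  moreover have "(\<Oplus>i \<in> {..n}. (t \<otimes> c i) \<otimes> u [^] i) \<in> scaled_span V t u n"
    using c(1) unfolding scaled_span_def by (auto simp: Pi_def)
  moreover have "c (Suc n) \<in> V" using c(1) by auto
  ultimately show thesis using that by blast
qed

lemma scaled_span_carrier: "scaled_span V t u n \<subseteq> carrier R"
  unfolding scaled_span_def using t u VR by (auto intro!: finsum_closed simp: Pi_def)

lemma scaled_span_reverse:
  assumes "v \<in> carrier R" "u \<otimes> v = \<one>" "z \<in> scaled_span V t v n"
  shows "u [^] n \<otimes> z \<in> scaled_span V t u n"
proof -
  obtain c where c: "c \<in> {..n} \<rightarrow> V" "z = (\<Oplus>i \<in> {..n}. (t \<otimes> c i) \<otimes> v [^] i)"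
    using assms unfolding scaled_span_def by blast
  have "u [^] n \<otimes> z = (\<Oplus>i \<in> {..n}. (t \<otimes> c (n - i)) \<otimes> u [^] i)"
    unfolding c(2) using c t VR by (intro pow_mult_finsum_inverse_powers[OF u assms(1,2)]) (auto simp: Pi_def)
  then show ?thesis using c(1) unfolding scaled_span_def by (auto simp: Pi_def)
qed

text \<open>Multiplying the relation for \<open>v\<close>, with constant term \<open>t \<otimes> b\<close>, by \<open>u ^ (n + 1)\<close> expresses
  \<open>(\<one> \<ominus> t \<otimes> b) \<otimes> u ^ (n + 1)\<close> through lower powers of \<open>u\<close>. Substituting this into
  \<open>\<one> \<ominus> t \<otimes> b\<close> times the relation for \<open>u\<close> lowers the degree.\<close>

lemma one_in_scaled_span_descent:
  assumes v: "v \<in> carrier R" "u \<otimes> v = \<one>"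
    and 1: "\<one> \<in> scaled_span V t u (Suc n)" "\<one> \<in> scaled_span V t v m" "m \<le> Suc n"
  shows "\<one> \<in> scaled_span V t u n"
proof -
  obtain a s where a: "a \<in> V" "s \<in> scaled_span V t u n" "\<one> = (t \<otimes> a) \<otimes> u [^] Suc n \<oplus> s"
    using scaled_span_SucE[OF 1(1)] .
  \<comment> \<open>The relation for \<open>v\<close> is padded to length n + 1, so that u ^ (n + 1)
    turns it into a relation in powers of \<open>u\<close> of the same length.\<close>
  have "\<one> \<in> scaled_span V t v (Suc n)"
    using 1(2,3) lift_Suc_mono_le[of "scaled_span V t v"] cring.scaled_span_Suc[OF is_cring V t v(1)] by blast
  then have "u [^] Suc n \<otimes> \<one> \<in> scaled_span V t u (Suc n)"
    by (rule scaled_span_reverse[OF v])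
  then have "u [^] Suc n \<in> scaled_span V t u (Suc n)" using u by simp
  then obtain b r where b: "b \<in> V" "r \<in> scaled_span V t u n"
    "u [^] Suc n = (t \<otimes> b) \<otimes> u [^] Suc n \<oplus> r"
    using scaled_span_SucE by metis
  define w where "w = u [^] Suc n"
  have c: "s \<in> carrier R" "r \<in> carrier R" "w \<in> carrier R" "a \<in> carrier R" "b \<in> carrier R" "t \<in> carrier R"
    using a b scaled_span_carrier u t VR by (auto simp: w_def)
  have r: "r = (\<one> \<ominus> t \<otimes> b) \<otimes> w"
  proof -
    have "r = ((t \<otimes> b) \<otimes> w \<oplus> r) \<ominus> (t \<otimes> b) \<otimes> w" using c by algebra
    also have "\<dots> = w \<ominus> (t \<otimes> b) \<otimes> w" using b(3) by (simp only: w_def[symmetric])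
    also have "\<dots> = (\<one> \<ominus> t \<otimes> b) \<otimes> w" using c by algebra
    finally show ?thesis .
  qed
  have "\<one> = t \<otimes> b \<oplus> (\<one> \<ominus> t \<otimes> b) \<otimes> \<one>" using c by algebra
  also have "\<dots> = t \<otimes> b \<oplus> (\<one> \<ominus> t \<otimes> b) \<otimes> ((t \<otimes> a) \<otimes> w \<oplus> s)"
    using a(3) by (simp only: w_def[symmetric])
  also have "\<dots> = t \<otimes> b \<oplus> ((t \<otimes> a) \<otimes> r \<oplus> (\<one> \<ominus> t \<otimes> b) \<otimes> s)"
    unfolding r using c by algebra
  finally have eq: "\<one> = t \<otimes> b \<oplus> ((t \<otimes> a) \<otimes> r \<oplus> (\<one> \<ominus> t \<otimes> b) \<otimes> s)" .
  have "t \<otimes> a \<in> V" "\<one> \<ominus> t \<otimes> b \<in> V"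
    using subringE[OF V] a(1) b(1) t by (auto simp: minus_eq)
  then have "t \<otimes> b \<oplus> ((t \<otimes> a) \<otimes> r \<oplus> (\<one> \<ominus> t \<otimes> b) \<otimes> s) \<in> scaled_span V t u n"
    using a b by (intro scaled_span_add scaled_span_const scaled_span_smult)
  then show ?thesis using eq by simp
qed

end

text \<open>Take relations of lengths n and m for u and its inverse. Descent shortens the longer
  one, so induction on n + m ends at length 0, where t would be a unit of V.\<close>

lemma one_notin_scaled_spans:
  assumes V: "subring V R" and t: "t \<in> V" and nt: "\<And>c. c \<in> V \<Longrightarrow> \<one> \<noteq> t \<otimes> c"
    and "u \<in> carrier R" "v \<in> carrier R" "u \<otimes> v = \<one>"
  shows "\<one> \<notin> scaled_span V t u n \<or> \<one> \<notin> scaled_span V t v m"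
  using assms(4-)
proof (induction "n + m" arbitrary: n m u v rule: less_induct)
  case less
  have zero: False if z: "z \<in> carrier R" "\<one> \<in> scaled_span V t z 0" for z
  proof -
    obtain c where c: "c \<in> {..0::nat} \<rightarrow> V" "\<one> = (\<Oplus>i \<in> {..0::nat}. (t \<otimes> c i) \<otimes> z [^] i)"
      using z(2) unfolding scaled_span_def by blast
    then have "\<one> = t \<otimes> c 0" using z subringE(1)[OF V] t by (simp add: subset_iff)
    then show False using nt[of "c 0"] c(1) by auto
  qed
  have vu: "v \<otimes> u = \<one>" using less.prems by (simp add: m_comm)
  show ?case
  proof (rule ccontr)
    assume "\<not> ?thesis"
    then have 1: "\<one> \<in> scaled_span V t u n" "\<one> \<in> scaled_span V t v m" by auto
    show False
    proof (cases "m \<le> n")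
      case True
      show False
      proof (cases n)
        case 0
        then show False using zero[OF less.prems(1)] 1 by simp
      next
        case (Suc k)
        have "\<one> \<in> scaled_span V t u k"
          using one_in_scaled_span_descent[OF V t less.prems, of k m] 1 Suc True by simp
        then show False using less.hyps[of k m u v] less.prems Suc 1 by simp
      qed
    next
      case False
      then obtain k where k: "m = Suc k" by (cases m) auto
      have "\<one> \<in> scaled_span V t v k"
        using one_in_scaled_span_descent[OF V t less.prems(2,1) vu, of k n] 1 k False by simp
      then show False using less.hyps[of n k u v] less.prems k 1 by simp
    qed
  qed
qed

end

context field
begin

lemma inverse_facts:
  assumes "x \<in> carrier R" "x \<noteq> \<zero>"
  shows "inv x \<in> carrier R" "x \<otimes> inv x = \<one>" "inv x \<otimes> x = \<one>"
  using assms by (simp_all add: field_Units)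

text \<open>The valuation ring is a maximal subring containing \<open>A[1/x]\<close> but not \<open>x\<close>.\<close>

lemma exists_valuation_subring:
  assumes A: "subring A R" and x: "x \<in> carrier R"
    and nonint: "\<And>n c. c \<in> {..<n} \<rightarrow> A \<Longrightarrow> monic_value R n c x \<noteq> \<zero>"
  shows "\<exists>V. valuation_subring V R \<and> A \<subseteq> V \<and> x \<notin> V"
proof -
  have "x \<noteq> \<zero>"
  proof
    assume "x = \<zero>"
    then have "monic_value R 1 (\<lambda>_. \<zero>) x = \<zero>" by (simp add: monic_value_def)
    then show False using nonint[of "\<lambda>_. \<zero>" 1] subringE(2)[OF A] by auto
  qed
  define t where "t = inv x"
  have t: "t \<in> carrier R" "x \<otimes> t = \<one>" "t \<otimes> x = \<one>"
    using inverse_facts[OF x \<open>x \<noteq> \<zero>\<close>] by (auto simp: t_def)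
  obtain W where W: "subring W R" "A \<subseteq> W" "t \<in> W"
    and Wsum: "\<And>w. w \<in> W \<Longrightarrow> \<exists>n c. c \<in> {..n::nat} \<rightarrow> A \<and> w = (\<Oplus>i \<in> {..n}. c i \<otimes> t [^] i)"
    using adjoin_element[OF A t(1)] by blast
  \<comment> \<open>If x were a polynomial of degree n in t = 1/x, multiplication by x ^ n would
    give a monic equation of degree n + 1 for x over A.\<close>
  have xW: "x \<notin> W"
  proof
    assume "x \<in> W"
    then obtain n c where c: "c \<in> {..n::nat} \<rightarrow> A" "x = (\<Oplus>i \<in> {..n}. c i \<otimes> t [^] i)"
      using Wsum by blast
    let ?S = "\<Oplus>i \<in> {..n}. c (n - i) \<otimes> x [^] i" and ?d = "\<lambda>i. \<ominus> c (n - i)"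
    have cR: "c i \<in> carrier R" if "i \<le> n" for i using c(1) subringE(1)[OF A] that by auto
    have "x [^] Suc n = x [^] n \<otimes> (\<Oplus>i \<in> {..n}. c i \<otimes> t [^] i)" using c(2) by simp
    also have "\<dots> = ?S"
      using cR by (intro pow_mult_finsum_inverse_powers x t) auto
    finally have "monic_value R (Suc n) ?d x = ?S \<oplus> (\<Oplus>i \<in> {..n}. ?d i \<otimes> x [^] i)"
      by (simp add: monic_value_def lessThan_Suc_atMost)
    also have "\<dots> = (\<Oplus>i \<in> {..n}. c (n - i) \<otimes> x [^] i \<oplus> ?d i \<otimes> x [^] i)"
      using cR x by (intro finsum_addf[symmetric]) auto
    also have "\<dots> = (\<Oplus>i \<in> {..n}. \<zero>)"
      using cR x by (intro finsum_cong') (auto simp: l_minus r_neg)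
    finally have "monic_value R (Suc n) ?d x = \<zero>" by simp
    moreover have "?d \<in> {..<Suc n} \<rightarrow> A" using c(1) subringE(5)[OF A] by (auto simp: Pi_def)
    ultimately show False using nonint by blast
  qed
  define F where "F = {V. subring V R \<and> W \<subseteq> V \<and> x \<notin> V}"
  have "\<exists>V\<in>F. \<forall>H\<in>F. V \<subseteq> H \<longrightarrow> H = V"
  proof (rule subset_Zorn_nonempty)
    show "F \<noteq> {}" using W xW by (auto simp: F_def)
    fix C assume C: "C \<noteq> {}" "subset.chain F C"
    then have CF: "C \<subseteq> F" unfolding subset.chain_def by blast
    have "subset.chain {H. subring H R} C" using C CF unfolding subset.chain_def F_def by blast
    then have "subring (\<Union>C) R" by (rule chain_Union_subring[OF C(1)])
    moreover have "W \<subseteq> \<Union>C" "x \<notin> \<Union>C" using CF C(1) unfolding F_def by blast+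
    ultimately show "\<Union>C \<in> F" by (simp add: F_def)
  qed
  then obtain V where "V \<in> F" and max: "\<And>H. H \<in> F \<Longrightarrow> V \<subseteq> H \<Longrightarrow> H = V" by blast
  then have V: "subring V R" "W \<subseteq> V" "x \<notin> V" by (auto simp: F_def)
  have tV: "t \<in> V" using V W by blast
  \<comment> \<open>The inverse of t is x, which V lacks, so t is not a unit of V.\<close>
  have nt: "\<one> \<noteq> t \<otimes> c" if c: "c \<in> V" for c
  proof
    assume "\<one> = t \<otimes> c"
    then have "x \<otimes> \<one> = x \<otimes> (t \<otimes> c)" by simp
    also have "\<dots> = (x \<otimes> t) \<otimes> c" using x t(1) c subringE(1)[OF V(1)] by (simp add: m_assoc subset_iff)
    finally have "x = c" using x t(2) c subringE(1)[OF V(1)] by (simp add: subset_iff)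
    then show False using V c by blast
  qed
  \<comment> \<open>By maximality V[u] contains x. Multiplying an expression of x as a polynomial in
    u by t exhibits 1 in t V[u].\<close>
  have span: "\<exists>n. \<one> \<in> scaled_span V t u n" if u: "u \<in> carrier R" "u \<notin> V" for u
  proof -
    obtain H where H: "subring H R" "V \<subseteq> H" "u \<in> H"
      and Hsum: "\<And>w. w \<in> H \<Longrightarrow> \<exists>n c. c \<in> {..n::nat} \<rightarrow> V \<and> w = (\<Oplus>i \<in> {..n}. c i \<otimes> u [^] i)"
      using adjoin_element[OF V(1) u(1)] by blast
    have "H \<notin> F" using max[of H] H u(2) by blast
    then have "x \<in> H" using H V by (auto simp: F_def)
    then obtain n c where c: "c \<in> {..n::nat} \<rightarrow> V" "x = (\<Oplus>i \<in> {..n}. c i \<otimes> u [^] i)"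
      using Hsum by blast
    have cR: "c i \<in> carrier R" if "i \<le> n" for i using c(1) subringE(1)[OF V(1)] that by auto
    have "\<one> = t \<otimes> (\<Oplus>i \<in> {..n}. c i \<otimes> u [^] i)" using t c(2) by simp
    also have "\<dots> = (\<Oplus>i \<in> {..n}. t \<otimes> (c i \<otimes> u [^] i))"
      using cR t u by (intro finsum_rdistr) auto
    also have "\<dots> = (\<Oplus>i \<in> {..n}. (t \<otimes> c i) \<otimes> u [^] i)"
      using cR t u by (intro finsum_cong') (auto simp: m_assoc)
    finally show ?thesis using c(1) unfolding scaled_span_def by blast
  qed
  have "y \<in> V \<or> inv y \<in> V" if y: "y \<in> carrier R" for y
  proof (rule ccontr)
    assume *: "\<not> ?thesis"
    then have "y \<noteq> \<zero>" using subringE(2)[OF V(1)] by blast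
    note i = inverse_facts[OF y this]
    from * obtain n m where "\<one> \<in> scaled_span V t y n" "\<one> \<in> scaled_span V t (inv y) m"
      using span[OF y] span[OF i(1)] by blast
    then show False using one_notin_scaled_spans[OF V(1) tV nt y i(1,2)] by blast
  qed
  then show ?thesis using V W unfolding valuation_subring_def by blast
qed

text \<open>If y were not in V, its inverse would be. Dividing the integral equation by y ^ (n - 1)
  then writes y as a polynomial in that inverse with coefficients in V.\<close>

lemma valuation_subring_integrally_closed:
  assumes V: "valuation_subring V R" and y: "y \<in> carrier R"
    and c: "c \<in> {..<n} \<rightarrow> V" "monic_value R n c y = \<zero>"
  shows "y \<in> V"
proof (rule ccontr)
  assume yV: "y \<notin> V"
  have sV: "subring V R" using V by (simp add: valuation_subring_def)
  then have "y \<noteq> \<zero>" using yV subringE(2) by blast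
  note i = inverse_facts[OF y this]
  have iV: "inv y \<in> V" using V y yV by (auto simp: valuation_subring_def)
  have "n \<noteq> 0" using c(2) by (intro notI) (simp add: monic_value_def)
  then obtain m where n: "n = Suc m" by (cases n) auto
  have c': "c \<in> {..m} \<rightarrow> V" "c \<in> {..m} \<rightarrow> carrier R"
    using c(1) n subringE(1)[OF sV] by (auto simp: lessThan_Suc_atMost)
  let ?S = "\<Oplus>i \<in> {..m}. c i \<otimes> y [^] i"
  have S: "?S \<in> carrier R" using c' y by (intro finsum_closed) auto
  have "y [^] Suc m \<oplus> ?S = \<zero>" using c(2) by (simp add: monic_value_def n lessThan_Suc_atMost)
  then have "inv y [^] m \<otimes> (y [^] Suc m \<oplus> ?S) = \<zero>" using i by simp
  moreover have "inv y [^] m \<otimes> y [^] Suc m = y"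
  proof -
    have "inv y [^] m \<otimes> y [^] m = \<one>" using i y by (metis nat_pow_distrib nat_pow_one)
    then show ?thesis using i y by (simp add: m_assoc[symmetric])
  qed
  moreover have "inv y [^] m \<otimes> ?S = (\<Oplus>j \<in> {..m}. c (m - j) \<otimes> inv y [^] j)"
    using c' by (intro pow_mult_finsum_inverse_powers i y) auto
  ultimately have "y \<oplus> (\<Oplus>j \<in> {..m}. c (m - j) \<otimes> inv y [^] j) = \<zero>"
    using S i y by (simp add: r_distr del: nat_pow_Suc)
  moreover have fV: "(\<Oplus>j \<in> {..m}. c (m - j) \<otimes> inv y [^] j) \<in> V"
    using c' iV sV subringE(6)[OF sV] subring_pow_closed[OF sV iV] by (intro subring_finsum_closed) (auto simp: Pi_def)
  ultimately have "y = \<ominus> (\<Oplus>j \<in> {..m}. c (m - j) \<otimes> inv y [^] j)"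
    using sum_zero_eq_neg y subringE(1)[OF sV] by blast
  then show False using yV fV subringE(5)[OF sV] by metis
qed

end

text \<open>Closure of the integral elements under the ring operations and transitivity of integrality
  are read off from this description.\<close>

lemma integral_element_iff_valuation_subrings:
  assumes "cring D" "field K" "\<phi> \<in> ring_hom D K" "x \<in> carrier K"
  shows "integral_element D K \<phi> x \<longleftrightarrow>
    (\<forall>V. valuation_subring V K \<and> \<phi> ` carrier D \<subseteq> V \<longrightarrow> x \<in> V)"
proof -
  interpret K: field K by fact
  have ring_D: "ring D" using assms(1) by (simp add: cring_def)
  have "ring_hom_ring D K \<phi>" by (rule ring_hom_ringI2[OF ring_D K.ring_axioms assms(3)])
  then have A: "subring (\<phi> ` carrier D) K"
    by (rule ring_hom_ring.img_is_subring) (rule ring.carrier_is_subring[OF ring_D])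
  \<comment> \<open>Replaces coefficients from D by coefficients from its image, a subring of K,
    which is the form that the lemmas on valuation subrings need.\<close>
  have iff: "integral_element D K \<phi> x \<longleftrightarrow>
    (\<exists>n c. c \<in> {..<n} \<rightarrow> \<phi> ` carrier D \<and> monic_value K n c x = \<zero>\<^bsub>K\<^esub>)"
  proof -
    have "\<exists>n c. c \<in> {..<n} \<rightarrow> carrier D \<and> monic_value K n (\<lambda>i. \<phi> (c i)) x = \<zero>\<^bsub>K\<^esub>"
      if c: "c \<in> {..<n} \<rightarrow> \<phi> ` carrier D" "monic_value K n c x = \<zero>\<^bsub>K\<^esub>" for n c
    proof -
      have "\<forall>i \<in> {..<n}. \<exists>d \<in> carrier D. c i = \<phi> d" using c(1) by auto
      then obtain d where d: "\<And>i. i < n \<Longrightarrow> d i \<in> carrier D" "\<And>i. i < n \<Longrightarrow> c i = \<phi> (d i)"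
        using bchoice[of "{..<n}" "\<lambda>i d. d \<in> carrier D \<and> c i = \<phi> d"] by (auto simp: Bex_def)
      have "monic_value K n (\<lambda>i. \<phi> (d i)) x = monic_value K n c x"
        using d assms(4) c(1) subringE(1)[OF A] by (intro K.monic_value_cong) auto
      then show ?thesis using d c(2) by (intro exI[of _ n] exI[of _ d]) auto
    qed
    moreover have "\<exists>n c. c \<in> {..<n} \<rightarrow> \<phi> ` carrier D \<and> monic_value K n c x = \<zero>\<^bsub>K\<^esub>"
      if "c \<in> {..<n} \<rightarrow> carrier D" "monic_value K n (\<lambda>i. \<phi> (c i)) x = \<zero>\<^bsub>K\<^esub>" for n c
      using that by (intro exI[of _ n] exI[of _ "\<lambda>i. \<phi> (c i)"]) auto
    ultimately show ?thesis
      unfolding integral_element_iff[OF assms(1) K.is_cring assms(3)] using assms(4) by blast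
  qed
  show ?thesis
  proof
    assume "integral_element D K \<phi> x"
    then obtain n c where c: "c \<in> {..<n} \<rightarrow> \<phi> ` carrier D" "monic_value K n c x = \<zero>\<^bsub>K\<^esub>"
      unfolding iff by blast
    have "x \<in> V" if V: "valuation_subring V K" "\<phi> ` carrier D \<subseteq> V" for V
      by (rule K.valuation_subring_integrally_closed[OF V(1) assms(4) _ c(2)]) (use c(1) V(2) in auto)
    then show "\<forall>V. valuation_subring V K \<and> \<phi> ` carrier D \<subseteq> V \<longrightarrow> x \<in> V" by blast
  next
    assume "\<forall>V. valuation_subring V K \<and> \<phi> ` carrier D \<subseteq> V \<longrightarrow> x \<in> V"
    then show "integral_element D K \<phi> x"
      unfolding iff using K.exists_valuation_subring[OF A assms(4)] by blast
  qed
qed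

lemma subring_integral_closure:
  assumes "cring D" "field K" "\<phi> \<in> ring_hom D K"
  shows "subring {x \<in> carrier K. integral_element D K \<phi> x} K"
proof -
  interpret K: field K by fact
  note iff = integral_element_iff_valuation_subrings[OF assms]
  show ?thesis
    by (rule K.subringI) (auto simp: iff valuation_subring_def subringE(3,5,6,7))
qed

lemma integral_element_trans:
  assumes "cring D" "field K" "\<phi> \<in> ring_hom D K" "y \<in> carrier K"
    and "\<And>i. i < n \<Longrightarrow> integral_element D K \<phi> (c i)" "monic_value K n c y = \<zero>\<^bsub>K\<^esub>"
  shows "integral_element D K \<phi> y"
proof -
  note iff = integral_element_iff_valuation_subrings[OF assms(1-3)]
  have c: "c i \<in> carrier K" if "i < n" for i using assms(5)[OF that] by (simp add: integral_element_def)
  have "y \<in> V" if V: "valuation_subring V K" "\<phi> ` carrier D \<subseteq> V" for V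
  proof (rule field.valuation_subring_integrally_closed[OF assms(2) V(1) assms(4) _ assms(6)])
    show "c \<in> {..<n} \<rightarrow> V" using assms(5) V c by (auto simp: iff)
  qed
  then show ?thesis by (simp add: iff assms(4))
qed

section \<open>Extending homomorphisms into algebraically closed fields\<close>

lemma (in "domain") nat_pow_nonzero: "x \<in> carrier R \<Longrightarrow> x \<noteq> \<zero> \<Longrightarrow> x [^] (n::nat) \<noteq> \<zero>"
  by (induction n) (auto simp: integral_iff)

text \<open>Normalizes the leading coefficient, since the hypothesis on roots in K concerns monic
  polynomials.\<close>

lemma finsum_atMost_monic:
  assumes "cring K" "c \<in> {..d} \<rightarrow> carrier K" "b \<in> carrier K" "c d \<otimes>\<^bsub>K\<^esub> b = \<one>\<^bsub>K\<^esub>" "y \<in> carrier K"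
  shows "(\<Oplus>\<^bsub>K\<^esub>i\<in>{..d}. c i \<otimes>\<^bsub>K\<^esub> y [^]\<^bsub>K\<^esub> i) = c d \<otimes>\<^bsub>K\<^esub> monic_value K d (\<lambda>i. b \<otimes>\<^bsub>K\<^esub> c i) y"
proof -
  interpret K: cring K by fact
  have 1: "(\<lambda>i. (b \<otimes>\<^bsub>K\<^esub> c i) \<otimes>\<^bsub>K\<^esub> y [^]\<^bsub>K\<^esub> i) \<in> {..<d} \<rightarrow> carrier K" using assms by (auto simp: Pi_def)
  have "c d \<otimes>\<^bsub>K\<^esub> (\<Oplus>\<^bsub>K\<^esub>i\<in>{..<d}. (b \<otimes>\<^bsub>K\<^esub> c i) \<otimes>\<^bsub>K\<^esub> y [^]\<^bsub>K\<^esub> i)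
    = (\<Oplus>\<^bsub>K\<^esub>i\<in>{..<d}. c d \<otimes>\<^bsub>K\<^esub> ((b \<otimes>\<^bsub>K\<^esub> c i) \<otimes>\<^bsub>K\<^esub> y [^]\<^bsub>K\<^esub> i))"
    using assms 1 by (intro K.finsum_rdistr) auto
  also have "\<dots> = (\<Oplus>\<^bsub>K\<^esub>i\<in>{..<d}. c i \<otimes>\<^bsub>K\<^esub> y [^]\<^bsub>K\<^esub> i)"
  proof (rule K.finsum_cong')
    fix i assume i: "i \<in> {..<d}"
    then have "c i \<in> carrier K" "c d \<in> carrier K" using assms by auto
    then have "c d \<otimes>\<^bsub>K\<^esub> ((b \<otimes>\<^bsub>K\<^esub> c i) \<otimes>\<^bsub>K\<^esub> y [^]\<^bsub>K\<^esub> i) = (c d \<otimes>\<^bsub>K\<^esub> b) \<otimes>\<^bsub>K\<^esub> (c i \<otimes>\<^bsub>K\<^esub> y [^]\<^bsub>K\<^esub> i)"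
      using assms(3,5) by (simp add: K.m_assoc)
    then show "c d \<otimes>\<^bsub>K\<^esub> ((b \<otimes>\<^bsub>K\<^esub> c i) \<otimes>\<^bsub>K\<^esub> y [^]\<^bsub>K\<^esub> i) = c i \<otimes>\<^bsub>K\<^esub> y [^]\<^bsub>K\<^esub> i"
      using assms \<open>c i \<in> carrier K\<close> by simp
  qed (use assms in \<open>auto simp: Pi_def\<close>)
  finally show ?thesis
    using assms 1 K.finsum_atMost_eq[of "\<lambda>i. c i \<otimes>\<^bsub>K\<^esub> y [^]\<^bsub>K\<^esub> i" d]
    by (simp add: monic_value_def K.r_distr K.finsum_closed Pi_def)
qed

section \<open>Graphs of partial ring homomorphisms\<close>

lemma RDirProd_simps:
  "carrier (RDirProd E K) = carrier E \<times> carrier K"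
  "(a, b) \<otimes>\<^bsub>RDirProd E K\<^esub> (c, d) = (a \<otimes>\<^bsub>E\<^esub> c, b \<otimes>\<^bsub>K\<^esub> d)"
  "(a, b) \<oplus>\<^bsub>RDirProd E K\<^esub> (c, d) = (a \<oplus>\<^bsub>E\<^esub> c, b \<oplus>\<^bsub>K\<^esub> d)"
  "\<one>\<^bsub>RDirProd E K\<^esub> = (\<one>\<^bsub>E\<^esub>, \<one>\<^bsub>K\<^esub>)"
  "\<zero>\<^bsub>RDirProd E K\<^esub> = (\<zero>\<^bsub>E\<^esub>, \<zero>\<^bsub>K\<^esub>)"
  by (auto simp: RDirProd_def DirProd_def monoid.defs)

lemma RDirProd_uminus:
  assumes "ring E" "ring K" "a \<in> carrier E" "b \<in> carrier K"
  shows "\<ominus>\<^bsub>RDirProd E K\<^esub> (a, b) = (\<ominus>\<^bsub>E\<^esub> a, \<ominus>\<^bsub>K\<^esub> b)"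
proof -
  interpret E: ring E by fact
  interpret K: ring K by fact
  interpret P: ring "RDirProd E K" by (rule RDirProd_ring[OF assms(1,2)])
  show ?thesis
    using assms by (intro P.minus_equality) (auto simp: RDirProd_simps E.l_neg K.l_neg)
qed

lemma RDirProd_hom_pair:
  "f \<in> ring_hom R E \<Longrightarrow> g \<in> ring_hom R K \<Longrightarrow> (\<lambda>r. (f r, g r)) \<in> ring_hom R (RDirProd E K)"
  by (auto simp: ring_hom_def RDirProd_simps)

lemma image_pair_subring:
  assumes "ring R" "ring E" "ring K" "f \<in> ring_hom R E" "g \<in> ring_hom R K"
  shows "subring ((\<lambda>r. (f r, g r)) ` carrier R) (RDirProd E K)"
  by (rule ring_hom_ring.img_is_subring[OF ring_hom_ringI2])
    (use assms in \<open>auto intro: RDirProd_ring RDirProd_hom_pair ring.carrier_is_subring\<close>)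

text \<open>Two pairs with the same first entry differ by a pair (0, y - y'), so excluding (0, y)
  for y \<noteq> 0 is all that makes a subring of the product the graph of a homomorphism.\<close>

lemma functional_subring_hom:
  assumes "cring E" "cring K" and G: "subring G (RDirProd E K)"
    and fn: "\<And>y. (\<zero>\<^bsub>E\<^esub>, y) \<in> G \<Longrightarrow> y = \<zero>\<^bsub>K\<^esub>"
  shows "subring (fst ` G) E"
    and "\<exists>g. g \<in> ring_hom (E\<lparr>carrier := fst ` G\<rparr>) K \<and> (\<forall>x y. (x, y) \<in> G \<longleftrightarrow> x \<in> fst ` G \<and> g x = y)"
proof -
  interpret E: cring E by fact
  interpret K: cring K by fact
  note G' = subringE[OF G]
  have GR: "x \<in> carrier E" "y \<in> carrier K" if "(x, y) \<in> G" for x y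
    using that G'(1) by (auto simp: RDirProd_simps)
  have neg: "(\<ominus>\<^bsub>E\<^esub> x, \<ominus>\<^bsub>K\<^esub> y) \<in> G" if "(x, y) \<in> G" for x y
    using G'(5)[OF that] GR[OF that] RDirProd_uminus[OF E.ring_axioms K.ring_axioms] by simp
  have mul: "(x \<otimes>\<^bsub>E\<^esub> x', y \<otimes>\<^bsub>K\<^esub> y') \<in> G" if "(x, y) \<in> G" "(x', y') \<in> G" for x y x' y'
    using G'(6)[OF that] by (simp add: RDirProd_simps)
  have add: "(x \<oplus>\<^bsub>E\<^esub> x', y \<oplus>\<^bsub>K\<^esub> y') \<in> G" if "(x, y) \<in> G" "(x', y') \<in> G" for x y x' y'
    using G'(7)[OF that] by (simp add: RDirProd_simps)
  have one: "(\<one>\<^bsub>E\<^esub>, \<one>\<^bsub>K\<^esub>) \<in> G" using G'(3) by (simp add: RDirProd_simps)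
  show "subring (fst ` G) E"
  proof (rule E.subringI)
    show "fst ` G \<subseteq> carrier E" using GR by auto
    show "\<one>\<^bsub>E\<^esub> \<in> fst ` G" using one by force
    show "\<ominus>\<^bsub>E\<^esub> h \<in> fst ` G" if "h \<in> fst ` G" for h using that neg by force
    show "h1 \<otimes>\<^bsub>E\<^esub> h2 \<in> fst ` G" if "h1 \<in> fst ` G" "h2 \<in> fst ` G" for h1 h2 using that mul by force
    show "h1 \<oplus>\<^bsub>E\<^esub> h2 \<in> fst ` G" if "h1 \<in> fst ` G" "h2 \<in> fst ` G" for h1 h2 using that add by force
  qed
  have uniq: "y = y'" if y: "(x, y) \<in> G" "(x, y') \<in> G" for x y y'
  proof -
    have "(x \<oplus>\<^bsub>E\<^esub> \<ominus>\<^bsub>E\<^esub> x, y \<oplus>\<^bsub>K\<^esub> \<ominus>\<^bsub>K\<^esub> y') \<in> G" by (rule add[OF y(1) neg[OF y(2)]])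
    then have "y \<oplus>\<^bsub>K\<^esub> \<ominus>\<^bsub>K\<^esub> y' = \<zero>\<^bsub>K\<^esub>" using fn GR[OF y(1)] by (simp add: E.r_neg)
    then show ?thesis using GR(2)[OF y(1)] GR(2)[OF y(2)] by (simp add: K.minus_eq[symmetric])
  qed
  define g where "g x = (THE y. (x, y) \<in> G)" for x
  have g: "g x = y" if "(x, y) \<in> G" for x y
    unfolding g_def using that uniq by (intro the_equality) auto
  have gG: "(x, g x) \<in> G" if "x \<in> fst ` G" for x using that g by force
  have "g \<in> ring_hom (E\<lparr>carrier := fst ` G\<rparr>) K"
  proof (rule ring_hom_memI)
    fix x x' assume "x \<in> carrier (E\<lparr>carrier := fst ` G\<rparr>)" "x' \<in> carrier (E\<lparr>carrier := fst ` G\<rparr>)"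
    then have "(x, g x) \<in> G" "(x', g x') \<in> G" using gG by simp_all
    then show "g (x \<otimes>\<^bsub>E\<lparr>carrier := fst ` G\<rparr>\<^esub> x') = g x \<otimes>\<^bsub>K\<^esub> g x'"
      "g (x \<oplus>\<^bsub>E\<lparr>carrier := fst ` G\<rparr>\<^esub> x') = g x \<oplus>\<^bsub>K\<^esub> g x'"
      using g[OF mul] g[OF add] by simp_all
  next
    show "g x \<in> carrier K" if "x \<in> carrier (E\<lparr>carrier := fst ` G\<rparr>)" for x
      using GR(2)[OF gG] that by simp
    show "g \<one>\<^bsub>E\<lparr>carrier := fst ` G\<rparr>\<^esub> = \<one>\<^bsub>K\<^esub>" using g[OF one] by simp
  qed
  moreover have "(x, y) \<in> G \<longleftrightarrow> x \<in> fst ` G \<and> g x = y" for x y using g gG by force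
  ultimately show "\<exists>g. g \<in> ring_hom (E\<lparr>carrier := fst ` G\<rparr>) K \<and> (\<forall>x y. (x, y) \<in> G \<longleftrightarrow> x \<in> fst ` G \<and> g x = y)"
    by blast
qed

text \<open>The image of \<open>x\<close> is chosen as a root of the image of a nonzero polynomial of least degree
  vanishing at \<open>x\<close>; pseudo-division shows that this respects every relation for \<open>x\<close>.\<close>

lemma extend_injective_hom_by_root:
  assumes E: "domain E" and K: "field K"
    and roots: "\<And>n c. 0 < n \<Longrightarrow> c \<in> {..<n} \<rightarrow> carrier K \<Longrightarrow> \<exists>a \<in> carrier K. monic_value K n c a = \<zero>\<^bsub>K\<^esub>"
    and A: "subring A E" and g: "g \<in> ring_hom (E\<lparr>carrier := A\<rparr>) K"
    and inj: "\<And>a. a \<in> A \<Longrightarrow> g a = \<zero>\<^bsub>K\<^esub> \<Longrightarrow> a = \<zero>\<^bsub>E\<^esub>"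
    and x: "x \<in> carrier E" and int: "c \<in> {..<n} \<rightarrow> A" "monic_value E n c x = \<zero>\<^bsub>E\<^esub>"
  shows "\<exists>G. subring G (RDirProd E K) \<and> (\<forall>y. (\<zero>\<^bsub>E\<^esub>, y) \<in> G \<longrightarrow> y = \<zero>\<^bsub>K\<^esub>) \<and>
    (\<forall>a \<in> A. (a, g a) \<in> G) \<and> x \<in> fst ` G"
proof -
  let ?A = "E\<lparr>carrier := A\<rparr>"
  interpret E: "domain" E by fact
  interpret K: field K by fact
  have Ad: "domain ?A" by (rule E.subring_is_domain[OF A])
  interpret A: UP_domain ?A "UP ?A" by (simp_all add: UP_domain_def Ad)
  let ?P = "UP ?A" and ?eE = "UnivPoly.eval ?A E id x"
  have Ac: "cring ?A" by (rule A.R.is_cring)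
  interpret U: UP_pre_univ_prop ?A E id ?P
    by (rule UP_pre_univ_propI[OF Ac E.is_cring E.subring_id_hom[OF A]])
  interpret eE: ring_hom_cring ?P E ?eE
    using U.eval_ring_hom[OF x] by unfold_locales
  interpret W: UP_pre_univ_prop ?A K g ?P
    by (rule UP_pre_univ_propI[OF Ac K.is_cring g])
  define Z where "Z = {f \<in> carrier ?P. f \<noteq> \<zero>\<^bsub>?P\<^esub> \<and> ?eE f = \<zero>\<^bsub>E\<^esub>}"
  have "monic_UP ?A n c \<in> Z"
  proof -
    have ne: "\<one>\<^bsub>?A\<^esub> \<noteq> \<zero>\<^bsub>?A\<^esub>" by simp
    have c: "c \<in> {..<n} \<rightarrow> carrier ?A" using int(1) by simp
    have "?eE (monic_UP ?A n c) = monic_value E n (\<lambda>i. id (c i)) x"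
      by (rule A.eval_monic_UP[OF E.is_cring E.subring_id_hom[OF A] x c ne])
    moreover have "monic_UP ?A n c \<noteq> \<zero>\<^bsub>?P\<^esub>"
    proof
      assume "monic_UP ?A n c = \<zero>\<^bsub>?P\<^esub>"
      then have "up_ring.coeff ?P (monic_UP ?A n c) n = \<zero>\<^bsub>?A\<^esub>" by (simp only: A.coeff_zero)
      then show False using A.coeff_monic_UP[OF c] ne by (simp add: monic_UP_def)
    qed
    ultimately show ?thesis using A.monic_UP_closed[OF c] int(2) by (simp add: Z_def)
  qed
  then obtain m where m: "m \<in> Z" and least: "\<And>f. f \<in> Z \<Longrightarrow> deg ?A m \<le> deg ?A f"
    using ex_has_least_nat[of "\<lambda>f. f \<in> Z" _ "deg ?A"] by blast
  define d where "d = deg ?A m"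
  let ?m = "up_ring.coeff ?P m"
  have mP: "m \<in> carrier ?P" "m \<noteq> \<zero>\<^bsub>?P\<^esub>" "?eE m = \<zero>\<^bsub>E\<^esub>" using m by (auto simp: Z_def)
  have lc: "?m d \<in> A" "?m d \<noteq> \<zero>\<^bsub>E\<^esub>"
    using A.lcoeff_nonzero2[OF mP(1,2)] A.lcoeff_closed[OF mP(1)] by (auto simp: d_def)
  have mA: "?m i \<in> carrier ?A" for i using A.coeff_closed[OF mP(1)] .
  \<comment> \<open>A nonzero constant does not vanish at x; positive degree is what the existence
    of roots asks for.\<close>
  have d0: "0 < d"
  proof (rule ccontr)
    assume "\<not> 0 < d"
    then have d0: "deg ?A m = 0" by (simp add: d_def)
    have "m = up_ring.monom ?P (?m 0) 0" using A.deg_zero_impl_monom[OF mP(1) d0] by simp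
    then have "?eE m = ?m 0" using U.eval_const[OF x mA[of 0]] by simp
    then show False using lc(2) mP(3) d0 by (simp add: d_def)
  qed
  have gm: "g (?m i) \<in> carrier K" for i using W.hom_closed[OF mA] .
  \<comment> \<open>Injectivity of g keeps the degree of the image polynomial, whose leading
    coefficient is now invertible in K.\<close>
  have glc: "g (?m d) \<noteq> \<zero>\<^bsub>K\<^esub>" using inj lc by blast
  let ?b = "inv\<^bsub>K\<^esub> (g (?m d))"
  note i = K.inverse_facts[OF gm glc]
  obtain y where y: "y \<in> carrier K" "monic_value K d (\<lambda>i. ?b \<otimes>\<^bsub>K\<^esub> g (?m i)) y = \<zero>\<^bsub>K\<^esub>"
    using roots[OF d0, of "\<lambda>i. ?b \<otimes>\<^bsub>K\<^esub> g (?m i)"] gm i by auto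
  let ?eK = "UnivPoly.eval ?A K g y"
  interpret eK: ring_hom_cring ?P K ?eK
    using W.eval_ring_hom[OF y(1)] by unfold_locales
  have mK: "?eK m = \<zero>\<^bsub>K\<^esub>"
    unfolding A.eval_on_carrier[OF mP(1)] d_def[symmetric]
    using finsum_atMost_monic[OF K.is_cring, of "\<lambda>i. g (?m i)" d ?b y] i gm y by simp
  \<comment> \<open>Division by m is possible after multiplying f by a power of the leading
    coefficient. The remainder vanishes at x and has smaller degree, so it is zero, and the image of
    that power is nonzero in K and can be cancelled.\<close>
  have rel: "?eK f = \<zero>\<^bsub>K\<^esub>" if f: "f \<in> carrier ?P" "?eE f = \<zero>\<^bsub>E\<^esub>" for f
  proof -
    obtain q r k where qr: "q \<in> carrier ?P" "r \<in> carrier ?P"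
      "?m d [^]\<^bsub>?A\<^esub> (k::nat) \<odot>\<^bsub>?P\<^esub> f = m \<otimes>\<^bsub>?P\<^esub> q \<oplus>\<^bsub>?P\<^esub> r"
      "r = \<zero>\<^bsub>?P\<^esub> \<or> deg ?A r < deg ?A m"
      using A.long_div_theorem[OF mP(1) f(1) mP(2)] unfolding d_def by blast
    let ?u = "?m d [^]\<^bsub>?A\<^esub> k"
    have uA: "?u \<in> carrier ?A" by (rule A.R.nat_pow_closed[OF mA])
    have sm: "?u \<odot>\<^bsub>?P\<^esub> f = up_ring.monom ?P ?u 0 \<otimes>\<^bsub>?P\<^esub> f"
      using A.monom_mult_is_smult[OF uA f(1)] by simp
    have "?eE (up_ring.monom ?P ?u 0 \<otimes>\<^bsub>?P\<^esub> f) = \<zero>\<^bsub>E\<^esub>"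
      using f uA by simp
    then have "?eE r = \<zero>\<^bsub>E\<^esub>"
      using qr(1,2) mP unfolding sm[symmetric] qr(3) by simp
    then have "r \<noteq> \<zero>\<^bsub>?P\<^esub> \<Longrightarrow> r \<in> Z" using qr(2) by (simp add: Z_def)
    then have "r = \<zero>\<^bsub>?P\<^esub>" using least[of r] qr(4) leD by blast
    then have "up_ring.monom ?P ?u 0 \<otimes>\<^bsub>?P\<^esub> f = m \<otimes>\<^bsub>?P\<^esub> q" using qr sm mP by simp
    then have "?eK (up_ring.monom ?P ?u 0 \<otimes>\<^bsub>?P\<^esub> f) = \<zero>\<^bsub>K\<^esub>" using mK mP qr(1) by simp
    then have "g ?u \<otimes>\<^bsub>K\<^esub> ?eK f = \<zero>\<^bsub>K\<^esub>"
      using W.eval_const[OF y(1) uA] uA f(1) by simp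
    moreover have "g ?u \<noteq> \<zero>\<^bsub>K\<^esub>"
      using K.nat_pow_nonzero[OF gm glc] W.hom_pow[OF mA] by simp
    moreover have "g ?u \<in> carrier K" "?eK f \<in> carrier K"
      using W.hom_closed[OF uA] eK.hom_closed[OF f(1)] .
    ultimately show ?thesis using K.integral by blast
  qed
  \<comment> \<open>The graph of the extension to A[x]: the value of f at x is paired with the value
    at y of its image under g.\<close>
  let ?G = "(\<lambda>f. (?eE f, ?eK f)) ` carrier ?P"
  have "subring ?G (RDirProd E K)"
    by (rule image_pair_subring) (simp_all add: A.P.ring_axioms E.ring_axioms K.ring_axioms)
  moreover have "y' = \<zero>\<^bsub>K\<^esub>" if "(\<zero>\<^bsub>E\<^esub>, y') \<in> ?G" for y' using that rel by auto
  moreover have "(a, g a) \<in> ?G" if a: "a \<in> A" for a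
  proof -
    have aA: "a \<in> carrier ?A" using a by simp
    show ?thesis
      using U.eval_const[OF x aA] W.eval_const[OF y(1) aA] A.monom_closed[OF aA, of 0]
      by (intro image_eqI[of _ _ "up_ring.monom ?P a 0"]) auto
  qed
  moreover have "x \<in> fst ` ?G"
  proof -
    have "?eE (up_ring.monom ?P \<one>\<^bsub>?A\<^esub> 1) = x" by (rule U.eval_monom1[OF x])
    moreover have "up_ring.monom ?P \<one>\<^bsub>?A\<^esub> 1 \<in> carrier ?P" by (rule A.monom_closed[OF A.R.one_closed])
    ultimately show ?thesis unfolding image_image by (intro image_eqI[of _ _ "up_ring.monom ?P \<one>\<^bsub>?A\<^esub> 1"]) auto
  qed
  ultimately show ?thesis by blast
qed

text \<open>The partial map g of a maximal graph is injective: a nonzero element of its domain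
  divides a nonzero element from R, where g agrees with \<psi> and the kernels coincide. An
  injective partial map extends to any further integral element, so by maximality the domain is
  E.\<close>

lemma integral_domain_hom_extension:
  assumes E: "domain E" and K: "field K"
    and roots: "\<And>n c. 0 < n \<Longrightarrow> c \<in> {..<n} \<rightarrow> carrier K \<Longrightarrow> \<exists>a \<in> carrier K. monic_value K n c a = \<zero>\<^bsub>K\<^esub>"
    and R: "cring R" and hom: "\<phi> \<in> ring_hom R E" "\<psi> \<in> ring_hom R K"
    and ker: "\<And>r. r \<in> carrier R \<Longrightarrow> \<phi> r = \<zero>\<^bsub>E\<^esub> \<longleftrightarrow> \<psi> r = \<zero>\<^bsub>K\<^esub>"
    and int: "\<And>x. x \<in> carrier E \<Longrightarrow> integral_element R E \<phi> x"
  shows "\<exists>h \<in> ring_hom E K. \<forall>r \<in> carrier R. h (\<phi> r) = \<psi> r"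
proof -
  interpret E: "domain" E by fact
  interpret K: field K by fact
  interpret R: cring R by fact
  let ?P = "RDirProd E K" and ?G0 = "(\<lambda>r. (\<phi> r, \<psi> r)) ` carrier R"
  interpret P: ring ?P by (rule RDirProd_ring[OF E.ring_axioms K.ring_axioms])
  define F where "F = {G. subring G ?P \<and> ?G0 \<subseteq> G \<and> (\<forall>y. (\<zero>\<^bsub>E\<^esub>, y) \<in> G \<longrightarrow> y = \<zero>\<^bsub>K\<^esub>)}"
  have "\<exists>G\<in>F. \<forall>H\<in>F. G \<subseteq> H \<longrightarrow> H = G"
  proof (rule subset_Zorn_nonempty)
    have "subring ?G0 ?P"
      by (rule image_pair_subring[OF R.ring_axioms E.ring_axioms K.ring_axioms hom])
    moreover have "\<psi> r = \<zero>\<^bsub>K\<^esub>" if "r \<in> carrier R" "\<zero>\<^bsub>E\<^esub> = \<phi> r" for r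
      using ker[OF that(1)] that(2) by simp
    ultimately have "?G0 \<in> F" by (auto simp: F_def)
    then show "F \<noteq> {}" by blast
    fix C assume C: "C \<noteq> {}" "subset.chain F C"
    then have CF: "C \<subseteq> F" unfolding subset.chain_def by blast
    have "subset.chain {H. subring H ?P} C" using C CF unfolding subset.chain_def F_def by blast
    then have "subring (\<Union>C) ?P" by (rule P.chain_Union_subring[OF C(1)])
    moreover have "?G0 \<subseteq> \<Union>C" using CF C(1) unfolding F_def by blast
    moreover have "y = \<zero>\<^bsub>K\<^esub>" if "(\<zero>\<^bsub>E\<^esub>, y) \<in> \<Union>C" for y using CF that unfolding F_def by blast
    ultimately show "\<Union>C \<in> F" by (simp add: F_def)
  qed
  then obtain G where "G \<in> F" and max: "\<And>H. H \<in> F \<Longrightarrow> G \<subseteq> H \<Longrightarrow> H = G" by blast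
  then have G: "subring G ?P" "?G0 \<subseteq> G" "\<And>y. (\<zero>\<^bsub>E\<^esub>, y) \<in> G \<Longrightarrow> y = \<zero>\<^bsub>K\<^esub>" by (auto simp: F_def)
  let ?D = "fst ` G"
  let ?A = "E\<lparr>carrier := ?D\<rparr>"
  note sub = functional_subring_hom(1)[OF E.is_cring K.is_cring G(1,3)]
  obtain g where g: "g \<in> ring_hom ?A K" and gG: "\<And>x y. (x, y) \<in> G \<longleftrightarrow> x \<in> ?D \<and> g x = y"
    using functional_subring_hom(2)[OF E.is_cring K.is_cring G(1,3)] by blast
  have g\<phi>: "\<phi> r \<in> ?D" "g (\<phi> r) = \<psi> r" if "r \<in> carrier R" for r
    using gG G(2) that by blast+
  have Ad: "domain ?A" by (rule E.subring_is_domain[OF sub])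
  interpret A: "domain" ?A by (rule Ad)
  have \<phi>A: "\<phi> \<in> ring_hom R ?A" using hom(1) g\<phi>(1) by (auto simp: ring_hom_def)
  interpret gh: ring_hom_cring ?A K g by (rule ring_hom_cring_memI[OF A.is_cring K.is_cring g])
  have inj: "a = \<zero>\<^bsub>E\<^esub>" if a: "a \<in> ?D" "g a = \<zero>\<^bsub>K\<^esub>" for a
  proof (rule ccontr)
    assume a0: "a \<noteq> \<zero>\<^bsub>E\<^esub>"
    have aE: "a \<in> carrier E" using a(1) subringE(1)[OF sub] by blast
    obtain n c where c: "c \<in> {..<n} \<rightarrow> carrier R" "monic_value E n (\<lambda>i. \<phi> (c i)) a = \<zero>\<^bsub>E\<^esub>"
      using int[OF aE] unfolding integral_element_iff[OF R E.is_cring hom(1)] by blast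
    \<comment> \<open>The equation of a is moved into the subring \<open>?A\<close>, so that the
      cofactor \<open>z\<close> found below lies in the domain of g.\<close>
    have "id (monic_value ?A n (\<lambda>i. \<phi> (c i)) a) = monic_value E n (\<lambda>i. id (\<phi> (c i))) (id a)"
      using c(1) a(1) g\<phi>(1)
      by (intro ring_hom_monic_value[OF A.is_cring E.is_cring E.subring_id_hom[OF sub]]) auto
    then have "integral_element R ?A \<phi> a"
      unfolding integral_element_iff[OF R A.is_cring \<phi>A] using c a(1) by auto
    from integral_divides_nonzero[OF Ad R \<phi>A this] a0
    obtain z r where z: "z \<in> ?D" "r \<in> carrier R" "a \<otimes>\<^bsub>E\<^esub> z = \<phi> r" "\<phi> r \<noteq> \<zero>\<^bsub>E\<^esub>" by auto
    have "g (a \<otimes>\<^bsub>?A\<^esub> z) = g a \<otimes>\<^bsub>K\<^esub> g z" using z a by (intro gh.hom_mult) auto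
    then have "g (\<phi> r) = \<zero>\<^bsub>K\<^esub>" using z a gh.hom_closed[of z] by simp
    then have "\<psi> r = \<zero>\<^bsub>K\<^esub>" using z g\<phi>(2) by simp
    then show False using z ker by blast
  qed
  have D: "x \<in> ?D" if x: "x \<in> carrier E" for x
  proof -
    obtain n c where c: "c \<in> {..<n} \<rightarrow> carrier R" "monic_value E n (\<lambda>i. \<phi> (c i)) x = \<zero>\<^bsub>E\<^esub>"
      using int[OF x] unfolding integral_element_iff[OF R E.is_cring hom(1)] by blast
    have "(\<lambda>i. \<phi> (c i)) \<in> {..<n} \<rightarrow> ?D" using c(1) g\<phi>(1) by auto
    from extend_injective_hom_by_root[OF E K roots sub g inj x this c(2)]
    obtain H where "subring H ?P \<and> (\<forall>y. (\<zero>\<^bsub>E\<^esub>, y) \<in> H \<longrightarrow> y = \<zero>\<^bsub>K\<^esub>) \<and>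
      (\<forall>a \<in> ?D. (a, g a) \<in> H) \<and> x \<in> fst ` H" by (rule exE)
    then have H: "subring H ?P" "\<And>y. (\<zero>\<^bsub>E\<^esub>, y) \<in> H \<Longrightarrow> y = \<zero>\<^bsub>K\<^esub>"
      "\<And>a. a \<in> ?D \<Longrightarrow> (a, g a) \<in> H" "x \<in> fst ` H" by blast+
    have GH: "G \<subseteq> H"
    proof
      fix z assume "z \<in> G"
      then have "fst z \<in> ?D" "g (fst z) = snd z" using gG[of "fst z" "snd z"] by simp_all
      then show "z \<in> H" using H(3)[of "fst z"] by simp
    qed
    then have "H \<in> F" using G(2) H(1,2) by (auto simp: F_def)
    then show ?thesis using max[OF _ GH] H(4) by simp
  qed
  then have "?D = carrier E" using subringE(1)[OF sub] by blast
  then have "g \<in> ring_hom E K" using g by simp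
  then show ?thesis using g\<phi>(2) by blast
qed

text \<open>Since q contracts to the kernel of \<psi>, the map from R to the domain S/q has the same
  kernel as \<psi>, and the extension lemma for domains applies to S/q.\<close>

lemma integral_extension_hom_to_field:
  assumes S: "cring S" and K: "field K"
    and roots: "\<And>n c. 0 < n \<Longrightarrow> c \<in> {..<n} \<rightarrow> carrier K \<Longrightarrow> \<exists>a \<in> carrier K. monic_value K n c a = \<zero>\<^bsub>K\<^esub>"
    and R: "cring R" and hom: "\<phi> \<in> ring_hom R S" "\<psi> \<in> ring_hom R K"
    and q: "primeideal q S"
    and ker: "\<And>r. r \<in> carrier R \<Longrightarrow> \<phi> r \<in> q \<longleftrightarrow> \<psi> r = \<zero>\<^bsub>K\<^esub>"
    and int: "integral_extension R S \<phi>"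
  shows "\<exists>h \<in> ring_hom S K. \<forall>r \<in> carrier R. h (\<phi> r) = \<psi> r"
proof -
  interpret q: primeideal q S by fact
  let ?E = "S Quot q" and ?p = "\<lambda>x. q +>\<^bsub>S\<^esub> x"
  have E: "domain ?E" by (rule q.quotient_is_domain)
  then have Ec: "cring ?E" by (rule domain.axioms)
  have p: "?p \<in> ring_hom S ?E" by (rule q.rcos_ring_hom)
  have p0: "?p x = \<zero>\<^bsub>?E\<^esub> \<longleftrightarrow> x \<in> q" if "x \<in> carrier S" for x
    using that q.rcos_const_imp_mem q.a_rcos_const by (auto simp: FactRing_def)
  have "\<exists>h \<in> ring_hom ?E K. \<forall>r \<in> carrier R. h ((?p \<circ> \<phi>) r) = \<psi> r"
  proof (rule integral_domain_hom_extension[OF E K roots R ring_hom_trans[OF hom(1) p] hom(2)])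
    show "(?p \<circ> \<phi>) r = \<zero>\<^bsub>?E\<^esub> \<longleftrightarrow> \<psi> r = \<zero>\<^bsub>K\<^esub>" if "r \<in> carrier R" for r
      using p0[OF ring_hom_closed[OF hom(1) that]] ker[OF that] by simp
    fix x assume "x \<in> carrier ?E"
    then obtain s where s: "s \<in> carrier S" "x = ?p s"
      by (auto simp: FactRing_def A_RCOSETS_def' a_r_coset_def)
    then obtain n c where c: "c \<in> {..<n} \<rightarrow> carrier R" "monic_value S n (\<lambda>i. \<phi> (c i)) s = \<zero>\<^bsub>S\<^esub>"
      using int unfolding integral_extension_def integral_element_iff[OF R S hom(1)] by blast
    have "?p (monic_value S n (\<lambda>i. \<phi> (c i)) s) = monic_value ?E n (\<lambda>i. ?p (\<phi> (c i))) (?p s)"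
      using c(1) s(1) ring_hom_closed[OF hom(1)] by (intro ring_hom_monic_value[OF S Ec p]) auto
    moreover have "?p \<zero>\<^bsub>S\<^esub> = \<zero>\<^bsub>?E\<^esub>" using p0[of "\<zero>\<^bsub>S\<^esub>"] by simp
    moreover have "x \<in> carrier ?E" using s ring_hom_closed[OF p] by simp
    ultimately show "integral_element R ?E (?p \<circ> \<phi>) x"
      unfolding integral_element_iff[OF R Ec ring_hom_trans[OF hom(1) p]] using c s by auto
  qed
  then obtain h where "h \<in> ring_hom ?E K" "\<forall>r \<in> carrier R. h (?p (\<phi> r)) = \<psi> r" by auto
  then show ?thesis using ring_hom_trans[OF p] by (intro bexI[of _ "h \<circ> ?p"]) auto
qed

section \<open>The integral closure of a domain in an algebraic closure, and products\<close>

text \<open>The polynomials of \<open>algebraically_closed\<close> are lists with the leading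
  coefficient first, whence \<open>rev\<close>.\<close>

lemma (in ring) eval_monic_list:
  assumes "c \<in> {..<n} \<rightarrow> carrier R" "x \<in> carrier R"
  shows "ring.eval R (map c (rev [0..<n])) x = (\<Oplus>i \<in> {..<n}. c i \<otimes> x [^] i)"
  using assms(1)
proof (induction n)
  case 0
  then show ?case by simp
next
  case (Suc n)
  have "(\<Oplus>i \<in> {..<Suc n}. c i \<otimes> x [^] i) = c n \<otimes> x [^] n \<oplus> (\<Oplus>i \<in> {..<n}. c i \<otimes> x [^] i)"
    unfolding lessThan_Suc using Suc.prems assms(2) by (intro finsum_insert) (auto simp: Pi_def)
  then show ?case using Suc by (simp add: Pi_def)
qed

text \<open>A polynomial that splits has as many roots as its degree, which is positive
  here.\<close>

lemma (in algebraically_closed) exists_root_monic: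
  assumes "0 < n" "c \<in> {..<n} \<rightarrow> carrier L"
  shows "\<exists>a \<in> carrier L. monic_value L n c a = \<zero>"
proof -
  let ?l = "map c (rev [0..<n])"
  let ?p = "\<one> # ?l"
  have "set ?l \<subseteq> carrier L" using assms(2) by auto
  then have p: "?p \<in> carrier (poly_ring L)"
    unfolding univ_poly_carrier[symmetric] polynomial_def by simp
  have "size (roots ?p) = degree ?p"
    using roots_over_carrier[OF p] by (simp add: splitted_def)
  then have "roots ?p \<noteq> {#}" using assms(1) by (intro notI) simp
  then obtain a where "a \<in># roots ?p" by blast
  then have a: "a \<in> carrier L" "eval ?p a = \<zero>"
    using roots_mem_iff_is_root[OF p] by (auto simp: is_root_def)
  then have "a [^] n \<oplus> eval ?l a = \<zero>" by simp
  then show ?thesis using a(1) eval_monic_list[OF assms(2) a(1)] by (auto simp: monic_value_def)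
qed

lemma (in cring) monic_value_restrict:
  assumes "subring A R" "c \<in> {..<n} \<rightarrow> A" "x \<in> A"
  shows "monic_value (R\<lparr>carrier := A\<rparr>) n c x = monic_value R n c x"
  using ring_hom_monic_value[OF subring_cring[OF assms(1)] is_cring subring_id_hom[OF assms(1)], of c n x]
    assms(2,3) by simp

context "domain"
begin

lemma frac_closure_field: "field (frac_closure R)"
  using frac_closure_algebraic_closure algebraic_closure.axioms(1) by blast

lemma frac_closure_roots:
  assumes "0 < n" "c \<in> {..<n} \<rightarrow> carrier (frac_closure R)"
  shows "\<exists>a \<in> carrier (frac_closure R). monic_value (frac_closure R) n c a = \<zero>\<^bsub>frac_closure R\<^esub>"
proof -
  interpret L: algebraic_closure "frac_closure R" "ring.indexed_const (fraction_field R) ` carrier (fraction_field R)"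
    by (rule frac_closure_algebraic_closure)
  show ?thesis by (rule L.exists_root_monic[OF assms])
qed

lemma plus_map_hom: "plus_map R \<in> ring_hom R (frac_closure R)"
proof -
  interpret F: field "fraction_field R" by (rule fraction_field_is_field)
  have "(\<lambda>a. fraction R a \<one>) \<in> ring_hom R (fraction_field R)"
  proof (rule ring_hom_memI)
    fix a b assume ab: "a \<in> carrier R" "b \<in> carrier R"
    show "fraction R (a \<otimes> b) \<one> = fraction R a \<one> \<otimes>\<^bsub>fraction_field R\<^esub> fraction R b \<one>"
      using ab by (subst fraction_mult) auto
    show "fraction R (a \<oplus> b) \<one> = fraction R a \<one> \<oplus>\<^bsub>fraction_field R\<^esub> fraction R b \<one>"
      using ab by (subst fraction_add) auto
  next
    fix a assume "a \<in> carrier R"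
    then show "fraction R a \<one> \<in> carrier (fraction_field R)"
      unfolding fraction_field_def partial_object.simps
      by (intro CollectI exI[of _ a] exI[of _ \<one>]) simp
  qed (simp add: fraction_field_def)
  from ring_hom_trans[OF this F.alg_closureE(2)] show ?thesis
    by (simp add: frac_closure_def plus_map_def[abs_def] comp_def)
qed

lemma plus_map_eq_zero_iff:
  assumes "a \<in> carrier R"
  shows "plus_map R a = \<zero>\<^bsub>frac_closure R\<^esub> \<longleftrightarrow> a = \<zero>"
proof -
  interpret F: field "fraction_field R" by (rule fraction_field_is_field)
  interpret K: field "frac_closure R" by (rule frac_closure_field)
  interpret h: ring_hom_cring R "frac_closure R" "plus_map R"
    by (rule ring_hom_cring_memI[OF is_cring K.is_cring plus_map_hom])
  have "a = \<zero>" if "plus_map R a = plus_map R \<zero>"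
    using injD[OF F.indexed_const_is_inj that[unfolded plus_map_def]] assms
    by (subst (asm) fraction_eq_iff) auto
  then show ?thesis using h.hom_zero by metis
qed

lemma plus_ring_subring:
  "subring {x \<in> carrier (frac_closure R). integral_element R (frac_closure R) (plus_map R) x} (frac_closure R)"
  by (rule subring_integral_closure[OF is_cring frac_closure_field plus_map_hom])

lemma plus_ring_domain: "domain (plus_ring R)"
  unfolding plus_ring_def
  by (rule domain.subring_is_domain[OF field.axioms(1)[OF frac_closure_field] plus_ring_subring])

lemma plus_ring_simps [simp]:
  "x \<otimes>\<^bsub>plus_ring R\<^esub> y = x \<otimes>\<^bsub>frac_closure R\<^esub> y" "x \<oplus>\<^bsub>plus_ring R\<^esub> y = x \<oplus>\<^bsub>frac_closure R\<^esub> y"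
  "\<one>\<^bsub>plus_ring R\<^esub> = \<one>\<^bsub>frac_closure R\<^esub>" "\<zero>\<^bsub>plus_ring R\<^esub> = \<zero>\<^bsub>frac_closure R\<^esub>"
  by (simp_all add: plus_ring_def)

lemma plus_ring_carrier:
  "x \<in> carrier (plus_ring R) \<longleftrightarrow> integral_element R (frac_closure R) (plus_map R) x"
  by (auto simp: plus_ring_def integral_element_def)

lemma plus_ring_monic_value:
  assumes "c \<in> {..<n} \<rightarrow> carrier (plus_ring R)" "x \<in> carrier (plus_ring R)"
  shows "monic_value (plus_ring R) n c x = monic_value (frac_closure R) n c x"
  using assms unfolding plus_ring_def
  by (intro cring.monic_value_restrict fieldE(1) frac_closure_field plus_ring_subring) auto

lemma plus_map_hom_plus_ring: "plus_map R \<in> ring_hom R (plus_ring R)"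
proof -
  have "integral_element R (frac_closure R) (plus_map R) (plus_map R a)" if "a \<in> carrier R" for a
    using integral_element_iff_valuation_subrings[OF is_cring frac_closure_field plus_map_hom
        ring_hom_closed[OF plus_map_hom that]] that by blast
  then show ?thesis
    using plus_map_hom by (auto simp: ring_hom_def plus_ring_carrier)
qed

text \<open>A root in the algebraic closure is integral over integral elements, hence over R by
  transitivity.\<close>

lemma plus_ring_roots:
  assumes "0 < n" "c \<in> {..<n} \<rightarrow> carrier (plus_ring R)"
  shows "\<exists>a \<in> carrier (plus_ring R). monic_value (plus_ring R) n c a = \<zero>\<^bsub>plus_ring R\<^esub>"
proof -
  have int: "integral_element R (frac_closure R) (plus_map R) (c i)" if "i < n" for i
    using assms(2) that plus_ring_carrier by auto
  then have "c \<in> {..<n} \<rightarrow> carrier (frac_closure R)" by (auto simp: integral_element_def)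
  from frac_closure_roots[OF assms(1) this]
  obtain a where a: "a \<in> carrier (frac_closure R)" "monic_value (frac_closure R) n c a = \<zero>\<^bsub>frac_closure R\<^esub>"
    by blast
  then have "a \<in> carrier (plus_ring R)"
    unfolding plus_ring_carrier
    by (intro integral_element_trans[OF is_cring frac_closure_field plus_map_hom _ int])
  then show ?thesis using a plus_ring_monic_value[OF assms(2)] by auto
qed

lemma plus_ring_integral:
  assumes "x \<in> carrier (plus_ring R)"
  shows "\<exists>n c. c \<in> {..<n} \<rightarrow> carrier R \<and> monic_value (plus_ring R) n (\<lambda>i. plus_map R (c i)) x = \<zero>\<^bsub>plus_ring R\<^esub>"
proof -
  obtain n c where c: "c \<in> {..<n} \<rightarrow> carrier R"
    "monic_value (frac_closure R) n (\<lambda>i. plus_map R (c i)) x = \<zero>\<^bsub>frac_closure R\<^esub>"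
    using assms unfolding plus_ring_carrier
      integral_element_iff[OF is_cring fieldE(1)[OF frac_closure_field] plus_map_hom] by blast
  moreover have "(\<lambda>i. plus_map R (c i)) \<in> {..<n} \<rightarrow> carrier (plus_ring R)"
    using c(1) ring_hom_closed[OF plus_map_hom_plus_ring] by auto
  ultimately have "monic_value (plus_ring R) n (\<lambda>i. plus_map R (c i)) x = \<zero>\<^bsub>plus_ring R\<^esub>"
    using plus_ring_monic_value[OF _ assms] by simp
  then show ?thesis using c(1) by blast
qed

end

section \<open>Direct products of rings\<close>

lemma product_ring_simps:
  "carrier (product_ring I A) = (\<Pi>\<^sub>E i\<in>I. carrier (A i))"
  "x \<otimes>\<^bsub>product_ring I A\<^esub> y = (\<lambda>i\<in>I. x i \<otimes>\<^bsub>A i\<^esub> y i)"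
  "x \<oplus>\<^bsub>product_ring I A\<^esub> y = (\<lambda>i\<in>I. x i \<oplus>\<^bsub>A i\<^esub> y i)"
  "\<one>\<^bsub>product_ring I A\<^esub> = (\<lambda>i\<in>I. \<one>\<^bsub>A i\<^esub>)"
  "\<zero>\<^bsub>product_ring I A\<^esub> = (\<lambda>i\<in>I. \<zero>\<^bsub>A i\<^esub>)"
  by (simp_all add: product_ring_def)

lemma product_ring_eqI:
  "x \<in> carrier (product_ring I A) \<Longrightarrow> y \<in> carrier (product_ring I A) \<Longrightarrow> (\<And>i. i \<in> I \<Longrightarrow> x i = y i) \<Longrightarrow> x = y"
  unfolding product_ring_simps by (rule PiE_ext)

lemma cring_product_ring:
  assumes "\<And>i. i \<in> I \<Longrightarrow> cring (A i)"
  shows "cring (product_ring I A)"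
proof -
  let ?P = "product_ring I A"
  note s = product_ring_simps
  have m: "x i \<in> carrier (A i)" if "x \<in> carrier ?P" "i \<in> I" for x i
    using that by (auto simp: s)
  have ra: "ring (A i)" "abelian_monoid (A i)" "monoid (A i)" "cring (A i)" if "i \<in> I" for i
    using assms[OF that] by (simp_all add: cring_def ring_def abelian_group_def)
  have cl: "x \<oplus>\<^bsub>?P\<^esub> y \<in> carrier ?P" "x \<otimes>\<^bsub>?P\<^esub> y \<in> carrier ?P" if "x \<in> carrier ?P" "y \<in> carrier ?P" for x y
    using m[OF that(1)] m[OF that(2)] assms by (auto simp: s intro!: ring.ring_simprules(1,5) ra)
  have cl01: "\<zero>\<^bsub>?P\<^esub> \<in> carrier ?P" "\<one>\<^bsub>?P\<^esub> \<in> carrier ?P"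
    by (auto simp: s intro!: ring.ring_simprules(2,6) ra)
  show ?thesis
  proof (rule cringI)
    show "abelian_group ?P"
    proof (rule abelian_groupI)
      fix x assume x: "x \<in> carrier ?P"
      show "\<zero>\<^bsub>?P\<^esub> \<oplus>\<^bsub>?P\<^esub> x = x"
        by (rule product_ring_eqI[OF cl(1)[OF cl01(1) x] x])
          (use m[OF x] in \<open>auto simp: s intro!: ring.ring_simprules(8) ra\<close>)
      let ?y = "\<lambda>i\<in>I. \<ominus>\<^bsub>A i\<^esub> x i"
      have y: "?y \<in> carrier ?P" using m[OF x] by (auto simp: s intro!: ring.ring_simprules(3) ra)
      have "?y \<oplus>\<^bsub>?P\<^esub> x = \<zero>\<^bsub>?P\<^esub>"
        by (rule product_ring_eqI[OF cl(1)[OF y x] cl01(1)])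
          (use m[OF x] in \<open>auto simp: s intro!: ring.ring_simprules(9) ra\<close>)
      then show "\<exists>y \<in> carrier ?P. y \<oplus>\<^bsub>?P\<^esub> x = \<zero>\<^bsub>?P\<^esub>" using y by blast
      fix y assume y: "y \<in> carrier ?P"
      show "x \<oplus>\<^bsub>?P\<^esub> y \<in> carrier ?P" by (rule cl(1)[OF x y])
      show "x \<oplus>\<^bsub>?P\<^esub> y = y \<oplus>\<^bsub>?P\<^esub> x"
        by (rule product_ring_eqI[OF cl(1)[OF x y] cl(1)[OF y x]])
          (use m[OF x] m[OF y] in \<open>auto simp: s intro!: ring.ring_simprules(10) ra\<close>)
      fix z assume z: "z \<in> carrier ?P"
      show "x \<oplus>\<^bsub>?P\<^esub> y \<oplus>\<^bsub>?P\<^esub> z = x \<oplus>\<^bsub>?P\<^esub> (y \<oplus>\<^bsub>?P\<^esub> z)"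
        by (rule product_ring_eqI[OF cl(1)[OF cl(1)[OF x y] z] cl(1)[OF x cl(1)[OF y z]]])
          (use m[OF x] m[OF y] m[OF z] in \<open>auto simp: s intro!: ring.ring_simprules(7) ra\<close>)
    qed (rule cl01)
    show "comm_monoid ?P"
    proof (rule comm_monoidI)
      fix x assume x: "x \<in> carrier ?P"
      show "\<one>\<^bsub>?P\<^esub> \<otimes>\<^bsub>?P\<^esub> x = x"
        by (rule product_ring_eqI[OF cl(2)[OF cl01(2) x] x])
          (use m[OF x] in \<open>auto simp: s intro!: ring.ring_simprules(12) ra\<close>)
      fix y assume y: "y \<in> carrier ?P"
      show "x \<otimes>\<^bsub>?P\<^esub> y \<in> carrier ?P" by (rule cl(2)[OF x y])
      show "x \<otimes>\<^bsub>?P\<^esub> y = y \<otimes>\<^bsub>?P\<^esub> x"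
        by (rule product_ring_eqI[OF cl(2)[OF x y] cl(2)[OF y x]])
          (use m[OF x] m[OF y] in \<open>auto simp: s intro!: cring.cring_simprules(14) ra\<close>)
      fix z assume z: "z \<in> carrier ?P"
      show "x \<otimes>\<^bsub>?P\<^esub> y \<otimes>\<^bsub>?P\<^esub> z = x \<otimes>\<^bsub>?P\<^esub> (y \<otimes>\<^bsub>?P\<^esub> z)"
        by (rule product_ring_eqI[OF cl(2)[OF cl(2)[OF x y] z] cl(2)[OF x cl(2)[OF y z]]])
          (use m[OF x] m[OF y] m[OF z] in \<open>auto simp: s intro!: ring.ring_simprules(11) ra\<close>)
    qed (rule cl01)
    fix x y z assume x: "x \<in> carrier ?P" and y: "y \<in> carrier ?P" and z: "z \<in> carrier ?P"
    show "(x \<oplus>\<^bsub>?P\<^esub> y) \<otimes>\<^bsub>?P\<^esub> z = x \<otimes>\<^bsub>?P\<^esub> z \<oplus>\<^bsub>?P\<^esub> y \<otimes>\<^bsub>?P\<^esub> z"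
      by (rule product_ring_eqI[OF cl(2)[OF cl(1)[OF x y] z] cl(1)[OF cl(2)[OF x z] cl(2)[OF y z]]])
        (use m[OF x] m[OF y] m[OF z] in \<open>auto simp: s intro!: cring.cring_simprules(13) ra\<close>)
  qed
qed

lemma product_ring_proj: "i \<in> I \<Longrightarrow> (\<lambda>x. x i) \<in> ring_hom (product_ring I A) (A i)"
  by (auto simp: ring_hom_def product_ring_simps)

lemma product_ring_homI:
  assumes "\<And>i. i \<in> I \<Longrightarrow> f i \<in> ring_hom R (A i)"
  shows "(\<lambda>r. \<lambda>i\<in>I. f i r) \<in> ring_hom R (product_ring I A)"
  by (rule ring_hom_memI)
    (auto simp: product_ring_simps restrict_def ring_hom_closed[OF assms] ring_hom_mult[OF assms]
      ring_hom_add[OF assms] ring_hom_one[OF assms])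

text \<open>Roots, unlike factorizations, can be chosen independently in each coordinate; this is
  why \<open>ai_closedI\<close> asks for roots.\<close>

lemma ai_closed_product_ring:
  assumes cr: "\<And>i. i \<in> I \<Longrightarrow> cring (A i)"
    and roots: "\<And>i n c. i \<in> I \<Longrightarrow> 0 < n \<Longrightarrow> c \<in> {..<n} \<rightarrow> carrier (A i) \<Longrightarrow>
      \<exists>a \<in> carrier (A i). monic_value (A i) n c a = \<zero>\<^bsub>A i\<^esub>"
  shows "ai_closed (product_ring I A)"
proof (rule ai_closedI)
  let ?P = "product_ring I A"
  show P: "cring ?P" by (rule cring_product_ring[OF cr])
  interpret P: cring ?P by fact
  fix n c assume n: "0 < n" and c: "c \<in> {..<n::nat} \<rightarrow> carrier ?P"
  have "\<exists>a. a \<in> carrier (A i) \<and> monic_value (A i) n (\<lambda>k. c k i) a = \<zero>\<^bsub>A i\<^esub>" if i: "i \<in> I" for i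
    using roots[OF i n, of "\<lambda>k. c k i"] c i by (auto simp: product_ring_simps Pi_def PiE_def)
  then obtain a where a: "\<And>i. i \<in> I \<Longrightarrow> a i \<in> carrier (A i)"
    "\<And>i. i \<in> I \<Longrightarrow> monic_value (A i) n (\<lambda>k. c k i) (a i) = \<zero>\<^bsub>A i\<^esub>" by metis
  let ?a = "\<lambda>i\<in>I. a i"
  have aP: "?a \<in> carrier ?P" using a by (auto simp: product_ring_simps)
  have "monic_value ?P n c ?a = \<zero>\<^bsub>?P\<^esub>"
  proof (rule product_ring_eqI[OF P.monic_value_closed[OF c aP] P.zero_closed])
    fix i assume i: "i \<in> I"
    show "monic_value ?P n c ?a i = \<zero>\<^bsub>?P\<^esub> i"
      using ring_hom_monic_value[OF P cr[OF i] product_ring_proj[OF i] c aP] a i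
      by (simp add: product_ring_simps)
  qed
  then show "\<exists>a \<in> carrier ?P. monic_value ?P n c a = \<zero>\<^bsub>?P\<^esub>" using aP by blast
qed

text \<open>In the convolution at the sum of the two degrees only the product of the leading
  coefficients survives.\<close>

lemma (in UP_cring) monic_poly_mult:
  assumes "monic_poly R f" "monic_poly R g"
  shows "monic_poly R (f \<otimes>\<^bsub>P\<^esub> g)"
proof -
  have f: "f \<in> carrier P" "up_ring.coeff P f (deg R f) = \<one>"
    and g: "g \<in> carrier P" "up_ring.coeff P g (deg R g) = \<one>"
    using assms by (auto simp: monic_poly_def P_def)
  let ?d = "deg R f" and ?e = "deg R g"
  have fg: "f \<otimes>\<^bsub>P\<^esub> g \<in> carrier P" using f g by simp
  have "up_ring.coeff P (f \<otimes>\<^bsub>P\<^esub> g) (?d + ?e)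
    = (\<Oplus>i \<in> {..?d + ?e}. up_ring.coeff P f i \<otimes> up_ring.coeff P g (?d + ?e - i))"
    using f g by simp
  also have "\<dots> = (\<Oplus>i \<in> {..?d + ?e}. if ?d = i then \<one> else \<zero>)"
  proof (rule R.finsum_cong')
    fix i assume "i \<in> {..?d + ?e}"
    show "up_ring.coeff P f i \<otimes> up_ring.coeff P g (?d + ?e - i) = (if ?d = i then \<one> else \<zero>)"
    proof (cases "i < ?d")
      case True
      then have "up_ring.coeff P g (?d + ?e - i) = \<zero>" using g by (intro deg_aboveD) auto
      then show ?thesis using True f by simp
    next
      case False
      then show ?thesis using f g deg_aboveD[OF _ f(1), of i] by auto
    qed
  qed auto
  also have "\<dots> = \<one>" by (rule R.finsum_singleton[of ?d "{..?d + ?e}" "\<lambda>_. \<one>"]) auto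
  finally have co: "up_ring.coeff P (f \<otimes>\<^bsub>P\<^esub> g) (?d + ?e) = \<one>" .
  show ?thesis
  proof (cases "\<one> = \<zero>")
    case True
    have "up_ring.coeff P (f \<otimes>\<^bsub>P\<^esub> g) (deg R (f \<otimes>\<^bsub>P\<^esub> g)) = \<one>"
      using R.one_zeroD[OF True] coeff_closed[OF fg, of "deg R (f \<otimes>\<^bsub>P\<^esub> g)"] True by simp
    then show ?thesis using fg by (simp add: monic_poly_def P_def)
  next
    case False
    have "deg R (f \<otimes>\<^bsub>P\<^esub> g) = ?d + ?e"
      using deg_mult_ring[OF f(1) g(1)] deg_belowI[OF _ fg, of "?d + ?e"] co False by (simp add: le_antisym)
    then show ?thesis using co fg by (simp add: monic_poly_def P_def)
  qed
qed

lemma ring_hom_eval_monic: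
  assumes "cring R" "cring S" "cring T" "\<phi> \<in> ring_hom R S" "h \<in> ring_hom S T" "s \<in> carrier S" "monic_poly R f"
  shows "h (UnivPoly.eval R S \<phi> s f) = UnivPoly.eval R T (\<lambda>r. h (\<phi> r)) (h s) f"
proof -
  interpret UP_cring R "UP R" by (simp_all add: UP_cring_def assms)
  have f: "f \<in> carrier (UP R)" using assms(7) by (simp add: monic_poly_def)
  have *: "(\<lambda>r. h (\<phi> r)) \<in> ring_hom R T" using ring_hom_trans[OF assms(4,5)] by (simp add: comp_def)
  have "(\<lambda>i. \<phi> (up_ring.coeff (UP R) f i)) \<in> {..<deg R f} \<rightarrow> carrier S"
    using f ring_hom_closed[OF assms(4)] by simp
  from ring_hom_monic_value[OF assms(2,3,5) this assms(6)] show ?thesis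
    unfolding monic_poly_eval[OF assms(2,4,6,7)]
      monic_poly_eval[OF assms(3) * ring_hom_closed[OF assms(5,6)] assms(7)] .
qed

text \<open>The product of one monic polynomial for each coordinate annihilates all coordinates at
  once; here the index set has to be finite.\<close>

lemma integral_product_ring:
  assumes fin: "finite I" and cr: "\<And>i. i \<in> I \<Longrightarrow> cring (A i)" and R: "cring R"
    and hom: "\<And>i. i \<in> I \<Longrightarrow> f i \<in> ring_hom R (A i)"
    and int: "\<And>i. i \<in> I \<Longrightarrow> integral_extension R (A i) (f i)"
  shows "integral_extension R (product_ring I A) (\<lambda>r. \<lambda>i\<in>I. f i r)"
  unfolding integral_extension_def
proof
  let ?P = "product_ring I A" and ?f = "\<lambda>r. \<lambda>i\<in>I. f i r"
  have P: "cring ?P" by (rule cring_product_ring[OF cr])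
  have hP: "?f \<in> ring_hom R ?P" by (rule product_ring_homI[OF hom])
  interpret Q: cring ?P by fact
  interpret UP_cring R "UP R" by (simp_all add: UP_cring_def R)
  fix x assume x: "x \<in> carrier ?P"
  have xi: "x i \<in> carrier (A i)" if "i \<in> I" for i using x that by (auto simp: product_ring_simps)
  have "\<exists>g. monic_poly R g \<and> (\<forall>i \<in> J. UnivPoly.eval R (A i) (f i) (x i) g = \<zero>\<^bsub>A i\<^esub>)"
    if "finite J" "J \<subseteq> I" for J using that
  proof (induction J rule: finite_induct)
    case empty
    have "monic_poly R \<one>\<^bsub>UP R\<^esub>" by (simp add: monic_poly_def)
    then show ?case by auto
  next
    case (insert j J)
    then obtain g where g: "monic_poly R g" "\<forall>i \<in> J. UnivPoly.eval R (A i) (f i) (x i) g = \<zero>\<^bsub>A i\<^esub>" by auto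
    obtain k where k: "monic_poly R k" "UnivPoly.eval R (A j) (f j) (x j) k = \<zero>\<^bsub>A j\<^esub>"
      using int[of j] xi[of j] insert.prems by (auto simp: integral_extension_def integral_element_def)
    have c: "g \<in> carrier (UP R)" "k \<in> carrier (UP R)" using g k by (auto simp: monic_poly_def)
    have "UnivPoly.eval R (A i) (f i) (x i) (g \<otimes>\<^bsub>UP R\<^esub> k) = \<zero>\<^bsub>A i\<^esub>" if i: "i \<in> insert j J" for i
    proof -
      have iI: "i \<in> I" using i insert.prems by blast
      interpret Ai: cring "A i" by (rule cr[OF iI])
      let ?e = "UnivPoly.eval R (A i) (f i) (x i)"
      have e: "?e \<in> ring_hom (UP R) (A i)"
        by (rule UP_pre_univ_prop.eval_ring_hom[OF UP_pre_univ_propI[OF R cr[OF iI] hom[OF iI]] xi[OF iI]])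
      then have "?e (g \<otimes>\<^bsub>UP R\<^esub> k) = ?e g \<otimes>\<^bsub>A i\<^esub> ?e k" by (rule ring_hom_memE(2)[OF _ c])
      moreover have "?e g = \<zero>\<^bsub>A i\<^esub> \<or> ?e k = \<zero>\<^bsub>A i\<^esub>" using i g k by auto
      ultimately show ?thesis using ring_hom_closed[OF e] c by auto
    qed
    then show ?case using monic_poly_mult[OF g(1) k(1)] by blast
  qed
  from this[OF fin] obtain g where g: "monic_poly R g"
    "\<forall>i \<in> I. UnivPoly.eval R (A i) (f i) (x i) g = \<zero>\<^bsub>A i\<^esub>" by blast
  have e: "UnivPoly.eval R ?P ?f x \<in> ring_hom (UP R) ?P"
    by (rule UP_pre_univ_prop.eval_ring_hom[OF UP_pre_univ_propI[OF R P hP] x])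
  have "UnivPoly.eval R ?P ?f x g = \<zero>\<^bsub>?P\<^esub>"
  proof (rule product_ring_eqI[OF ring_hom_closed[OF e] Q.zero_closed])
    show "g \<in> carrier (UP R)" using g(1) by (simp add: monic_poly_def)
    fix i assume i: "i \<in> I"
    show "UnivPoly.eval R ?P ?f x g i = \<zero>\<^bsub>?P\<^esub> i"
      using ring_hom_eval_monic[OF R P cr[OF i] hP product_ring_proj[OF i] x g(1)] g(2) i
      by (simp add: product_ring_simps)
  qed
  then show "integral_element R ?P ?f x" using x g(1) by (auto simp: integral_element_def)
qed

section \<open>Idempotents and connected components of the spectrum\<close>

text \<open>Choose an element outside I in each q and multiply: the product is in every q, and
  outside I because I is prime.\<close>

lemma (in primeideal) exists_in_ideals_avoiding:
  assumes "finite Q" "\<And>q. q \<in> Q \<Longrightarrow> ideal q R \<and> \<not> q \<subseteq> I"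
  shows "\<exists>s \<in> carrier R. s \<notin> I \<and> (\<forall>q \<in> Q. s \<in> q)"
  using assms
proof (induction Q rule: finite_induct)
  case empty
  then show ?case using notin_submonoid(1) one_closed by blast
next
  case (insert q Q)
  then obtain s where s: "s \<in> carrier R" "s \<notin> I" "\<forall>q \<in> Q. s \<in> q" by auto
  have q: "ideal q R" "\<not> q \<subseteq> I" using insert.prems by auto
  then obtain a where a: "a \<in> q" "a \<notin> I" by blast
  have aR: "a \<in> carrier R" using ideal.Icarr[OF q(1) a(1)] .
  have "a \<otimes> s \<in> carrier R - I" using notin_submonoid(2)[of a s] a(2) s aR by blast
  moreover have "a \<otimes> s \<in> q" using ideal.I_r_closed[OF q(1) a(1) s(1)] .
  moreover have "a \<otimes> s \<in> q'" if "q' \<in> Q" for q'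
    using ideal.I_l_closed[of q' R s a] insert.prems s that aR by blast
  ultimately show ?case by (intro bexI[of _ "a \<otimes> s"]) auto
qed

lemma openin_Spec_basic: "f \<in> carrier S \<Longrightarrow> openin (Spec S) {p. primeideal p S \<and> f \<notin> p}"
  unfolding Spec_def by (rule topology_generated_by_Basis) blast

text \<open>An f that avoids P avoids every smaller prime, and this property of the basic open sets
  passes to unions and intersections.\<close>

lemma openin_Spec_generization:
  assumes "openin (Spec S) E" "P \<in> E" "q \<subseteq> P" "primeideal q S"
  shows "q \<in> E"
proof -
  have "generate_topology_on {{p. primeideal p S \<and> f \<notin> p} | f. f \<in> carrier S} E"
    using assms(1) by (simp add: Spec_def openin_topology_generated_by_iff)
  then show ?thesis using assms(2)
  proof (induction rule: generate_topology_on.induct)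
    case (Basis s)
    then show ?case using assms(3,4) by auto
  qed auto
qed

text \<open>Every open set that meets {q, P} contains q, so two disjoint ones cannot separate the
  pair.\<close>

lemma connected_component_of_Spec_subset:
  assumes "cring S" "primeideal q S" "primeideal P S" "q \<subseteq> P"
  shows "connected_component_of (Spec S) q P"
proof -
  have q: "q \<in> E" if "openin (Spec S) E" "E \<inter> {q, P} \<noteq> {}" for E
    using openin_Spec_generization[OF that(1) _ assms(4,2)] that(2) by auto
  have "connectedin (Spec S) {q, P}"
    unfolding connectedin
  proof (intro conjI notI)
    show "{q, P} \<subseteq> topspace (Spec S)" using assms by (simp add: topspace_Spec)
    assume "\<exists>E1 E2. openin (Spec S) E1 \<and> openin (Spec S) E2 \<and> {q, P} \<subseteq> E1 \<union> E2 \<and>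
      E1 \<inter> E2 \<inter> {q, P} = {} \<and> E1 \<inter> {q, P} \<noteq> {} \<and> E2 \<inter> {q, P} \<noteq> {}"
    then show False using q by blast
  qed
  then show ?thesis unfolding connected_component_of_def by blast
qed

text \<open>Every prime contains some q in Q: otherwise an element of all the q would lie outside
  it, but that element is zero. So every component is that of some q. An idempotent is determined by
  the primes in Q that contain it, and a set of components arises by splitting 1 along the induced
  partition of Q.\<close>

lemma card_idempotents_eq_power_components:
  assumes S: "cring S" and fin: "finite Q" and prime: "\<And>q. q \<in> Q \<Longrightarrow> primeideal q S"
    and inter: "\<And>x. x \<in> carrier S \<Longrightarrow> (\<And>q. q \<in> Q \<Longrightarrow> x \<in> q) \<Longrightarrow> x = \<zero>\<^bsub>S\<^esub>"
  shows "finite (connected_components_of (Spec S))"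
    and "card (idempotents S) = 2 ^ card (connected_components_of (Spec S))"
proof -
  interpret cring S by fact
  define comp where "comp p = connected_component_of_set (Spec S) p" for p
  let ?C = "connected_components_of (Spec S)"
  note top = topspace_Spec[OF S]
  have ideal: "ideal q S" if "q \<in> Q" for q using prime[OF that] by (rule primeideal.axioms)
  have comp_eq: "comp q = comp P" if "primeideal q S" "primeideal P S" "q \<subseteq> P" for q P
    using connected_component_of_Spec_subset[OF S that] connected_component_of_equiv[of "Spec S" q P]
    by (simp add: comp_def)
  have contains: "\<exists>q \<in> Q. q \<subseteq> P" if P: "primeideal P S" for P
  proof (rule ccontr)
    assume "\<not> ?thesis"
    then have "\<And>q. q \<in> Q \<Longrightarrow> ideal q S \<and> \<not> q \<subseteq> P" using ideal by blast
    from primeideal.exists_in_ideals_avoiding[OF P fin this]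
    obtain s where s: "s \<in> carrier S" "s \<notin> P" "\<forall>q \<in> Q. s \<in> q" by blast
    then have "s = \<zero>\<^bsub>S\<^esub>" using inter by blast
    then show False using s(2) additive_subgroup.zero_closed[OF ideal.axioms(1)[OF primeideal.axioms(1)[OF P]]] by simp
  qed
  have C: "?C = comp ` Q"
  proof
    show "?C \<subseteq> comp ` Q"
    proof
      fix c assume "c \<in> ?C"
      then obtain P where P: "primeideal P S" "c = comp P"
        unfolding connected_components_of_def top comp_def by blast
      then obtain q where "q \<in> Q" "q \<subseteq> P" using contains by blast
      then show "c \<in> comp ` Q" using P comp_eq[OF prime P(1)] by blast
    qed
    show "comp ` Q \<subseteq> ?C"
      unfolding connected_components_of_def top comp_def using prime by blast
  qed
  show finC: "finite ?C" unfolding C using fin by simp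
  define U where "U f = {p. primeideal p S \<and> f \<notin> p}" for f
  \<comment> \<open>The complement of \<open>U e\<close> is the basic open set of 1 - e, so
    \<open>U e\<close> is clopen and contains or misses every component.\<close>
  have comp_U: "comp q \<subseteq> U e \<longleftrightarrow> e \<notin> q" if q: "q \<in> Q" and e: "e \<in> idempotents S" for q e
  proof -
    have eS: "e \<in> carrier S" "e \<otimes>\<^bsub>S\<^esub> e = e" using e by (auto simp: idempotents_def)
    have compl: "e \<in> p \<longleftrightarrow> \<one>\<^bsub>S\<^esub> \<ominus>\<^bsub>S\<^esub> e \<notin> p" if p: "primeideal p S" for p
    proof -
      interpret p: primeideal p S by fact
      have "e \<otimes>\<^bsub>S\<^esub> (\<one>\<^bsub>S\<^esub> \<ominus>\<^bsub>S\<^esub> e) = \<zero>\<^bsub>S\<^esub>"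
        using eS by (simp add: minus_eq r_distr r_minus r_neg)
      then have "e \<in> p \<or> \<one>\<^bsub>S\<^esub> \<ominus>\<^bsub>S\<^esub> e \<in> p" using p.I_prime[of e "\<one>\<^bsub>S\<^esub> \<ominus>\<^bsub>S\<^esub> e"] eS by simp
      moreover have "\<one>\<^bsub>S\<^esub> \<in> p" if "e \<in> p" "\<one>\<^bsub>S\<^esub> \<ominus>\<^bsub>S\<^esub> e \<in> p"
      proof -
        have "e \<oplus>\<^bsub>S\<^esub> (\<one>\<^bsub>S\<^esub> \<ominus>\<^bsub>S\<^esub> e) = \<one>\<^bsub>S\<^esub>" using eS by algebra
        then show ?thesis using p.a_closed[OF that] by simp
      qed
      ultimately show ?thesis using p.notin_submonoid(1) by blast
    qed
    have "openin (Spec S) (U e)" unfolding U_def by (rule openin_Spec_basic[OF eS(1)])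
    moreover have "topspace (Spec S) - U e = U (\<one>\<^bsub>S\<^esub> \<ominus>\<^bsub>S\<^esub> e)"
      unfolding top U_def using compl by blast
    then have "closedin (Spec S) (U e)"
      using openin_Spec_basic[of "\<one>\<^bsub>S\<^esub> \<ominus>\<^bsub>S\<^esub> e" S] eS(1)
      unfolding closedin_def by (auto simp: U_def top)
    ultimately have "comp q \<subseteq> U e \<or> disjnt (comp q) (U e)"
      using connectedin_clopen_cases[OF connectedin_connected_component_of[of "Spec S" q]]
      unfolding comp_def by blast
    moreover have "q \<in> comp q"
      unfolding comp_def using prime[OF q] top by (simp add: connected_component_of_refl)
    moreover have "q \<in> U e \<longleftrightarrow> e \<notin> q" using prime[OF q] by (simp add: U_def)
    ultimately show ?thesis by (auto simp: disjnt_iff)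
  qed
  define F where "F e = {c \<in> ?C. c \<subseteq> U e}" for e
  have F: "F e = {comp q | q. q \<in> Q \<and> e \<notin> q}" if "e \<in> idempotents S" for e
    unfolding F_def C using comp_U[OF _ that] by blast
  have "bij_betw F (idempotents S) (Pow ?C)"
  proof (rule bij_betw_imageI)
    show "inj_on F (idempotents S)"
    proof (rule inj_onI)
      fix e f assume e: "e \<in> idempotents S" and f: "f \<in> idempotents S" and eq: "F e = F f"
      have c: "e \<in> carrier S" "f \<in> carrier S" using e f by (auto simp: idempotents_def)
      \<comment> \<open>The idempotents e and f lie in the same primes of Q, and a prime without
        them contains 1 - e and 1 - f.\<close>
      have "e \<ominus>\<^bsub>S\<^esub> f \<in> q" if q: "q \<in> Q" for q
      proof -
        interpret q: primeideal q S by (rule prime[OF q])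
        have iff: "e \<in> q \<longleftrightarrow> f \<in> q"
          using eq comp_U[OF q e] comp_U[OF q f] q unfolding F_def C by blast
        have idem: "\<one>\<^bsub>S\<^esub> \<ominus>\<^bsub>S\<^esub> g \<in> q" if g: "g \<in> idempotents S" "g \<notin> q" for g
        proof -
          have gS: "g \<in> carrier S" "g \<otimes>\<^bsub>S\<^esub> g = g" using g by (auto simp: idempotents_def)
          have "g \<otimes>\<^bsub>S\<^esub> (\<one>\<^bsub>S\<^esub> \<ominus>\<^bsub>S\<^esub> g) = \<zero>\<^bsub>S\<^esub>" using gS by (simp add: minus_eq r_distr r_minus r_neg)
          then show ?thesis using q.I_prime[of g "\<one>\<^bsub>S\<^esub> \<ominus>\<^bsub>S\<^esub> g"] gS g(2) by simp
        qed
        show ?thesis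
        proof (cases "e \<in> q")
          case True
          then show ?thesis using iff unfolding minus_eq by (intro q.a_closed q.a_inv_closed) auto
        next
          case False
          then have "(\<one>\<^bsub>S\<^esub> \<ominus>\<^bsub>S\<^esub> f) \<oplus>\<^bsub>S\<^esub> \<ominus>\<^bsub>S\<^esub> (\<one>\<^bsub>S\<^esub> \<ominus>\<^bsub>S\<^esub> e) \<in> q"
            using iff idem e f by (intro q.a_closed q.a_inv_closed) auto
          moreover have "(\<one>\<^bsub>S\<^esub> \<ominus>\<^bsub>S\<^esub> f) \<oplus>\<^bsub>S\<^esub> \<ominus>\<^bsub>S\<^esub> (\<one>\<^bsub>S\<^esub> \<ominus>\<^bsub>S\<^esub> e) = e \<ominus>\<^bsub>S\<^esub> f" using c by algebra
          ultimately show ?thesis by simp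
        qed
      qed
      then have "e \<ominus>\<^bsub>S\<^esub> f = \<zero>\<^bsub>S\<^esub>" using inter c by simp
      then show "e = f" using c by simp
    qed
    show "F ` idempotents S = Pow ?C"
    proof
      show "F ` idempotents S \<subseteq> Pow ?C" by (auto simp: F_def)
      show "Pow ?C \<subseteq> F ` idempotents S"
      proof
        fix G assume "G \<in> Pow ?C"
        then have G: "G \<subseteq> comp ` Q" using C by simp
        define B where "B = {q \<in> Q. comp q \<in> G}"
        \<comment> \<open>The intersection of the primes in Q', taken inside the carrier, so that
          \<open>Z {}\<close> is all of S; this covers an empty B and an empty Q - B.\<close>
        define Z where "Z Q' = {x \<in> carrier S. \<forall>q \<in> Q'. x \<in> q}" for Q'
        have Zi: "ideal (Z Q') S" if "Q' \<subseteq> Q" for Q'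
        proof (rule idealI_cring)
          have i: "ideal q S" if "q \<in> Q'" for q using ideal that \<open>Q' \<subseteq> Q\<close> by blast
          note sub = additive_subgroup.zero_closed[OF ideal.axioms(1)[OF i]]
            additive_subgroup.a_closed[OF ideal.axioms(1)[OF i]] ideal.I_l_closed[OF i]
          show "Z Q' \<subseteq> carrier S" by (auto simp: Z_def)
          show "\<zero>\<^bsub>S\<^esub> \<in> Z Q'" using sub(1) by (auto simp: Z_def)
          show "a \<oplus>\<^bsub>S\<^esub> b \<in> Z Q'" if "a \<in> Z Q'" "b \<in> Z Q'" for a b
            using that sub(2) by (auto simp: Z_def)
          show "x \<otimes>\<^bsub>S\<^esub> a \<in> Z Q'" if "a \<in> Z Q'" "x \<in> carrier S" for a x
            using that sub(3) by (auto simp: Z_def)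
        qed
        have contZ: "\<exists>q \<in> Q'. q \<subseteq> P" if P: "primeideal P S" "Z Q' \<subseteq> P" and Q': "Q' \<subseteq> Q" for P Q'
        proof (rule ccontr)
          assume "\<not> ?thesis"
          then have "\<And>q. q \<in> Q' \<Longrightarrow> ideal q S \<and> \<not> q \<subseteq> P" using ideal Q' by blast
          from primeideal.exists_in_ideals_avoiding[OF P(1) finite_subset[OF Q' fin] this]
          obtain s where "s \<in> carrier S" "s \<notin> P" "\<forall>q \<in> Q'. s \<in> q" by blast
          then show False using P(2) by (auto simp: Z_def)
        qed
        let ?I = "Z B" and ?J = "Z (Q - B)"
        have sub: "B \<subseteq> Q" "Q - B \<subseteq> Q" by (auto simp: B_def)
        note iI = Zi[OF sub(1)] and iJ = Zi[OF sub(2)]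
        have zI: "\<zero>\<^bsub>S\<^esub> \<in> ?I" "\<zero>\<^bsub>S\<^esub> \<in> ?J"
          using additive_subgroup.zero_closed[OF ideal.axioms(1)] iI iJ by blast+
        have IJ: "ideal (?I <+>\<^bsub>S\<^esub> ?J) S" by (rule add_ideals[OF iI iJ])
        have "\<one>\<^bsub>S\<^esub> \<in> ?I <+>\<^bsub>S\<^esub> ?J"
        proof (rule ccontr)
          \<comment> \<open>A prime above both ideals would contain a prime of B and one of Q - B,
            which would then share a component; but B is a union of classes of primes with equal
            component.\<close>
          assume n: "\<one>\<^bsub>S\<^esub> \<notin> ?I <+>\<^bsub>S\<^esub> ?J"
          have "\<exists>P. primeideal P S \<and> ?I <+>\<^bsub>S\<^esub> ?J \<subseteq> P \<and> P \<inter> {\<one>\<^bsub>S\<^esub>} = {}"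
            by (rule exists_prime_disjoint[OF IJ]) (use n in auto)
          then obtain P where P: "primeideal P S" "?I <+>\<^bsub>S\<^esub> ?J \<subseteq> P" by blast
          have "x \<in> ?I <+>\<^bsub>S\<^esub> ?J" if "x \<in> ?I" for x
          proof -
            have "x \<oplus>\<^bsub>S\<^esub> \<zero>\<^bsub>S\<^esub> \<in> ?I <+>\<^bsub>S\<^esub> ?J" unfolding set_add_def' using that zI by blast
            then show ?thesis using that by (simp add: Z_def)
          qed
          moreover have "x \<in> ?I <+>\<^bsub>S\<^esub> ?J" if "x \<in> ?J" for x
          proof -
            have "\<zero>\<^bsub>S\<^esub> \<oplus>\<^bsub>S\<^esub> x \<in> ?I <+>\<^bsub>S\<^esub> ?J" unfolding set_add_def' using that zI by blast
            then show ?thesis using that by (simp add: Z_def)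
          qed
          ultimately have "?I \<subseteq> P" "?J \<subseteq> P" using P(2) by blast+
          then obtain q q' where q: "q \<in> B" "q \<subseteq> P" "q' \<in> Q - B" "q' \<subseteq> P"
            using contZ[OF P(1)] sub by meson
          then have "comp q = comp q'"
            using comp_eq[OF prime P(1), of q] comp_eq[OF prime P(1), of q'] sub by auto
          then show False using q by (auto simp: B_def)
        qed
        then obtain i j where ij: "i \<in> ?I" "j \<in> ?J" "\<one>\<^bsub>S\<^esub> = i \<oplus>\<^bsub>S\<^esub> j"
          unfolding set_add_def' by blast
        have ijS: "i \<in> carrier S" "j \<in> carrier S" using ij by (auto simp: Z_def)
        \<comment> \<open>Each prime of Q contains i or j, so i j = 0, and with i + j = 1 this makes
          j idempotent.\<close>
        have "i \<otimes>\<^bsub>S\<^esub> j \<in> q" if "q \<in> Q" for q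
          using ij ijS that ideal.I_l_closed[OF ideal[OF that]] ideal.I_r_closed[OF ideal[OF that]]
          by (cases "q \<in> B") (auto simp: Z_def)
        then have "i \<otimes>\<^bsub>S\<^esub> j = \<zero>\<^bsub>S\<^esub>" using inter ijS by simp
        moreover have "\<one>\<^bsub>S\<^esub> \<otimes>\<^bsub>S\<^esub> j = i \<otimes>\<^bsub>S\<^esub> j \<oplus>\<^bsub>S\<^esub> j \<otimes>\<^bsub>S\<^esub> j"
          unfolding ij(3) using ijS by (simp add: l_distr)
        ultimately have "j \<otimes>\<^bsub>S\<^esub> j = j" using ijS by simp
        then have je: "j \<in> idempotents S" using ijS by (simp add: idempotents_def)
        have jq: "j \<notin> q \<longleftrightarrow> comp q \<in> G" if q: "q \<in> Q" for q
        proof (cases "q \<in> B")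
          case True
          interpret q: primeideal q S by (rule prime[OF q])
          have "i \<in> q" using True ij by (simp add: Z_def)
          then have "j \<notin> q" using q.a_closed[of i j] ij(3) q.notin_submonoid(1) by auto
          then show ?thesis using True by (simp add: B_def)
        next
          case False
          then have "j \<in> q" using ij q by (simp add: Z_def)
          then show ?thesis using False q by (simp add: B_def)
        qed
        have "F j = G" unfolding F[OF je] using jq G by blast
        then show "G \<in> F ` idempotents S" using je by blast
      qed
    qed
  qed
  then show "card (idempotents S) = 2 ^ card ?C"
    using bij_betw_same_card card_Pow[OF finC] by metis
qed

section \<open>The universal absolute integral closure\<close>

abbreviation residue_map :: "('a, 'm) ring_scheme \<Rightarrow> 'a set \<Rightarrow> 'a \<Rightarrow> 'a set frac_closure" where
  "residue_map R p r \<equiv> plus_map (R Quot p) (p +>\<^bsub>R\<^esub> r)"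

lemma (in "domain") finprod_eq_zeroD:
  assumes "finite I" "f \<in> I \<rightarrow> carrier R" "finprod R f I = \<zero>"
  shows "\<exists>i \<in> I. f i = \<zero>"
  using assms
proof (induction I rule: finite_induct)
  case (insert i I)
  have f: "f i \<in> carrier R" "f \<in> I \<rightarrow> carrier R" using insert.prems by auto
  have "f i \<otimes> finprod R f I = \<zero>"
    using insert f by simp
  then have "f i = \<zero> \<or> finprod R f I = \<zero>" using f by (intro integral) auto
  then show ?case using insert.IH f by auto
qed simp

lemma (in "domain") idempotent_iff:
  "e \<in> carrier R \<Longrightarrow> e \<otimes> e = e \<longleftrightarrow> e = \<zero> \<or> e = \<one>"
  using m_lcancel[of e e \<one>] by auto

lemma (in primeideal) residue_map_hom: "residue_map R I \<in> ring_hom R (plus_ring (R Quot I))"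
  using ring_hom_trans[OF rcos_ring_hom domain.plus_map_hom_plus_ring[OF quotient_is_domain]]
  by (simp add: comp_def)

lemma (in primeideal) residue_map_eq_zero_iff:
  assumes "r \<in> carrier R"
  shows "residue_map R I r = \<zero>\<^bsub>plus_ring (R Quot I)\<^esub> \<longleftrightarrow> r \<in> I"
proof -
  interpret Q: "domain" "R Quot I" by (rule quotient_is_domain)
  have "I +> r \<in> carrier (R Quot I)" using ring_hom_closed[OF rcos_ring_hom assms] .
  moreover have "I +> r = \<zero>\<^bsub>R Quot I\<^esub> \<longleftrightarrow> r \<in> I"
    using assms rcos_const_imp_mem a_rcos_const by (auto simp: FactRing_def)
  ultimately show ?thesis using Q.plus_map_eq_zero_iff by simp
qed

text \<open>The coefficients of an equation over R/I are lifted to R.\<close>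

lemma (in primeideal) plus_ring_Quot_integral:
  "integral_extension R (plus_ring (R Quot I)) (residue_map R I)"
  unfolding integral_extension_def
proof
  interpret Q: "domain" "R Quot I" by (rule quotient_is_domain)
  interpret A: "domain" "plus_ring (R Quot I)" by (rule Q.plus_ring_domain)
  fix x assume x: "x \<in> carrier (plus_ring (R Quot I))"
  obtain n c where c: "c \<in> {..<n} \<rightarrow> carrier (R Quot I)"
    "monic_value (plus_ring (R Quot I)) n (\<lambda>i. plus_map (R Quot I) (c i)) x = \<zero>\<^bsub>plus_ring (R Quot I)\<^esub>"
    using Q.plus_ring_integral[OF x] by blast
  have "\<exists>r \<in> carrier R. c i = I +> r" if "i < n" for i
    using c(1) that by (auto simp: FactRing_def A_RCOSETS_def' Pi_def)
  then obtain d where d: "\<And>i. i < n \<Longrightarrow> d i \<in> carrier R" "\<And>i. i < n \<Longrightarrow> c i = I +> d i"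
    by metis
  have "monic_value (plus_ring (R Quot I)) n (\<lambda>i. residue_map R I (d i)) x
    = monic_value (plus_ring (R Quot I)) n (\<lambda>i. plus_map (R Quot I) (c i)) x"
  proof (rule A.monic_value_cong)
    show "(\<lambda>i. plus_map (R Quot I) (c i)) \<in> {..<n} \<rightarrow> carrier (plus_ring (R Quot I))"
      using c(1) ring_hom_closed[OF Q.plus_map_hom_plus_ring] by auto
  qed (simp_all add: d(2) x)
  then show "integral_element R (plus_ring (R Quot I)) (residue_map R I) x"
    unfolding integral_element_iff[OF is_cring A.is_cring residue_map_hom] using c d x by auto
qed

lemma embedding_of_tight_extension:
  assumes S: "cring S" and T: "cring T" and tight: "tight_extension R S \<phi>"
    and h: "h \<in> ring_hom S T" and inj: "inj_on (\<lambda>r. h (\<phi> r)) (carrier R)"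
    and R: "cring R" "\<phi> \<in> ring_hom R S"
  shows "inj_on h (carrier S)"
proof -
  interpret S: cring S by fact
  interpret T: cring T by fact
  interpret R: cring R by fact
  have hr: "ring_hom_ring S T h" by (rule ring_hom_ringI2[OF S.ring_axioms T.ring_axioms h])
  interpret hr: ring_hom_ring S T h by (rule hr)
  let ?K = "a_kernel S T h"
  have "?K \<inter> \<phi> ` carrier R = {\<zero>\<^bsub>S\<^esub>}"
  proof
    have \<phi>0: "\<phi> \<zero>\<^bsub>R\<^esub> = \<zero>\<^bsub>S\<^esub>" by (rule ring_hom_zero[OF R(2) R.ring_axioms S.ring_axioms])
    have "\<zero>\<^bsub>S\<^esub> \<in> \<phi> ` carrier R" using imageI[OF R.zero_closed, of \<phi>] by (simp only: \<phi>0)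
    moreover have "\<zero>\<^bsub>S\<^esub> \<in> ?K"
      by (rule additive_subgroup.zero_closed[OF ideal.axioms(1)[OF hr.kernel_is_ideal]])
    ultimately show "{\<zero>\<^bsub>S\<^esub>} \<subseteq> ?K \<inter> \<phi> ` carrier R" by blast
    show "?K \<inter> \<phi> ` carrier R \<subseteq> {\<zero>\<^bsub>S\<^esub>}"
    proof
      fix x assume "x \<in> ?K \<inter> \<phi> ` carrier R"
      then obtain r where r: "r \<in> carrier R" "x = \<phi> r" "h (\<phi> r) = \<zero>\<^bsub>T\<^esub>"
        unfolding a_kernel_def' by blast
      then have "h (\<phi> r) = h (\<phi> \<zero>\<^bsub>R\<^esub>)" by (simp only: \<phi>0 hr.hom_zero)
      then have "r = \<zero>\<^bsub>R\<^esub>" using inj_onD[OF inj] r(1) by blast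
      then show "x \<in> {\<zero>\<^bsub>S\<^esub>}" by (simp only: r(2) \<phi>0 singleton_iff)
    qed
  qed
  then have "?K = {\<zero>\<^bsub>S\<^esub>}" using tight hr.kernel_is_ideal unfolding tight_extension_def by blast
  then show ?thesis by (rule hr.trivial_ker_imp_inj)
qed

lemma idempotents_hom:
  "h \<in> ring_hom S T \<Longrightarrow> e \<in> idempotents S \<Longrightarrow> h e \<in> idempotents T"
  by (auto simp: idempotents_def ring_hom_closed ring_hom_mult[symmetric])

lemma bij_betw_idempotents:
  assumes "h \<in> ring_iso S T" "cring S"
  shows "bij_betw h (idempotents S) (idempotents T)"
proof (rule bij_betw_imageI)
  interpret S: cring S by fact
  have h: "h \<in> ring_hom S T" "bij_betw h (carrier S) (carrier T)" using assms by (auto simp: ring_iso_def)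
  show "inj_on h (idempotents S)"
    using bij_betw_imp_inj_on[OF h(2)] by (rule inj_on_subset) (auto simp: idempotents_def)
  show "h ` idempotents S = idempotents T"
  proof
    show "h ` idempotents S \<subseteq> idempotents T" using idempotents_hom[OF h(1)] by blast
    show "idempotents T \<subseteq> h ` idempotents S"
    proof
      fix e assume e: "e \<in> idempotents T"
      then obtain s where s: "s \<in> carrier S" "e = h s"
        using bij_betw_imp_surj_on[OF h(2)] by (auto simp: idempotents_def)
      have "h (s \<otimes>\<^bsub>S\<^esub> s) = h s" using e s ring_hom_mult[OF h(1)] by (simp add: idempotents_def)
      then have "s \<otimes>\<^bsub>S\<^esub> s = s" using inj_onD[OF bij_betw_imp_inj_on[OF h(2)]] s by simp
      then show "e \<in> h ` idempotents S" using s by (auto simp: idempotents_def)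
    qed
  qed
qed

section \<open>The product T over the minimal primes\<close>

locale reduced_finite_min_primes =
  fixes R :: "('a, 'm) ring_scheme" (structure)
  assumes cring: "cring R" and reduced: "reduced_ring R" and fin: "finite (min_primes R)"
begin

sublocale cring R by (rule cring)

abbreviation "M \<equiv> min_primes R"
abbreviation "A p \<equiv> plus_ring (R Quot p)"
abbreviation "T \<equiv> plus_product R"
abbreviation "\<psi> \<equiv> plus_product_map R"

lemma prime: "p \<in> M \<Longrightarrow> primeideal p R"
  by (simp add: min_primes_def)

lemma min_prime_notin: "p \<in> M \<Longrightarrow> q \<in> M \<Longrightarrow> q \<noteq> p \<Longrightarrow> \<not> q \<subseteq> p"
  by (auto simp: min_primes_def)

lemma domain_A: "p \<in> M \<Longrightarrow> domain (A p)"
  by (intro domain.plus_ring_domain primeideal.quotient_is_domain prime)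

lemma cring_A: "p \<in> M \<Longrightarrow> cring (A p)"
  using domain_A by (rule domain.axioms)

lemma T_def: "T = product_ring M A"
  by (simp add: plus_product_def)

lemma \<psi>_def: "\<psi> r = (\<lambda>p\<in>M. residue_map R p r)"
  by (simp add: plus_product_map_def)

lemma cring_T: "cring T"
  unfolding T_def by (rule cring_product_ring[OF cring_A])

lemma T_eqI: "x \<in> carrier T \<Longrightarrow> y \<in> carrier T \<Longrightarrow> (\<And>p. p \<in> M \<Longrightarrow> x p = y p) \<Longrightarrow> x = y"
  unfolding T_def by (rule product_ring_eqI)

lemma proj: "p \<in> M \<Longrightarrow> (\<lambda>x. x p) \<in> ring_hom T (A p)"
  unfolding T_def by (rule product_ring_proj)

lemma \<psi>_hom: "\<psi> \<in> ring_hom R T"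
  unfolding T_def \<psi>_def[abs_def]
  by (rule product_ring_homI) (intro primeideal.residue_map_hom prime)

text \<open>In a reduced ring the minimal primes have zero intersection.\<close>

lemma \<psi>_inj: "inj_on \<psi> (carrier R)"
proof (rule ring_hom_ring.trivial_ker_imp_inj)
  interpret T: cring T by (rule cring_T)
  show "ring_hom_ring R T \<psi>" by (rule ring_hom_ringI2[OF ring_axioms T.ring_axioms \<psi>_hom])
  have "r = \<zero>" if r: "r \<in> carrier R" "\<psi> r = \<zero>\<^bsub>T\<^esub>" for r
  proof (rule ccontr)
    assume "r \<noteq> \<zero>"
    then obtain p where p: "p \<in> M" "r \<notin> p" using reduced_ring_min_prime_avoiding[OF reduced r(1)] by blast
    have "\<psi> r p = \<zero>\<^bsub>A p\<^esub>" using r(2) p(1) by (simp add: T_def product_ring_simps)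
    then show False
      using primeideal.residue_map_eq_zero_iff[OF prime[OF p(1)] r(1)] p by (simp add: \<psi>_def)
  qed
  then show "a_kernel R T \<psi> = {\<zero>}"
    using ring_hom_zero[OF \<psi>_hom ring_axioms T.ring_axioms] by (auto simp: a_kernel_def')
qed

lemma T_ai_closed: "ai_closed T"
  unfolding T_def
  by (rule ai_closed_product_ring[OF cring_A])
    (simp_all only: domain.plus_ring_roots[OF primeideal.quotient_is_domain[OF prime]])

lemma T_integral: "integral_extension R T \<psi>"
  unfolding T_def \<psi>_def[abs_def]
  by (rule integral_product_ring[OF fin cring_A cring primeideal.residue_map_hom[OF prime]
        primeideal.plus_ring_Quot_integral[OF prime]])

text \<open>Multiplication by the image of such an \<open>s\<close> erases all coordinates of T
  except the one at p. It exists because distinct minimal primes are incomparable.\<close>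

lemma exists_in_other_min_primes:
  assumes "p \<in> M"
  shows "\<exists>s \<in> carrier R. s \<notin> p \<and> (\<forall>q \<in> M - {p}. s \<in> q)"
proof (rule primeideal.exists_in_ideals_avoiding[OF prime[OF assms]])
  show "finite (M - {p})" using fin by simp
  show "ideal q R \<and> \<not> q \<subseteq> p" if "q \<in> M - {p}" for q
    using that min_prime_notin[OF assms] primeideal.axioms(1)[OF prime] by blast
qed

lemma T_tight: "tight_extension R T \<psi>"
  unfolding tight_extension_def
proof (intro allI impI, elim conjE)
  fix I assume I: "ideal I T" "I \<noteq> {\<zero>\<^bsub>T\<^esub>}"
  interpret T: cring T by (rule cring_T)
  interpret I: ideal I T by fact
  obtain t where t: "t \<in> I" "t \<noteq> \<zero>\<^bsub>T\<^esub>" using I(2) I.zero_closed by blast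
  have tT: "t \<in> carrier T" using t(1) by (rule I.Icarr)
  have z: "\<zero>\<^bsub>T\<^esub> q = \<zero>\<^bsub>A q\<^esub>" if "q \<in> M" for q using that by (simp add: T_def product_ring_simps)
  obtain p where p: "p \<in> M" "t p \<noteq> \<zero>\<^bsub>A p\<^esub>"
    using T_eqI[OF tT T.zero_closed] t(2) z by auto
  interpret p: primeideal p R by (rule prime[OF p(1)])
  interpret Ap: "domain" "A p" by (rule domain_A[OF p(1)])
  have tp: "t p \<in> carrier (A p)" using ring_hom_closed[OF proj[OF p(1)] tT] .
  have "integral_element R (A p) (residue_map R p) (t p)"
    using p.plus_ring_Quot_integral tp by (simp add: integral_extension_def)
  from integral_divides_nonzero[OF domain_A[OF p(1)] cring p.residue_map_hom this p(2)]
  obtain u r where ur: "u \<in> carrier (A p)" "r \<in> carrier R"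
    "t p \<otimes>\<^bsub>A p\<^esub> u = residue_map R p r" "residue_map R p r \<noteq> \<zero>\<^bsub>A p\<^esub>" by blast
  obtain s where s: "s \<in> carrier R" "s \<notin> p" "\<forall>q \<in> M - {p}. s \<in> q"
    using exists_in_other_min_primes[OF p(1)] by blast
  have rs: "r \<otimes> s \<in> carrier R" "r \<otimes> s \<notin> p"
    using p.I_prime[of r s] p.residue_map_eq_zero_iff[OF ur(2)] ur s by auto
  \<comment> \<open>The cofactor \<open>u\<close> belongs to the factor at p and is extended by
    zero. The factor \<open>s\<close> is needed as well: away from p the image of \<open>r\<close>
    need not vanish, while that of \<open>r \<otimes> s\<close> does.\<close>
  define v where "v = (\<lambda>q\<in>M. if q = p then u else \<zero>\<^bsub>A q\<^esub>)"
  have vT: "v \<in> carrier T"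
    using ur(1) cring.cring_simprules(2)[OF cring_A] by (auto simp: v_def T_def product_ring_simps)
  have sT: "\<psi> s \<in> carrier T" "\<psi> (r \<otimes> s) \<in> carrier T"
    using ring_hom_closed[OF \<psi>_hom] s rs by blast+
  have "(t \<otimes>\<^bsub>T\<^esub> v) \<otimes>\<^bsub>T\<^esub> \<psi> s = \<psi> (r \<otimes> s)"
  proof (rule T_eqI)
    show "(t \<otimes>\<^bsub>T\<^esub> v) \<otimes>\<^bsub>T\<^esub> \<psi> s \<in> carrier T" "\<psi> (r \<otimes> s) \<in> carrier T" using tT vT sT by auto
    fix q assume q: "q \<in> M"
    interpret q: primeideal q R by (rule prime[OF q])
    interpret Aq: "domain" "A q" by (rule domain_A[OF q])
    have tq: "t q \<in> carrier (A q)" using ring_hom_closed[OF proj[OF q] tT] .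
    have mq: "residue_map R q s \<in> carrier (A q)" "residue_map R q r \<in> carrier (A q)"
      using ring_hom_closed[OF q.residue_map_hom] s ur by blast+
    have rsq: "residue_map R q (r \<otimes> s) = residue_map R q r \<otimes>\<^bsub>A q\<^esub> residue_map R q s"
      by (rule ring_hom_memE(2)[OF q.residue_map_hom ur(2) s(1)])
    have L: "((t \<otimes>\<^bsub>T\<^esub> v) \<otimes>\<^bsub>T\<^esub> \<psi> s) q = (t q \<otimes>\<^bsub>A q\<^esub> v q) \<otimes>\<^bsub>A q\<^esub> residue_map R q s"
      using q by (simp only: T_def product_ring_simps \<psi>_def restrict_apply' if_True)
    have R: "\<psi> (r \<otimes> s) q = residue_map R q r \<otimes>\<^bsub>A q\<^esub> residue_map R q s"
      using q rsq by (simp only: \<psi>_def restrict_apply')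
    show "((t \<otimes>\<^bsub>T\<^esub> v) \<otimes>\<^bsub>T\<^esub> \<psi> s) q = \<psi> (r \<otimes> s) q"
    proof (cases "q = p")
      case True
      then have "v q = u" using q by (simp add: v_def)
      then show ?thesis unfolding L R using ur(3) True by (simp only:)
    next
      case False
      then have vq: "v q = \<zero>\<^bsub>A q\<^esub>" using q by (simp add: v_def)
      have sq: "residue_map R q s = \<zero>\<^bsub>A q\<^esub>"
        using False q s q.residue_map_eq_zero_iff[OF s(1)] by blast
      show ?thesis unfolding L R sq vq using tq mq(2) by (simp only: Aq.r_null Aq.zero_closed)
    qed
  qed
  moreover have "(t \<otimes>\<^bsub>T\<^esub> v) \<otimes>\<^bsub>T\<^esub> \<psi> s \<in> I"
    using I.I_r_closed[OF I.I_r_closed[OF t(1) vT] sT(1)] .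
  ultimately have "\<psi> (r \<otimes> s) \<in> I \<inter> \<psi> ` carrier R" using rs by auto
  moreover have "\<psi> (r \<otimes> s) \<noteq> \<zero>\<^bsub>T\<^esub>"
  proof
    assume "\<psi> (r \<otimes> s) = \<zero>\<^bsub>T\<^esub>"
    then have "\<psi> (r \<otimes> s) p = \<zero>\<^bsub>A p\<^esub>" by (simp only: z[OF p(1)])
    then have "residue_map R p (r \<otimes> s) = \<zero>\<^bsub>A p\<^esub>" using p(1) by (simp only: \<psi>_def restrict_apply')
    then show False using p.residue_map_eq_zero_iff[OF rs(1)] rs(2) by blast
  qed
  ultimately show "I \<inter> \<psi> ` carrier R \<noteq> {\<zero>\<^bsub>T\<^esub>}" by blast
qed

lemma aic_T: "aic R T \<psi>"
  using cring cring_T \<psi>_hom \<psi>_inj T_ai_closed T_integral T_tight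
  by (simp add: aic_def ring_extension_def)

lemma aicD:
  assumes "aic R S \<phi>"
  shows "cring S" "\<phi> \<in> ring_hom R S" "inj_on \<phi> (carrier R)" "ai_closed S"
    "integral_extension R S \<phi>" "tight_extension R S \<phi>"
  using assms by (auto simp: aic_def ring_extension_def)

text \<open>The prime above p gives a homomorphism into the algebraic closure. As S is integral over
  R, its values satisfy monic equations over R/p and so lie in \<open>A p\<close>.\<close>

lemma hom_to_factor:
  assumes S: "aic R S \<phi>" and p: "p \<in> M"
  shows "\<exists>h \<in> ring_hom S (A p). \<forall>r \<in> carrier R. h (\<phi> r) = residue_map R p r"
proof -
  note S = aicD[OF S]
  let ?D = "R Quot p"
  interpret p: primeideal p R by (rule prime[OF p])
  interpret D: "domain" ?D by (rule p.quotient_is_domain)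
  let ?K = "frac_closure ?D"
  have K: "field ?K" by (rule D.frac_closure_field)
  obtain q where q: "primeideal q S" "\<forall>r \<in> carrier R. \<phi> r \<in> q \<longleftrightarrow> r \<in> p"
    using exists_prime_over_min_prime[OF S(1-3) p] by blast
  have hom: "residue_map R p \<in> ring_hom R ?K"
    using ring_hom_trans[OF p.rcos_ring_hom D.plus_map_hom] by (simp add: comp_def)
  have "\<exists>h \<in> ring_hom S ?K. \<forall>r \<in> carrier R. h (\<phi> r) = residue_map R p r"
    by (rule integral_extension_hom_to_field[OF S(1) K D.frac_closure_roots cring S(2) hom q(1) _ S(5)])
      (use q(2) p.residue_map_eq_zero_iff in auto)
  then obtain h where h: "h \<in> ring_hom S ?K" "\<And>r. r \<in> carrier R \<Longrightarrow> h (\<phi> r) = residue_map R p r" by blast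
  have mem: "h x \<in> carrier (A p)" if x: "x \<in> carrier S" for x
  proof -
    obtain n c where c: "c \<in> {..<n} \<rightarrow> carrier R" "monic_value S n (\<lambda>i. \<phi> (c i)) x = \<zero>\<^bsub>S\<^esub>"
      using S(5) x unfolding integral_extension_def integral_element_iff[OF cring S(1,2)] by blast
    have hx: "h x \<in> carrier ?K" using ring_hom_closed[OF h(1) x] .
    have \<phi>c: "(\<lambda>i. \<phi> (c i)) \<in> {..<n} \<rightarrow> carrier S" using c(1) ring_hom_closed[OF S(2)] by auto
    have "monic_value ?K n (\<lambda>i. residue_map R p (c i)) (h x) = monic_value ?K n (\<lambda>i. h (\<phi> (c i))) (h x)"
    proof (rule cring.monic_value_cong[OF fieldE(1)[OF K] _ _ hx])
      show "residue_map R p (c i) = h (\<phi> (c i))" if "i < n" for i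
        using c(1) that by (intro h(2)[symmetric]) auto
      show "(\<lambda>i. h (\<phi> (c i))) \<in> {..<n} \<rightarrow> carrier ?K"
        using \<phi>c ring_hom_closed[OF h(1)] by auto
    qed
    also have "\<dots> = h (monic_value S n (\<lambda>i. \<phi> (c i)) x)"
      by (rule ring_hom_monic_value[symmetric, OF S(1) fieldE(1)[OF K] h(1) \<phi>c x])
    also have "\<dots> = \<zero>\<^bsub>?K\<^esub>"
      unfolding c(2) using S(1) fieldE(1)[OF K] by (intro ring_hom_zero[OF h(1)]) (simp_all add: cring_def)
    finally have "monic_value ?K n (\<lambda>i. plus_map ?D (p +> c i)) (h x) = \<zero>\<^bsub>?K\<^esub>" .
    moreover have "(\<lambda>i. p +> c i) \<in> {..<n} \<rightarrow> carrier ?D"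
      using c(1) ring_hom_closed[OF p.rcos_ring_hom] by auto
    ultimately show ?thesis
      unfolding D.plus_ring_carrier integral_element_iff[OF D.is_cring fieldE(1)[OF K] D.plus_map_hom]
      using hx by blast
  qed
  have "h \<in> ring_hom S (A p)"
    using h(1) mem by (simp add: ring_hom_def D.plus_ring_simps Pi_def)
  then show ?thesis using h(2) by blast
qed

lemma embeds_T:
  assumes "aic R S \<phi>"
  shows "\<exists>h \<in> ring_hom S T. inj_on h (carrier S) \<and> (\<forall>r \<in> carrier R. h (\<phi> r) = \<psi> r)"
proof -
  note S = aicD[OF assms]
  obtain f where f: "\<And>p. p \<in> M \<Longrightarrow> f p \<in> ring_hom S (A p)"
    "\<And>p r. p \<in> M \<Longrightarrow> r \<in> carrier R \<Longrightarrow> f p (\<phi> r) = residue_map R p r"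
    using hom_to_factor[OF assms] by metis
  let ?h = "\<lambda>x. \<lambda>p\<in>M. f p x"
  have h: "?h \<in> ring_hom S T" unfolding T_def by (rule product_ring_homI[OF f(1)])
  have h\<phi>: "?h (\<phi> r) = \<psi> r" if "r \<in> carrier R" for r
    unfolding \<psi>_def using f(2) that by (intro restrict_ext) auto
  have "inj_on (\<lambda>r. ?h (\<phi> r)) (carrier R)"
    using \<psi>_inj h\<phi> by (simp add: inj_on_def)
  from embedding_of_tight_extension[OF S(1) cring_T S(6) h this cring S(2)]
  have "inj_on ?h (carrier S)" .
  then show ?thesis using h h\<phi> by blast
qed

lemma universal_aic_T: "universal_aic TYPE('b) R T \<psi>"
  using aic_T embeds_T by (auto simp: universal_aic_def algebra_embeds_def)

section \<open>Idempotents of T and the isomorphism criterion\<close>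

definition "coord_idem P = (\<lambda>p\<in>M. if p \<in> P then \<one>\<^bsub>A p\<^esub> else \<zero>\<^bsub>A p\<^esub>)"

text \<open>Each coordinate of an idempotent is an idempotent of a domain, hence 0 or 1, and these
  differ.\<close>

lemma idempotents_T: "bij_betw coord_idem (Pow M) (idempotents T)"
proof (rule bij_betw_imageI)
  have ne: "\<one>\<^bsub>A p\<^esub> \<noteq> \<zero>\<^bsub>A p\<^esub>" if "p \<in> M" for p
    using domain_A[OF that] by (rule domain.one_not_zero)
  show "inj_on coord_idem (Pow M)"
  proof (rule inj_onI)
    fix P Q assume PQ: "P \<in> Pow M" "Q \<in> Pow M" "coord_idem P = coord_idem Q"
    have "p \<in> P \<longleftrightarrow> p \<in> Q" if "p \<in> M" for p
      using fun_cong[OF PQ(3), of p] ne[OF that] that by (auto simp: coord_idem_def split: if_splits)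
    then show "P = Q" using PQ by blast
  qed
  show "coord_idem ` Pow M = idempotents T"
  proof
    show "coord_idem ` Pow M \<subseteq> idempotents T"
    proof
      fix e assume "e \<in> coord_idem ` Pow M"
      then obtain P where e: "e = coord_idem P" by blast
      have c: "\<one>\<^bsub>A p\<^esub> \<in> carrier (A p)" "\<zero>\<^bsub>A p\<^esub> \<in> carrier (A p)" if "p \<in> M" for p
        using cring.cring_simprules(6,2)[OF cring_A[OF that]] .
      have eT: "e \<in> carrier T"
        using c by (auto simp: e coord_idem_def T_def product_ring_simps simp del: restrict_apply)
      interpret T: cring T by (rule cring_T)
      have "e \<otimes>\<^bsub>T\<^esub> e = e"
      proof (rule T_eqI)
        fix p assume p: "p \<in> M"
        interpret Ap: "domain" "A p" by (rule domain_A[OF p])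
        have "(e \<otimes>\<^bsub>T\<^esub> e) p = e p \<otimes>\<^bsub>A p\<^esub> e p"
          using p by (simp only: T_def product_ring_simps restrict_apply' if_True)
        moreover have "e p = \<zero>\<^bsub>A p\<^esub> \<or> e p = \<one>\<^bsub>A p\<^esub>" using p by (simp add: e coord_idem_def)
        ultimately show "(e \<otimes>\<^bsub>T\<^esub> e) p = e p"
          using Ap.l_null[OF Ap.zero_closed] Ap.l_one[OF Ap.one_closed] by metis
      qed (use eT in auto)
      then show "e \<in> idempotents T" using eT by (simp add: idempotents_def)
    qed
    show "idempotents T \<subseteq> coord_idem ` Pow M"
    proof
      fix e assume e: "e \<in> idempotents T"
      then have eT: "e \<in> carrier T" "e \<otimes>\<^bsub>T\<^esub> e = e" by (auto simp: idempotents_def)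
      let ?P = "{p \<in> M. e p = \<one>\<^bsub>A p\<^esub>}"
      have "e = coord_idem ?P"
      proof
        fix p
        show "e p = coord_idem ?P p"
        proof (cases "p \<in> M")
          case True
          interpret Ap: "domain" "A p" by (rule domain_A[OF True])
          have ep: "e p \<in> carrier (A p)" using ring_hom_closed[OF proj[OF True] eT(1)] .
          have "(e \<otimes>\<^bsub>T\<^esub> e) p = e p \<otimes>\<^bsub>A p\<^esub> e p"
            using True by (simp only: T_def product_ring_simps restrict_apply' if_True)
          then have "e p \<otimes>\<^bsub>A p\<^esub> e p = e p" by (simp only: eT(2))
          then have "e p = \<zero>\<^bsub>A p\<^esub> \<or> e p = \<one>\<^bsub>A p\<^esub>" using Ap.idempotent_iff[OF ep] by blast
          then show ?thesis using True by (auto simp: coord_idem_def)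
        next
          case False
          \<comment> \<open>Elements of the product are extensional, so outside M both sides have
            the default value.\<close>
          have "e p = undefined"
            using eT(1) unfolding T_def product_ring_simps by (rule PiE_arb[OF _ False])
          then show ?thesis using False by (simp add: coord_idem_def)
        qed
      qed
      moreover have "?P \<in> Pow M" by blast
      ultimately show "e \<in> coord_idem ` Pow M" by (rule image_eqI)
    qed
  qed
qed

lemma card_idempotents_T: "card (idempotents T) = 2 ^ card M" "finite (idempotents T)"
  using bij_betw_same_card[OF idempotents_T] card_Pow[OF fin] bij_betw_finite[OF idempotents_T] fin
  by simp_all

text \<open>If all idempotents of \<open>T\<close> lie in the image of \<open>S\<close>, then an element of \<open>T\<close> can be assembled
  from its coordinates. By ai closedness of \<open>S\<close>, each coordinate is the coordinate of the image of
  some root in \<open>S\<close>.\<close>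

lemma embedding_surjective:
  assumes S: "aic R S \<phi>" and h: "h \<in> ring_hom S T" "inj_on h (carrier S)"
    "\<And>r. r \<in> carrier R \<Longrightarrow> h (\<phi> r) = \<psi> r"
    and card: "card (idempotents S) = 2 ^ card M"
  shows "h ` carrier S = carrier T"
proof
  note S = aicD[OF S]
  interpret S: cring S by (rule S)
  interpret T: cring T by (rule cring_T)
  show "h ` carrier S \<subseteq> carrier T" using ring_hom_closed[OF h(1)] by blast
  \<comment> \<open>An injection into a finite set of the same cardinality is onto.\<close>
  have idem: "h ` idempotents S = idempotents T"
  proof (rule card_subset_eq[OF card_idempotents_T(2)])
    show "h ` idempotents S \<subseteq> idempotents T" using idempotents_hom[OF h(1)] by blast
    have "inj_on h (idempotents S)" using h(2) by (rule inj_on_subset) (auto simp: idempotents_def)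
    then show "card (h ` idempotents S) = card (idempotents T)"
      using card card_idempotents_T(1) by (simp add: card_image)
  qed
  have "\<exists>u \<in> carrier S. h u = coord_idem {p}" if p: "p \<in> M" for p
  proof -
    have "coord_idem {p} \<in> h ` idempotents S"
      unfolding idem using idempotents_T p by (auto dest: bij_betw_imp_surj_on)
    then show ?thesis by (auto simp: idempotents_def)
  qed
  then obtain u where u: "\<And>p. p \<in> M \<Longrightarrow> u p \<in> carrier S" "\<And>p. p \<in> M \<Longrightarrow> h (u p) = coord_idem {p}"
    by metis
  show "carrier T \<subseteq> h ` carrier S"
  proof
    fix t assume t: "t \<in> carrier T"
    obtain n c where c: "c \<in> {..<n} \<rightarrow> carrier R" "monic_value T n (\<lambda>i. \<psi> (c i)) t = \<zero>\<^bsub>T\<^esub>"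
      using T_integral t unfolding integral_extension_def integral_element_iff[OF cring cring_T \<psi>_hom] by blast
    have \<phi>c: "(\<lambda>i. \<phi> (c i)) \<in> {..<n} \<rightarrow> carrier S" using c(1) ring_hom_closed[OF S(2)] by auto
    have "monic_value T n (\<lambda>i. h (\<phi> (c i))) t = monic_value T n (\<lambda>i. \<psi> (c i)) t"
      using c(1) h(3) t ring_hom_closed[OF \<psi>_hom] by (intro T.monic_value_cong) auto
    with c(2) have "monic_value T n (\<lambda>i. h (\<phi> (c i))) t = \<zero>\<^bsub>T\<^esub>" by simp
    from ai_closedD[OF S(4,1) cring_T h(1) t \<phi>c this]
    obtain m a where a: "a \<in> {..<m::nat} \<rightarrow> carrier S" "finprod T (\<lambda>i. t \<ominus>\<^bsub>T\<^esub> h (a i)) {..<m} = \<zero>\<^bsub>T\<^esub>"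
      by blast
    have ha: "h (a i) \<in> carrier T" if "i < m" for i using a(1) that ring_hom_closed[OF h(1)] by auto
    \<comment> \<open>In the domain \<open>A p\<close> the vanishing product has a vanishing factor;
      which factor depends on p, so no single root needs to hit t.\<close>
    have "\<exists>b \<in> carrier S. h b p = t p" if p: "p \<in> M" for p
    proof -
      interpret Ap: "domain" "A p" by (rule domain_A[OF p])
      interpret pr: ring_hom_cring T "A p" "\<lambda>x. x p"
        by (rule ring_hom_cring_memI[OF cring_T Ap.is_cring proj[OF p]])
      let ?d = "\<lambda>i. t \<ominus>\<^bsub>T\<^esub> h (a i)"
      have d: "?d \<in> {..<m} \<rightarrow> carrier T" using t ha by auto
      have "finprod (A p) ((\<lambda>x. x p) \<circ> ?d) {..<m} = \<zero>\<^bsub>A p\<^esub>"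
        using pr.hom_finprod[OF d] unfolding a(2) pr.hom_zero comp_def by (rule sym)
      moreover have "(\<lambda>x. x p) \<circ> ?d \<in> {..<m} \<rightarrow> carrier (A p)"
        using pr.hom_closed d by (auto simp: Pi_def)
      ultimately obtain i where i: "i < m" "?d i p = \<zero>\<^bsub>A p\<^esub>"
        using Ap.finprod_eq_zeroD[of "{..<m}" "(\<lambda>x. x p) \<circ> ?d"] by auto
      have "t p \<ominus>\<^bsub>A p\<^esub> h (a i) p = \<zero>\<^bsub>A p\<^esub>"
        using i(2) t ha[OF i(1)] unfolding T.minus_eq Ap.minus_eq
        by (simp only: pr.hom_add T.a_inv_closed pr.hom_a_inv)
      then have "t p = h (a i) p"
        using pr.hom_closed[OF t] pr.hom_closed[OF ha[OF i(1)]] by (simp only: Ap.r_right_minus_eq)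
      then show ?thesis using a(1) i(1) by auto
    qed
    then obtain b where b: "\<And>p. p \<in> M \<Longrightarrow> b p \<in> carrier S" "\<And>p. p \<in> M \<Longrightarrow> h (b p) p = t p" by metis
    \<comment> \<open>The image of \<open>u p\<close> is 1 at p and 0 elsewhere, so the sum takes
      from each \<open>b p\<close> exactly its coordinate at p.\<close>
    let ?s = "\<Oplus>\<^bsub>S\<^esub>p\<in>M. u p \<otimes>\<^bsub>S\<^esub> b p"
    have ub: "(\<lambda>p. u p \<otimes>\<^bsub>S\<^esub> b p) \<in> M \<rightarrow> carrier S" using u b by auto
    have sS: "?s \<in> carrier S" by (rule S.finsum_closed[OF ub])
    have "h ?s = t"
    proof (rule T_eqI[OF ring_hom_closed[OF h(1) sS] t])
      fix q assume q: "q \<in> M"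
      interpret Aq: "domain" "A q" by (rule domain_A[OF q])
      let ?g = "\<lambda>x. h x q"
      have g: "?g \<in> ring_hom S (A q)" using ring_hom_trans[OF h(1) proj[OF q]] by (simp only: comp_def)
      interpret g: ring_hom_cring S "A q" ?g by (rule ring_hom_cring_memI[OF S(1) Aq.is_cring g])
      have "?g ?s = (\<Oplus>\<^bsub>A q\<^esub>p\<in>M. (?g \<circ> (\<lambda>p. u p \<otimes>\<^bsub>S\<^esub> b p)) p)" by (rule g.hom_finsum[OF ub])
      also have "\<dots> = (\<Oplus>\<^bsub>A q\<^esub>p\<in>M. if q = p then h (b p) q else \<zero>\<^bsub>A q\<^esub>)"
      proof (rule Aq.finsum_cong')
        show "(\<lambda>p. if q = p then h (b p) q else \<zero>\<^bsub>A q\<^esub>) \<in> M \<rightarrow> carrier (A q)"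
          using g.hom_closed[OF b(1)] Aq.zero_closed by (simp add: Pi_def)
        fix p assume p: "p \<in> M"
        have "(?g \<circ> (\<lambda>p. u p \<otimes>\<^bsub>S\<^esub> b p)) p = ?g (u p) \<otimes>\<^bsub>A q\<^esub> ?g (b p)"
          using g.hom_mult[OF u(1)[OF p] b(1)[OF p]] by (simp only: comp_def)
        also have "?g (u p) = (if q = p then \<one>\<^bsub>A q\<^esub> else \<zero>\<^bsub>A q\<^esub>)"
          using u(2)[OF p] q by (simp add: coord_idem_def)
        finally show "(?g \<circ> (\<lambda>p. u p \<otimes>\<^bsub>S\<^esub> b p)) p = (if q = p then h (b p) q else \<zero>\<^bsub>A q\<^esub>)"
          using Aq.l_one[OF g.hom_closed[OF b(1)[OF p]]] Aq.l_null[OF g.hom_closed[OF b(1)[OF p]]]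
          by (simp only: split: if_splits) auto
      qed simp
      also have "\<dots> = h (b q) q"
        using q fin b g.hom_closed by (intro Aq.finsum_singleton) auto
      finally show "h ?s q = t q" using b(2)[OF q] by simp
    qed
    then show "t \<in> h ` carrier S" using sS by blast
  qed
qed

lemma algebra_iso_iff_card_idempotents:
  assumes S: "aic R S \<phi>"
  shows "algebra_iso R S \<phi> T \<psi> \<longleftrightarrow> card (idempotents S) = 2 ^ card M"
proof
  assume "algebra_iso R S \<phi> T \<psi>"
  then obtain h where "h \<in> ring_iso S T" by (auto simp: algebra_iso_def)
  from bij_betw_same_card[OF bij_betw_idempotents[OF this aicD(1)[OF S]]]
  show "card (idempotents S) = 2 ^ card M" using card_idempotents_T(1) by simp
next
  assume card: "card (idempotents S) = 2 ^ card M"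
  obtain h where h: "h \<in> ring_hom S T" "inj_on h (carrier S)" "\<forall>r \<in> carrier R. h (\<phi> r) = \<psi> r"
    using embeds_T[OF S] by blast
  then have "h ` carrier S = carrier T" using embedding_surjective[OF S] card by blast
  then have "h \<in> ring_iso S T" using h by (simp add: ring_iso_def bij_betw_def)
  then show "algebra_iso R S \<phi> T \<psi>" using h(3) by (auto simp: algebra_iso_def)
qed

text \<open>The kernels of the coordinate maps of an embedding h into T are primes of S, and
  injectivity of h makes their intersection zero. The count of idempotents then reduces the claim to
  comparing exponents of 2.\<close>

lemma card_idempotents_iff_components:
  assumes S: "aic R S \<phi>"
  shows "card (idempotents S) = 2 ^ card M \<longleftrightarrow>
    finite (connected_components_of (Spec S)) \<and> card (connected_components_of (Spec S)) = card M"
proof -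
  note S' = aicD[OF S]
  interpret S: cring S by (rule S')
  obtain h where h: "h \<in> ring_hom S T" "inj_on h (carrier S)" using embeds_T[OF S] by blast
  let ?q = "\<lambda>p. {x \<in> carrier S. h x p = \<zero>\<^bsub>A p\<^esub>}"
  have hom: "(\<lambda>x. h x p) \<in> ring_hom S (A p)" if "p \<in> M" for p
    using ring_hom_trans[OF h(1) proj[OF that]] by (simp only: comp_def)
  have prime: "primeideal (?q p) S" if p: "p \<in> M" for p
  proof (rule primeidealI)
    interpret Ap: "domain" "A p" by (rule domain_A[OF p])
    have hr: "ring_hom_ring S (A p) (\<lambda>x. h x p)"
      by (rule ring_hom_ringI2[OF S.ring_axioms Ap.ring_axioms hom[OF p]])
    show "ideal (?q p) S"
      using ring_hom_ring.kernel_is_ideal[OF hr] by (simp only: a_kernel_def')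
    show "cring S" by (rule S')
    have "h \<one>\<^bsub>S\<^esub> p \<noteq> \<zero>\<^bsub>A p\<^esub>"
      using ring_hom_one[OF hom[OF p]] Ap.one_not_zero by (simp only: not_False_eq_True)
    then show "carrier S \<noteq> ?q p" using S.one_closed by blast
    show "a \<in> ?q p \<or> b \<in> ?q p" if ab: "a \<in> carrier S" "b \<in> carrier S" "a \<otimes>\<^bsub>S\<^esub> b \<in> ?q p" for a b
    proof -
      have "h a p \<otimes>\<^bsub>A p\<^esub> h b p = \<zero>\<^bsub>A p\<^esub>"
        using ring_hom_memE(2)[OF hom[OF p] ab(1,2)] ab(3) by (simp only: mem_Collect_eq)
      then have "h a p = \<zero>\<^bsub>A p\<^esub> \<or> h b p = \<zero>\<^bsub>A p\<^esub>"
        by (rule Ap.integral) (use ring_hom_closed[OF hom[OF p]] ab in auto)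
      then show ?thesis using ab by blast
    qed
  qed
  have zero: "x = \<zero>\<^bsub>S\<^esub>" if x: "x \<in> carrier S" "\<And>q. q \<in> ?q ` M \<Longrightarrow> x \<in> q" for x
  proof -
    interpret T: cring T by (rule cring_T)
    have "h x = \<zero>\<^bsub>T\<^esub>"
    proof (rule T_eqI[OF ring_hom_closed[OF h(1) x(1)] T.zero_closed])
      fix p assume p: "p \<in> M"
      then have "h x p = \<zero>\<^bsub>A p\<^esub>" using x(2)[of "?q p"] by blast
      then show "h x p = \<zero>\<^bsub>T\<^esub> p" using p by (simp add: T_def product_ring_simps)
    qed
    then show ?thesis
      using inj_onD[OF h(2), of x "\<zero>\<^bsub>S\<^esub>"] x(1) ring_hom_zero[OF h(1) S.ring_axioms T.ring_axioms] by simp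
  qed
  define Q where "Q = ?q ` M"
  have Q: "finite Q" "\<And>q. q \<in> Q \<Longrightarrow> primeideal q S" using fin prime by (auto simp: Q_def)
  have "finite (connected_components_of (Spec S))"
    "card (idempotents S) = 2 ^ card (connected_components_of (Spec S))"
    by (rule card_idempotents_eq_power_components[OF S'(1) Q zero[folded Q_def]]; assumption)+
  then show ?thesis by simp
qed

text \<open>The competing rings have the type of T, so T itself embeds into U. With the embedding of
  U into T this bounds each number of idempotents by the other.\<close>

lemma universal_aic_unique:
  assumes "universal_aic TYPE('a plus_product) R U \<upsilon>"
  shows "algebra_iso R U \<upsilon> T \<psi>"
proof -
  have U: "aic R U \<upsilon>" and "algebra_embeds R T \<psi> U \<upsilon>"
    using assms aic_T by (auto simp: universal_aic_def)
  then obtain k where k: "k \<in> ring_hom T U" "inj_on k (carrier T)" by (auto simp: algebra_embeds_def)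
  obtain h where h: "h \<in> ring_hom U T" "inj_on h (carrier U)" using embeds_T[OF U] by blast
  have "inj_on h (idempotents U)" "inj_on k (idempotents T)"
    using h(2) k(2) by (auto intro: inj_on_subset simp: idempotents_def)
  moreover have "h ` idempotents U \<subseteq> idempotents T" "k ` idempotents T \<subseteq> idempotents U"
    using idempotents_hom[OF h(1)] idempotents_hom[OF k(1)] by blast+
  moreover from calculation have "finite (idempotents U)"
    using inj_on_finite card_idempotents_T(2) by blast
  ultimately have "card (idempotents U) = card (idempotents T)"
    by (intro le_antisym card_inj_on_le card_idempotents_T(2))
  then show ?thesis
    using algebra_iso_iff_card_idempotents[OF U] card_idempotents_T(1) by simp
qed

end

theorem theorem1:
  fixes R :: "('a, 'm) ring_scheme"
  assumes "cring R"
    and "reduced_ring R"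
    and "finite (min_primes R)"
  shows
    "(universal_aic TYPE('b) R (plus_product R) (plus_product_map R) \<and>
      (\<forall>(U :: 'b ring) \<upsilon>. universal_aic TYPE('a plus_product) R U \<upsilon> \<longrightarrow>
         algebra_iso R U \<upsilon> (plus_product R) (plus_product_map R))) \<and>
     (\<forall>(S :: 'b ring) \<phi>. aic R S \<phi> \<longrightarrow>
       (algebra_iso R S \<phi> (plus_product R) (plus_product_map R) \<longleftrightarrow>
          card (idempotents S) = 2 ^ card (min_primes R)) \<and>
       (algebra_iso R S \<phi> (plus_product R) (plus_product_map R) \<longleftrightarrow>
          finite (connected_components_of (Spec S)) \<and>
          card (connected_components_of (Spec S)) = card (min_primes R)))"
proof -
  interpret reduced_finite_min_primes R by (intro reduced_finite_min_primes.intro assms)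
  show ?thesis
    using universal_aic_T universal_aic_unique algebra_iso_iff_card_idempotents
      card_idempotents_iff_components by blast
qed

end
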